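(* For each $n\ge 0$ there exists a mapping $\mathfrak{J}_n^{(d)}\colon \mathscr{T}^{(d)}(\mathcal{H})\to \mathscr{T}^{(d)}(\mathcal{H})$ such that $$\big[\mathfrak{J}_n^{(d)}\omega\big](\mathrm{x})=\sum_{\varepsilon\in\Lambda^d} C_n^{(\varepsilon)}\,\omega(\mathrm{x}-\varepsilon)\,C_n^{(\varepsilon)},\qquad \mathrm{x}\in\mathbb{Z}^d,\ \omega\in\mathscr{T}^{(d)}(\mathcal{H}).$$
   Context: Let $d\ge 2$ be a fixed integer, $\mathbb{N}=\{0,1,2,\dots\}$, $\Lambda=\{-1,+1\}$, and $\Gamma$ the set of finite subsets of $\mathbb{N}$. Bernoulli functionals. Let $\Omega$ be the set of all functions $f\colon\mathbb{N}\to\{-1,1\}$, $\zeta_n(f)=f(n)$, $\mathscr{F}$ the $\sigma$-field generated by $(\zeta_n)_{n\ge0}$, $(p_n)_{n\ge0}$ a given sequence with $0<p_n<1$, $q_n=1-p_n$, and $\mathbb{P}$ the unique probability measure on $\mathscr{F}$ with $\mathbb{P}(\zeta_{n_1}=\epsilon_1,\dots,\zeta_{n_k}=\epsilon_k)=\prod_{j=1}^k p_{n_j}^{(1+\epsilon_j)/2}(1-p_{n_j})^{(1-\epsilon_j)/2}$ for all $k\ge 1$, distinct $n_1,\dots,n_k\in\mathbb{N}$ and $\epsilon_j\in\{-1,1\}$. Put $Z_n=(\zeta_n+q_n-p_n)/(2\sqrt{p_nq_n})$, $\mathcal{H}=L^2(\Omega,\mathscr{F},\mathbb{P})$ (complex-valued),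 $Z_\emptyset=1$ and $Z_\sigma=\prod_{j\in\sigma}Z_j$ for nonempty $\sigma\in\Gamma$; $\{Z_\sigma\mid\sigma\in\Gamma\}$ is an orthonormal basis of $\mathcal{H}$. For $k\ge0$, $\partial_k$ is the bounded operator on $\mathcal{H}$ with $\partial_kZ_\sigma=\mathbf{1}_\sigma(k)Z_{\sigma\setminus\{k\}}$; its adjoint satisfies $\partial_k^*Z_\sigma=[1-\mathbf{1}_\sigma(k)]Z_{\sigma\cup\{k\}}$. Put $L_n=\frac12(\partial_n^*+\partial_n-I)$ and $R_n=\frac12(\partial_n^*+\partial_n+I)$, $I$ being the identity on $\mathcal{H}$. Operators $C_n^{(\varepsilon)}$. Fix a unitary isomorphism $\mathsf{K}\colon\mathcal{H}^{\otimes d}\to\mathcal{H}$ ($\mathcal{H}^{\otimes d}$ is the $d$-fold Hilbert space tensor product). For $n\ge0$ and $\varepsilon=(\varepsilon_1,\dots,\varepsilon_d)\in\Lambda^d$ set $C_n^{(\varepsilon)}=\mathsf{K}\big(\bigotimes_{j=1}^dB_n^{(\varepsilon_j)}\big)\mathsf{K}^{-1}$, where $B_n^{(-1)}=L_n$ and $B_n^{(+1)}=R_n$. Nucleuses. $\mathfrak{S}_+(\mathcal{H})$ is the cone of positive trace class operators on $\mathcal{H}$. A $d$-dimensional nucleus on $\mathcal{H}$ is a mapping $\omega\colon\mathbb{Z}^d\to\mathfrak{S}_+(\mathcal{H})$ with $\sum_{\mathrm{x}\in\mathbb{Z}^d}\mathrm{Tr}[\omega(\mathrm{x})]=1$; the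 set of all of them is $\mathscr{T}^{(d)}(\mathcal{H})$. *)

theory Defs
  imports "HOL-Probability.Probability" "HOL-Algebra.Algebraic_Closure_Type"
begin

section \<open>Complex Hilbert spaces on explicit carriers\<close>

text \<open>
  The space of square integrable Bernoulli functionals depends on the parameter sequence, so it
  cannot be a type of its own. Hilbert spaces are therefore modules over the field of complex
  numbers in the sense of HOL-Algebra, enriched by an inner product. As in HOL-Algebra, the
  fields \<open>mult\<close> and \<open>one\<close> of such a record carry no meaning. Inner products are
  conjugate-linear in the first argument.
\<close>

record 'a inner_space = "(complex, 'a) module" +
  ip :: "'a \<Rightarrow> 'a \<Rightarrow> complex"

definition hnorm :: "('a, 'm) inner_space_scheme \<Rightarrow> 'a \<Rightarrow> real" where
  "hnorm H x = sqrt (Re (ip H x x))"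

definition hdist :: "('a, 'm) inner_space_scheme \<Rightarrow> 'a \<Rightarrow> 'a \<Rightarrow> real" where
  "hdist H x y = hnorm H (x \<ominus>\<^bsub>H\<^esub> y)"

definition complex_hilbert_space :: "('a, 'm) inner_space_scheme \<Rightarrow> bool" where
  "complex_hilbert_space H \<longleftrightarrow>
     Module.module (ring_of_type_algebra :: complex ring) H \<and>
     (\<forall>x\<in>carrier H. \<forall>y\<in>carrier H. \<forall>z\<in>carrier H. ip H x (y \<oplus>\<^bsub>H\<^esub> z) = ip H x y + ip H x z) \<and>
     (\<forall>c. \<forall>x\<in>carrier H. \<forall>y\<in>carrier H. ip H x (c \<odot>\<^bsub>H\<^esub> y) = c * ip H x y) \<and>
     (\<forall>x\<in>carrier H. \<forall>y\<in>carrier H. ip H x y = cnj (ip H y x)) \<and>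
     (\<forall>x\<in>carrier H. ip H x x \<in> \<real>\<^sub>\<ge>\<^sub>0) \<and>
     (\<forall>x\<in>carrier H. ip H x x = 0 \<longrightarrow> x = \<zero>\<^bsub>H\<^esub>) \<and>
     (\<forall>s :: nat \<Rightarrow> 'a. range s \<subseteq> carrier H \<and>
        (\<forall>e>0. \<exists>N. \<forall>m\<ge>N. \<forall>n\<ge>N. hdist H (s m) (s n) < e) \<longrightarrow>
        (\<exists>x\<in>carrier H. (\<lambda>n. hdist H (s n) x) \<longlonglongrightarrow> 0))"

definition lin_span :: "('a, 'm) inner_space_scheme \<Rightarrow> 'a set \<Rightarrow> 'a set" where
  "lin_span H S = \<Inter>{W. submodule W (ring_of_type_algebra :: complex ring) H \<and> S \<subseteq> W}"

definition total_in :: "('a, 'm) inner_space_scheme \<Rightarrow> 'a set \<Rightarrow> bool" where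
  "total_in H S \<longleftrightarrow> (\<forall>x\<in>carrier H. \<forall>e>0. \<exists>y\<in>lin_span H S. hdist H x y < e)"

definition orthonormal_basis :: "('a, 'm) inner_space_scheme \<Rightarrow> 'a set \<Rightarrow> bool" where
  "orthonormal_basis H E \<longleftrightarrow> E \<subseteq> carrier H \<and>
     (\<forall>e\<in>E. \<forall>f\<in>E. ip H e f = (if e = f then 1 else 0)) \<and> total_in H E"


section \<open>Operators\<close>

text \<open>
  Operators are extensional functions (undefined outside the carrier), so that HOL equality is
  equality of operators and \<^const>\<open>compose\<close> on the carrier is their product.
\<close>

definition linear_maps ::
  "('a, 'm) inner_space_scheme \<Rightarrow> ('b, 'n) inner_space_scheme \<Rightarrow> ('a \<Rightarrow> 'b) set" where
  "linear_maps V W = {A \<in> carrier V \<rightarrow>\<^sub>E carrier W.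
     (\<forall>x\<in>carrier V. \<forall>y\<in>carrier V. A (x \<oplus>\<^bsub>V\<^esub> y) = A x \<oplus>\<^bsub>W\<^esub> A y) \<and>
     (\<forall>c. \<forall>x\<in>carrier V. A (c \<odot>\<^bsub>V\<^esub> x) = c \<odot>\<^bsub>W\<^esub> A x)}"

definition bounded_ops :: "('a, 'm) inner_space_scheme \<Rightarrow> ('a \<Rightarrow> 'a) set" where
  "bounded_ops H = {A \<in> linear_maps H H. \<exists>M. \<forall>x\<in>carrier H. hnorm H (A x) \<le> M * hnorm H x}"

definition unitary_iso ::
  "('a, 'm) inner_space_scheme \<Rightarrow> ('b, 'n) inner_space_scheme \<Rightarrow> ('a \<Rightarrow> 'b) \<Rightarrow> bool" where
  "unitary_iso V W K \<longleftrightarrow> K \<in> linear_maps V W \<and> bij_betw K (carrier V) (carrier W) \<and>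
     (\<forall>x\<in>carrier V. \<forall>y\<in>carrier V. ip W (K x) (K y) = ip V x y)"

definition op_sum ::
  "('a, 'm) inner_space_scheme \<Rightarrow> ('i \<Rightarrow> 'a \<Rightarrow> 'a) \<Rightarrow> 'i set \<Rightarrow> 'a \<Rightarrow> 'a" where
  "op_sum H A I = (\<lambda>x\<in>carrier H. finsum H (\<lambda>i. A i x) I)"

definition hadjoint :: "('a, 'm) inner_space_scheme \<Rightarrow> ('a \<Rightarrow> 'a) \<Rightarrow> 'a \<Rightarrow> 'a" where
  "hadjoint H A = (THE B. B \<in> bounded_ops H \<and>
     (\<forall>x\<in>carrier H. \<forall>y\<in>carrier H. ip H (B x) y = ip H x (A y)))"

definition positive_ops :: "('a, 'm) inner_space_scheme \<Rightarrow> ('a \<Rightarrow> 'a) set" where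
  "positive_ops H = {A \<in> bounded_ops H. \<forall>x\<in>carrier H. ip H x (A x) \<in> \<real>\<^sub>\<ge>\<^sub>0}"

text \<open>The absolute value \<open>|A|\<close> is the unique positive square root of \<open>A\<^sup>* A\<close>.\<close>

definition abs_op :: "('a, 'm) inner_space_scheme \<Rightarrow> ('a \<Rightarrow> 'a) \<Rightarrow> 'a \<Rightarrow> 'a" where
  "abs_op H A = (THE S. S \<in> positive_ops H \<and>
     compose (carrier H) S S = compose (carrier H) (hadjoint H A) A)"

definition trace_class :: "('a, 'm) inner_space_scheme \<Rightarrow> ('a \<Rightarrow> 'a) set" where
  "trace_class H = {A \<in> bounded_ops H.
     \<exists>E. orthonormal_basis H E \<and> (\<lambda>e. ip H e (abs_op H A e)) summable_on E}"

text \<open>The trace of a trace class operator does not depend on the orthonormal basis.\<close>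

definition op_trace :: "('a, 'm) inner_space_scheme \<Rightarrow> ('a \<Rightarrow> 'a) \<Rightarrow> complex" where
  "op_trace H A = (\<Sum>\<^sub>\<infinity>e\<in>(SOME E. orthonormal_basis H E). ip H e (A e))"

definition pos_trace_class :: "('a, 'm) inner_space_scheme \<Rightarrow> ('a \<Rightarrow> 'a) set" where
  "pos_trace_class H = positive_ops H \<inter> trace_class H"

definition nuclei :: "('a, 'm) inner_space_scheme \<Rightarrow> (int ^ 'd \<Rightarrow> 'a \<Rightarrow> 'a) set" where
  "nuclei H = {\<omega>. (\<forall>x. \<omega> x \<in> pos_trace_class H) \<and>
     ((\<lambda>x. op_trace H (\<omega> x)) has_sum 1) UNIV}"


section \<open>Hilbert space tensor powers\<close>

text \<open>
  \<open>(T, \<tau>)\<close> is a tensor power of \<open>H\<close> with factors indexed by the finite type \<open>'i\<close>, where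
  \<open>\<tau> x\<close> is the elementary tensor of the family \<open>x\<close>. This determines \<open>(T, \<tau>)\<close> up to a unique
  unitary isomorphism compatible with elementary tensors.
\<close>

definition hilbert_tensor_power ::
  "('a, 'm) inner_space_scheme \<Rightarrow> ('t, 'n) inner_space_scheme \<Rightarrow>
     (('i::finite \<Rightarrow> 'a) \<Rightarrow> 't) \<Rightarrow> bool" where
  "hilbert_tensor_power H T \<tau> \<longleftrightarrow> complex_hilbert_space T \<and>
     \<tau> \<in> (UNIV \<rightarrow> carrier H) \<rightarrow> carrier T \<and>
     (\<forall>x\<in>UNIV \<rightarrow> carrier H. \<forall>j. \<forall>u\<in>carrier H. \<forall>v\<in>carrier H.
        \<tau> (x(j := u \<oplus>\<^bsub>H\<^esub> v)) = \<tau> (x(j := u)) \<oplus>\<^bsub>T\<^esub> \<tau> (x(j := v))) \<and>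
     (\<forall>x\<in>UNIV \<rightarrow> carrier H. \<forall>j. \<forall>c. \<forall>u\<in>carrier H.
        \<tau> (x(j := c \<odot>\<^bsub>H\<^esub> u)) = c \<odot>\<^bsub>T\<^esub> \<tau> (x(j := u))) \<and>
     (\<forall>x\<in>UNIV \<rightarrow> carrier H. \<forall>y\<in>UNIV \<rightarrow> carrier H.
        ip T (\<tau> x) (\<tau> y) = (\<Prod>j\<in>UNIV. ip H (x j) (y j))) \<and>
     total_in T (\<tau> ` (UNIV \<rightarrow> carrier H))"

definition tensor_op ::
  "('a, 'm) inner_space_scheme \<Rightarrow> ('t, 'n) inner_space_scheme \<Rightarrow>
     (('i::finite \<Rightarrow> 'a) \<Rightarrow> 't) \<Rightarrow> ('i \<Rightarrow> 'a \<Rightarrow> 'a) \<Rightarrow> 't \<Rightarrow> 't" where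
  "tensor_op H T \<tau> B = (THE A. A \<in> bounded_ops T \<and>
     (\<forall>x\<in>UNIV \<rightarrow> carrier H. A (\<tau> x) = \<tau> (\<lambda>j. B j (x j))))"


section \<open>Bernoulli functionals\<close>

definition bern_space :: "(nat \<Rightarrow> int) set" where
  "bern_space = {f. \<forall>n. f n \<in> {-1, 1}}"

definition bern_measure :: "(nat \<Rightarrow> real) \<Rightarrow> (nat \<Rightarrow> int) measure" where
  "bern_measure p = (THE M. prob_space M \<and> space M = bern_space \<and>
     sets M = sigma_sets bern_space {{f \<in> bern_space. f n \<in> B} | n B. B \<subseteq> {-1, 1}} \<and>
     (\<forall>N e. finite N \<and> N \<noteq> {} \<and> e \<in> N \<rightarrow> {-1, 1} \<longrightarrow>
        measure M {f \<in> bern_space. \<forall>j\<in>N. f j = e j} =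
          (\<Prod>j\<in>N. p j powr ((1 + of_int (e j)) / 2) * (1 - p j) powr ((1 - of_int (e j)) / 2))))"

definition square_integrable :: "'x measure \<Rightarrow> ('x \<Rightarrow> complex) set" where
  "square_integrable M =
     {f \<in> borel_measurable M. integrable M (\<lambda>x. (cmod (f x))\<^sup>2)}"

definition ae_rel :: "'x measure \<Rightarrow> (('x \<Rightarrow> complex) \<times> ('x \<Rightarrow> complex)) set" where
  "ae_rel M = {(f, g). f \<in> square_integrable M \<and> g \<in> square_integrable M \<and>
     (AE x in M. f x = g x)}"

definition ae_class :: "'x measure \<Rightarrow> ('x \<Rightarrow> complex) \<Rightarrow> ('x \<Rightarrow> complex) set" where
  "ae_class M f = ae_rel M `` {f}"

definition rep :: "'b set \<Rightarrow> 'b" where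
  "rep F = (SOME f. f \<in> F)"

definition L2_space :: "'x measure \<Rightarrow> ('x \<Rightarrow> complex) set inner_space" where
  "L2_space M = \<lparr>
     carrier = square_integrable M // ae_rel M,
     mult = undefined, one = undefined,
     zero = ae_class M (\<lambda>_. 0),
     add = (\<lambda>F G. ae_class M (\<lambda>x. rep F x + rep G x)),
     smult = (\<lambda>c F. ae_class M (\<lambda>x. c * rep F x)),
     ip = (\<lambda>F G. \<integral>x. cnj (rep F x) * rep G x \<partial>M)\<rparr>"

type_synonym bern_functional = "((nat \<Rightarrow> int) \<Rightarrow> complex) set"

definition bern_H :: "(nat \<Rightarrow> real) \<Rightarrow> bern_functional inner_space" where
  "bern_H p = L2_space (bern_measure p)"

definition bern_Z :: "(nat \<Rightarrow> real) \<Rightarrow> nat set \<Rightarrow> bern_functional" where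
  "bern_Z p \<sigma> = ae_class (bern_measure p) (\<lambda>f. of_real (\<Prod>j\<in>\<sigma>.
     (of_int (f j) + (1 - p j) - p j) / (2 * sqrt (p j * (1 - p j)))))"

definition annihilation :: "(nat \<Rightarrow> real) \<Rightarrow> nat \<Rightarrow> bern_functional \<Rightarrow> bern_functional" where
  "annihilation p k = (THE D. D \<in> bounded_ops (bern_H p) \<and>
     (\<forall>\<sigma>. finite \<sigma> \<longrightarrow>
        D (bern_Z p \<sigma>) = indicator \<sigma> k \<odot>\<^bsub>bern_H p\<^esub> bern_Z p (\<sigma> - {k})))"

definition creation :: "(nat \<Rightarrow> real) \<Rightarrow> nat \<Rightarrow> bern_functional \<Rightarrow> bern_functional" where
  "creation p k = hadjoint (bern_H p) (annihilation p k)"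

definition bern_L :: "(nat \<Rightarrow> real) \<Rightarrow> nat \<Rightarrow> bern_functional \<Rightarrow> bern_functional" where
  "bern_L p n = (\<lambda>f\<in>carrier (bern_H p). (1 / 2) \<odot>\<^bsub>bern_H p\<^esub>
     ((creation p n f \<oplus>\<^bsub>bern_H p\<^esub> annihilation p n f) \<ominus>\<^bsub>bern_H p\<^esub> f))"

definition bern_R :: "(nat \<Rightarrow> real) \<Rightarrow> nat \<Rightarrow> bern_functional \<Rightarrow> bern_functional" where
  "bern_R p n = (\<lambda>f\<in>carrier (bern_H p). (1 / 2) \<odot>\<^bsub>bern_H p\<^esub>
     ((creation p n f \<oplus>\<^bsub>bern_H p\<^esub> annihilation p n f) \<oplus>\<^bsub>bern_H p\<^esub> f))"

definition signs :: "(int ^ 'd) set" where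
  "signs = {\<epsilon>. \<forall>j. \<epsilon> $ j \<in> {-1, 1}}"

text \<open>Only used for \<open>s = -1\<close> and \<open>s = 1\<close>.\<close>

definition bern_B :: "(nat \<Rightarrow> real) \<Rightarrow> nat \<Rightarrow> int \<Rightarrow> bern_functional \<Rightarrow> bern_functional" where
  "bern_B p n s = (if s = -1 then bern_L p n else bern_R p n)"

definition bern_C ::
  "(nat \<Rightarrow> real) \<Rightarrow> ('t, 'n) inner_space_scheme \<Rightarrow> (('d::finite \<Rightarrow> bern_functional) \<Rightarrow> 't) \<Rightarrow>
     ('t \<Rightarrow> bern_functional) \<Rightarrow> nat \<Rightarrow> int ^ 'd \<Rightarrow> bern_functional \<Rightarrow> bern_functional" where
  "bern_C p T \<tau> K n \<epsilon> = compose (carrier (bern_H p)) K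
     (compose (carrier (bern_H p)) (tensor_op (bern_H p) T \<tau> (\<lambda>j. bern_B p n (\<epsilon> $ j)))
        (inv_into (carrier T) K))"

end

theory Submission
  imports Defs
begin

text \<open>
  Everything rests on two properties of the operators \<open>C\<^sub>\<epsilon>\<close>: each is bounded and symmetric, and
  \<open>\<Sum>\<^sub>\<epsilon> C\<^sub>\<epsilon>\<^sup>2 = I\<close>. Symmetry makes \<open>C\<^sub>\<epsilon> \<omega>(x - \<epsilon>) C\<^sub>\<epsilon>\<close> positive. The resolution of the identity preserves
  the total trace: by cyclicity the term of \<open>\<epsilon>\<close> contributes \<open>Tr (\<omega>(x - \<epsilon>) C\<^sub>\<epsilon>\<^sup>2)\<close> at \<open>x\<close>, the shift by \<open>\<epsilon>\<close>
  disappears in the sum over all \<open>x\<close>, and the sum over \<open>\<epsilon>\<close> then returns \<open>Tr (\<omega>(x))\<close>. This is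
  \<open>nuclei_conjugation\<close>.

  The two properties come from the operator \<open>W = \<partial>\<^sub>n\<^sup>* + \<partial>\<^sub>n\<close>. It permutes the basis \<open>Z\<^sub>\<sigma>\<close> by adding \<open>n\<close> to
  \<open>\<sigma>\<close> or removing it, so it is a symmetric involution (\<open>toggle_involution\<close>). For \<open>s = \<plusminus>1\<close> the operator
  \<open>B\<^sub>s = (W + s I) / 2\<close> is symmetric, and \<open>B\<^sub>-\<^sub>1\<^sup>2 + B\<^sub>1\<^sup>2 = (W\<^sup>2 + I) / 2 = I\<close> (\<open>bern_B_resolution\<close>). In the
  tensor power the sum of \<open>(\<Otimes>\<^sub>j B\<^bsub>\<epsilon>\<^sub>j\<^esub>)\<^sup>2\<close> over all sign vectors factorizes into \<open>d\<close> such sums.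
  Conjugation by the unitary \<open>K\<close> changes nothing.

  Traces are computed from sums of squares: Gaussian elimination along a basis writes the form of
  a positive operator \<open>A\<close> as \<open>\<langle>x, A x\<rangle> = \<Sum>\<^sub>i \<bar>\<langle>v\<^sub>i, x\<rangle>\<bar>\<^sup>2\<close> (\<open>positive_decomposition\<close>), and Parseval's identity
  gives \<open>Tr (C A C) = \<Sum>\<^sub>i \<parallel>C v\<^sub>i\<parallel>\<^sup>2\<close> in every orthonormal basis. Trace class membership refers to \<open>\<bar>A\<bar>\<close>, the
  positive square root of \<open>A\<^sup>* A\<close>; for positive \<open>A\<close> it is \<open>A\<close>, by uniqueness of positive square roots
  (\<open>positive_sqrt_unique\<close>).

  The remaining work is to see that the operators and the measure are what their descriptions say.
  Existence of operators is always obtained from prescribed coordinates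
  (\<open>bounded_op_by_coordinates\<close>), uniqueness from total sets. The Bernoulli measure is a product
  measure, determined by its values on cylinders, and the \<open>Z\<^sub>\<sigma>\<close> span the indicators of cylinders
  (\<open>Z_function_complete\<close>).
\<close>

section \<open>Calculus in Hilbert spaces on carriers\<close>

locale hilbert =
  fixes H :: "('a, 'm) inner_space_scheme" (structure)
  assumes hilbert: "complex_hilbert_space H"
begin

lemma module: "Module.module (ring_of_type_algebra :: complex ring) H"
  using hilbert unfolding complex_hilbert_space_def by blast

end

sublocale hilbert \<subseteq> abelian_group H
  using module Module.module.axioms(2) by blast

context hilbert
begin

lemma smult_carrier [simp, intro]: "x \<in> carrier H \<Longrightarrow> c \<odot> x \<in> carrier H"
  using Module.module.smult_closed[OF module, of c x] by (simp add: ring_of_type_algebra_def)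

lemma ip_add_right [simp]:
  "x \<in> carrier H \<Longrightarrow> y \<in> carrier H \<Longrightarrow> z \<in> carrier H \<Longrightarrow> ip H x (y \<oplus> z) = ip H x y + ip H x z"
  using hilbert unfolding complex_hilbert_space_def by blast

lemma ip_smult_right [simp]:
  "x \<in> carrier H \<Longrightarrow> y \<in> carrier H \<Longrightarrow> ip H x (c \<odot> y) = c * ip H x y"
  using hilbert unfolding complex_hilbert_space_def by blast

lemma ip_cnj: "x \<in> carrier H \<Longrightarrow> y \<in> carrier H \<Longrightarrow> cnj (ip H x y) = ip H y x"
proof -
  assume "x \<in> carrier H" "y \<in> carrier H"
  then have "ip H x y = cnj (ip H y x)"
    using hilbert unfolding complex_hilbert_space_def by blast
  then show ?thesis by simp
qed

lemma ip_flip: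
  assumes "x \<in> carrier H" "y \<in> carrier H" "u \<in> carrier H" "v \<in> carrier H" "ip H x y = ip H u v"
  shows "ip H y x = ip H v u"
  using assms ip_cnj[of x y] ip_cnj[of u v] by simp

lemma ip_add_left [simp]:
  "x \<in> carrier H \<Longrightarrow> y \<in> carrier H \<Longrightarrow> z \<in> carrier H \<Longrightarrow> ip H (y \<oplus> z) x = ip H y x + ip H z x"
  using arg_cong[OF ip_add_right[of x y z], of cnj] by (simp add: ip_cnj del: ip_add_right)

lemma ip_smult_left [simp]:
  "x \<in> carrier H \<Longrightarrow> y \<in> carrier H \<Longrightarrow> ip H (c \<odot> y) x = cnj c * ip H y x"
  using arg_cong[OF ip_smult_right[of x y c], of cnj] by (simp add: ip_cnj del: ip_add_right ip_smult_right)

lemma ip_zero_right [simp]: "x \<in> carrier H \<Longrightarrow> ip H x \<zero> = 0"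
  using ip_add_right[of x \<zero> \<zero>] by simp

lemma ip_zero_left [simp]: "x \<in> carrier H \<Longrightarrow> ip H \<zero> x = 0"
  using ip_add_left[of x \<zero> \<zero>] by simp

lemma ip_uminus_right [simp]: 
  assumes "x \<in> carrier H" "y \<in> carrier H" shows "ip H x (\<ominus> y) = - ip H x y"
proof -
  have "ip H x (y \<oplus> \<ominus> y) = 0" using assms by (simp only: r_neg ip_zero_right)
  then show ?thesis using assms by (simp add: add_eq_0_iff)
qed

lemma ip_minus_right [simp]:
  "x \<in> carrier H \<Longrightarrow> y \<in> carrier H \<Longrightarrow> z \<in> carrier H \<Longrightarrow> ip H x (y \<ominus> z) = ip H x y - ip H x z"
  by (simp add: a_minus_def)

lemma ip_minus_left [simp]:
  "x \<in> carrier H \<Longrightarrow> y \<in> carrier H \<Longrightarrow> z \<in> carrier H \<Longrightarrow> ip H (y \<ominus> z) x = ip H y x - ip H z x"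
  using arg_cong[OF ip_minus_right[of x y z], of cnj] by (simp add: ip_cnj del: ip_add_right ip_smult_right ip_minus_right)

lemma ip_finsum_right:
  assumes "x \<in> carrier H" "f \<in> I \<rightarrow> carrier H"
  shows "ip H x (finsum H f I) = (\<Sum>i\<in>I. ip H x (f i))"
proof (cases "finite I")
  case True
  then show ?thesis using assms(2)
  proof (induction I)
    case empty
    then show ?case using assms by simp
  next
    case (insert a F)
    then show ?case using assms by (auto simp: Pi_iff)
  qed
qed (use assms in simp)

lemma ip_finsum_left:
  assumes "x \<in> carrier H" "f \<in> I \<rightarrow> carrier H"
  shows "ip H (finsum H f I) x = (\<Sum>i\<in>I. ip H (f i) x)"
proof -
  have "ip H (finsum H f I) x = cnj (\<Sum>i\<in>I. ip H x (f i))"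
    using arg_cong[OF ip_finsum_right[OF assms], of cnj] assms by (simp add: ip_cnj)
  then show ?thesis using assms by (simp add: cnj_sum ip_cnj Pi_iff)
qed

lemma ip_self_nonneg: "x \<in> carrier H \<Longrightarrow> ip H x x \<in> \<real>\<^sub>\<ge>\<^sub>0"
  using hilbert unfolding complex_hilbert_space_def by blast

lemma hnorm_nonneg [simp]: "x \<in> carrier H \<Longrightarrow> 0 \<le> hnorm H x"
  using ip_self_nonneg[of x] by (auto simp: hnorm_def complex_nonneg_Reals_iff)

lemma hnorm_sq: "x \<in> carrier H \<Longrightarrow> (hnorm H x)\<^sup>2 = Re (ip H x x)"
  using ip_self_nonneg[of x] by (auto simp: hnorm_def complex_nonneg_Reals_iff)

lemma ip_self: "x \<in> carrier H \<Longrightarrow> ip H x x = of_real ((hnorm H x)\<^sup>2)"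
  using ip_self_nonneg[of x] by (auto simp: hnorm_sq complex_eq_iff complex_nonneg_Reals_iff)

lemma ip_self_eq_0: "x \<in> carrier H \<Longrightarrow> ip H x x = 0 \<Longrightarrow> x = \<zero>"
  using hilbert unfolding complex_hilbert_space_def by blast

lemma hnorm_eq_0: "x \<in> carrier H \<Longrightarrow> hnorm H x = 0 \<Longrightarrow> x = \<zero>"
  using ip_self ip_self_eq_0 by simp

lemma minus_eq_zeroD:
  assumes "x \<in> carrier H" "y \<in> carrier H" "x \<ominus> y = \<zero>"
  shows "x = y"
  using assms minus_equality[of x "\<ominus> y"] by (simp add: a_minus_def)

text \<open>
  Vectors are compared by testing them against all vectors: this turns every identity of vectors
  into an identity of complex numbers, where the simplifier has a normal form.
\<close>

lemma ip_eqI: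
  assumes "x \<in> carrier H" "y \<in> carrier H" "\<And>z. z \<in> carrier H \<Longrightarrow> ip H z x = ip H z y"
  shows "x = y"
proof -
  have "x \<ominus> y = \<zero>" using assms by (intro ip_self_eq_0) auto
  then show ?thesis using assms(1,2) minus_eq_zeroD by blast
qed

text \<open>
  The quadratic polynomial \<open>s (x - t c y) (x - t c y)\<close> in the real variable \<open>t\<close>, with
  \<open>c = s y x\<close>, is nonnegative. If \<open>s y y > 0\<close> it is evaluated at \<open>t = 1 / s y y\<close>, its minimum; if
  \<open>s y y = 0\<close> it is affine in \<open>t\<close>, and so its slope must vanish.
\<close>

lemma form_cauchy_schwarz:
  assumes add: "\<And>x y z. x \<in> carrier H \<Longrightarrow> y \<in> carrier H \<Longrightarrow> z \<in> carrier H \<Longrightarrow> s x (y \<oplus> z) = s x y + s x z"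
    and smult: "\<And>c x y. x \<in> carrier H \<Longrightarrow> y \<in> carrier H \<Longrightarrow> s x (c \<odot> y) = c * s x y"
    and herm: "\<And>x y. x \<in> carrier H \<Longrightarrow> y \<in> carrier H \<Longrightarrow> cnj (s x y) = s y x"
    and pos: "\<And>x. x \<in> carrier H \<Longrightarrow> s x x \<in> \<real>\<^sub>\<ge>\<^sub>0"
    and xy: "x \<in> carrier H" "y \<in> carrier H"
  shows "(cmod (s x y))\<^sup>2 \<le> Re (s x x) * Re (s y y)"
proof -
  define a b c where "a = Re (s x x)" and "b = Re (s y y)" and "c = s y x"
  have re: "s z z = of_real (Re (s z z))" "0 \<le> Re (s z z)" if "z \<in> carrier H" for z
    using pos[OF that] by (auto simp: complex_eq_iff complex_nonneg_Reals_iff)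
  have ab: "s x x = of_real a" "s y y = of_real b" "s x y = cnj c" "0 \<le> a" "0 \<le> b"
    using re xy herm by (auto simp: a_def b_def c_def)
  have left: "s (u \<oplus> v) w = s u w + s v w" "s (k \<odot> u) w = cnj k * s u w"
    if "u \<in> carrier H" "v \<in> carrier H" "w \<in> carrier H" for u v w k
    using that arg_cong[OF add[of w u v], of cnj] arg_cong[OF smult[of w u k], of cnj] by (simp_all add: herm)
  have quad: "0 \<le> a - 2 * t * (cmod c)\<^sup>2 + t\<^sup>2 * (cmod c)\<^sup>2 * b" for t :: real
  proof -
    let ?z = "x \<oplus> (of_real (-t) * c) \<odot> y"
    have "s ?z ?z = of_real a + of_real (-2 * t) * (c * cnj c) + of_real (t\<^sup>2) * (c * cnj c) * of_real b"
      using xy by (simp add: add smult left ab c_def[symmetric] algebra_simps power2_eq_square)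
    also have "\<dots> = of_real (a - 2 * t * (cmod c)\<^sup>2 + t\<^sup>2 * (cmod c)\<^sup>2 * b)"
      by (simp add: complex_norm_square[symmetric])
    finally show ?thesis using re(2)[of ?z] xy by simp
  qed
  have "(cmod c)\<^sup>2 \<le> a * b"
  proof (cases "b = 0")
    case True
    have "(cmod c)\<^sup>2 = 0"
    proof (rule ccontr)
      assume "(cmod c)\<^sup>2 \<noteq> 0"
      then show False using quad[of "(a + 1) / (2 * (cmod c)\<^sup>2)"] True by simp
    qed
    then show ?thesis using True by simp
  next
    case False
    then have "0 < b" using ab by simp
    have "0 \<le> a - (cmod c)\<^sup>2 / b"
      using quad[of "1 / b"] \<open>0 < b\<close> by (simp add: power2_eq_square field_simps)
    then show ?thesis using \<open>0 < b\<close> by (simp add: field_simps)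
  qed
  then show ?thesis by (simp add: a_def b_def c_def herm[OF xy, symmetric])
qed

lemma cauchy_schwarz:
  assumes "x \<in> carrier H" "y \<in> carrier H"
  shows "cmod (ip H x y) \<le> hnorm H x * hnorm H y"
proof -
  have "(cmod (ip H x y))\<^sup>2 \<le> Re (ip H x x) * Re (ip H y y)"
    using assms by (intro form_cauchy_schwarz) (auto simp: ip_cnj ip_self_nonneg)
  then have "(cmod (ip H x y))\<^sup>2 \<le> (hnorm H x * hnorm H y)\<^sup>2"
    using assms by (simp add: hnorm_sq power_mult_distrib)
  then show ?thesis using assms by (auto intro: power2_le_imp_le)
qed

lemma hnorm_smult: "x \<in> carrier H \<Longrightarrow> hnorm H (c \<odot> x) = cmod c * hnorm H x"
proof (rule power2_eq_imp_eq)
  assume x: "x \<in> carrier H"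
  have "of_real ((hnorm H (c \<odot> x))\<^sup>2) = (c * cnj c) * of_real ((hnorm H x)\<^sup>2)"
    using x by (simp add: ip_self[symmetric] del: of_real_power)
  also have "\<dots> = of_real ((cmod c * hnorm H x)\<^sup>2)"
    by (simp add: complex_norm_square[symmetric] power_mult_distrib)
  finally show "(hnorm H (c \<odot> x))\<^sup>2 = (cmod c * hnorm H x)\<^sup>2" by (simp only: of_real_eq_iff)
qed auto

lemma hnorm_triangle:
  assumes "x \<in> carrier H" "y \<in> carrier H"
  shows "hnorm H (x \<oplus> y) \<le> hnorm H x + hnorm H y"
proof (rule power2_le_imp_le)
  have "(hnorm H (x \<oplus> y))\<^sup>2 = (hnorm H x)\<^sup>2 + 2 * Re (ip H x y) + (hnorm H y)\<^sup>2"
    using assms ip_cnj[of x y] by (auto simp: hnorm_sq complex_eq_iff)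
  also have "\<dots> \<le> (hnorm H x)\<^sup>2 + 2 * (hnorm H x * hnorm H y) + (hnorm H y)\<^sup>2"
    using cauchy_schwarz[OF assms] complex_Re_le_cmod[of "ip H x y"] by linarith
  finally show "(hnorm H (x \<oplus> y))\<^sup>2 \<le> (hnorm H x + hnorm H y)\<^sup>2"
    by (simp add: power2_eq_square algebra_simps)
qed (use assms in simp)

lemma complete:
  assumes "\<And>n. s n \<in> carrier H"
    and "\<And>e. e > 0 \<Longrightarrow> \<exists>N. \<forall>m\<ge>N. \<forall>n\<ge>N. hdist H (s m) (s n) < e"
  obtains x where "x \<in> carrier H" "(\<lambda>n. hdist H (s n) x) \<longlonglongrightarrow> 0"
proof -
  have "range s \<subseteq> carrier H" using assms(1) by blast
  moreover have "\<forall>e>0. \<exists>N. \<forall>m\<ge>N. \<forall>n\<ge>N. hdist H (s m) (s n) < e" using assms(2) by blast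
  ultimately have "\<exists>x\<in>carrier H. (\<lambda>n. hdist H (s n) x) \<longlonglongrightarrow> 0"
    using hilbert unfolding complex_hilbert_space_def by blast
  then show ?thesis using that by blast
qed

lemma tendsto_ip:
  assumes "\<And>n. s n \<in> carrier H" "x \<in> carrier H" "z \<in> carrier H" "(\<lambda>n. hdist H (s n) x) \<longlonglongrightarrow> 0"
  shows "(\<lambda>n. ip H z (s n)) \<longlonglongrightarrow> ip H z x"
proof -
  have "(\<lambda>n. ip H z (s n) - ip H z x) \<longlonglongrightarrow> 0"
  proof (rule Lim_null_comparison)
    show "\<forall>\<^sub>F n in sequentially. norm (ip H z (s n) - ip H z x) \<le> hnorm H z * hdist H (s n) x"
      using assms cauchy_schwarz[of z "s _ \<ominus> x"] by (intro always_eventually) (auto simp: hdist_def)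
    show "(\<lambda>n. hnorm H z * hdist H (s n) x) \<longlonglongrightarrow> 0"
      using tendsto_mult_right_zero[OF assms(4)] by simp
  qed
  then show ?thesis by (simp add: LIM_zero_iff)
qed

subsection \<open>Total sets\<close>

lemma complex_submoduleI:
  assumes "W \<subseteq> carrier H" "\<zero> \<in> W" "\<And>x y. x \<in> W \<Longrightarrow> y \<in> W \<Longrightarrow> x \<oplus> y \<in> W"
    and "\<And>c x. x \<in> W \<Longrightarrow> c \<odot> x \<in> W"
  shows "submodule W (ring_of_type_algebra :: complex ring) H"
proof (rule Module.module.submoduleI[OF module])
  show "\<ominus> x \<in> W" if "x \<in> W" for x
  proof -
    have "x \<in> carrier H" using that assms(1) by blast
    then have "\<ominus> x = (-1) \<odot> x" by (intro ip_eqI) auto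
    then show ?thesis using assms(4)[OF that] by simp
  qed
qed (use assms in auto)

text \<open>The kernel of a bounded functional is a closed subspace.\<close>

lemma functional_zero_on_total:
  assumes tot: "total_in H S" "S \<subseteq> carrier H"
    and add: "\<And>x y. x \<in> carrier H \<Longrightarrow> y \<in> carrier H \<Longrightarrow> \<phi> (x \<oplus> y) = \<phi> x + \<phi> y"
    and smult: "\<And>c x. x \<in> carrier H \<Longrightarrow> \<phi> (c \<odot> x) = c * \<phi> x"
    and bdd: "\<And>x. x \<in> carrier H \<Longrightarrow> cmod (\<phi> x) \<le> C * hnorm H x"
    and zero: "\<And>x. x \<in> S \<Longrightarrow> \<phi> x = 0"
    and x: "x \<in> carrier H"
  shows "\<phi> x = 0"
proof -
  let ?W = "{y \<in> carrier H. \<phi> y = 0}"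
  have "\<phi> \<zero> = 0" using add[of \<zero> \<zero>] by simp
  then have "submodule ?W (ring_of_type_algebra :: complex ring) H"
    by (intro complex_submoduleI) (auto simp: add smult)
  then have span: "lin_span H S \<subseteq> ?W"
    using tot(2) zero unfolding lin_span_def by (intro Inter_lower) auto
  have "cmod (\<phi> x) \<le> 0 + e" if "e > 0" for e
  proof -
    obtain y where y: "y \<in> lin_span H S" "hdist H x y < e / (\<bar>C\<bar> + 1)"
      using tot(1) x \<open>e > 0\<close> unfolding total_in_def by (meson abs_ge_zero add_nonneg_pos divide_pos_pos zero_less_one)
    then have yc: "y \<in> carrier H" "\<phi> y = 0" using span by auto
    have "\<phi> ((x \<ominus> y) \<oplus> y) = \<phi> (x \<ominus> y) + \<phi> y" using x yc by (intro add) auto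
    moreover have "(x \<ominus> y) \<oplus> y = x" using x yc by (intro ip_eqI) auto
    ultimately have "\<phi> x = \<phi> (x \<ominus> y)" using yc by simp
    then have "cmod (\<phi> x) \<le> C * hdist H x y" using bdd[of "x \<ominus> y"] x yc by (simp add: hdist_def)
    also have "\<dots> \<le> (\<bar>C\<bar> + 1) * hdist H x y"
      using x yc by (intro mult_right_mono) (auto simp: hdist_def)
    also have "\<dots> \<le> (\<bar>C\<bar> + 1) * (e / (\<bar>C\<bar> + 1))"
      using y(2) by (intro mult_left_mono) auto
    also have "\<dots> = e" by (simp add: add_nonneg_eq_0_iff)
    finally show ?thesis by simp
  qed
  then have "cmod (\<phi> x) \<le> 0" using field_le_epsilon by blast
  then show ?thesis by simp
qed

lemma eq_on_total:
  assumes "total_in H S" "S \<subseteq> carrier H" "x \<in> carrier H" "y \<in> carrier H"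
    and "\<And>s. s \<in> S \<Longrightarrow> ip H s x = ip H s y"
  shows "x = y"
proof -
  have "ip H (x \<ominus> y) z = 0" if "z \<in> carrier H" for z
  proof (rule functional_zero_on_total[OF assms(1,2) _ _ _ _ that])
    show "cmod (ip H (x \<ominus> y) z) \<le> hnorm H (x \<ominus> y) * hnorm H z" if "z \<in> carrier H" for z
      using assms that by (intro cauchy_schwarz) auto
    show "ip H (x \<ominus> y) z = 0" if "z \<in> S" for z
      using assms that ip_cnj[of z x] ip_cnj[of z y] by auto
  qed (use assms in auto)
  then have "x \<ominus> y = \<zero>" using assms by (intro ip_self_eq_0) auto
  then show ?thesis using assms minus_eq_zeroD by blast
qed

subsection \<open>Bounded operators\<close>

lemma bounded_opsI:
  assumes "\<And>x. x \<in> carrier H \<Longrightarrow> A x \<in> carrier H" "\<And>x. x \<notin> carrier H \<Longrightarrow> A x = undefined"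
    and "\<And>x y. x \<in> carrier H \<Longrightarrow> y \<in> carrier H \<Longrightarrow> A (x \<oplus> y) = A x \<oplus> A y"
    and "\<And>c x. x \<in> carrier H \<Longrightarrow> A (c \<odot> x) = c \<odot> A x"
    and "\<And>x. x \<in> carrier H \<Longrightarrow> hnorm H (A x) \<le> M * hnorm H x"
  shows "A \<in> bounded_ops H"
proof -
  have "\<exists>M. \<forall>x\<in>carrier H. hnorm H (A x) \<le> M * hnorm H x" using assms(5) by blast
  then show ?thesis
    using assms(1-4) unfolding bounded_ops_def linear_maps_def by (auto simp: PiE_def extensional_def)
qed

lemma
  assumes "A \<in> bounded_ops H"
  shows op_carrier: "x \<in> carrier H \<Longrightarrow> A x \<in> carrier H"
    and op_undefined: "x \<notin> carrier H \<Longrightarrow> A x = undefined"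
    and op_add: "x \<in> carrier H \<Longrightarrow> y \<in> carrier H \<Longrightarrow> A (x \<oplus> y) = A x \<oplus> A y"
    and op_smult: "x \<in> carrier H \<Longrightarrow> A (c \<odot> x) = c \<odot> A x"
  using assms unfolding bounded_ops_def linear_maps_def by (auto simp: PiE_def extensional_def)

lemma op_minus:
  assumes "A \<in> bounded_ops H" "x \<in> carrier H" "y \<in> carrier H"
  shows "A (x \<ominus> y) = A x \<ominus> A y"
proof -
  have "x \<ominus> y = x \<oplus> (-1) \<odot> y" using assms by (intro ip_eqI) auto
  then have "A (x \<ominus> y) = A x \<oplus> (-1) \<odot> A y" using assms by (simp add: op_add op_smult)
  also have "\<dots> = A x \<ominus> A y" using assms by (intro ip_eqI) (auto simp: op_carrier)
  finally show ?thesis .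
qed

lemma op_finsum:
  assumes "A \<in> bounded_ops H" "f \<in> I \<rightarrow> carrier H" "finite I"
  shows "A (finsum H f I) = finsum H (\<lambda>i. A (f i)) I"
  using assms(3,2)
proof (induction I)
  case empty
  have "A \<zero> = A (0 \<odot> \<zero>)" by (intro arg_cong[of _ _ A] ip_eqI) auto
  also have "\<dots> = 0 \<odot> A \<zero>" using assms(1) by (simp add: op_smult)
  also have "\<dots> = \<zero>" using assms(1) by (intro ip_eqI) (auto simp: op_carrier)
  finally show ?case by simp
next
  case (insert a F)
  then show ?case using assms(1) by (auto simp: op_add op_carrier Pi_iff)
qed

lemma op_eqI:
  assumes "A \<in> bounded_ops H" "B \<in> bounded_ops H" "\<And>x. x \<in> carrier H \<Longrightarrow> A x = B x"
  shows "A = B"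
  using assms op_undefined by (metis ext)

lemma op_bound:
  assumes "A \<in> bounded_ops H"
  obtains M where "M \<ge> 0" "\<And>x. x \<in> carrier H \<Longrightarrow> hnorm H (A x) \<le> M * hnorm H x"
proof -
  obtain M where M: "\<And>x. x \<in> carrier H \<Longrightarrow> hnorm H (A x) \<le> M * hnorm H x"
    using assms unfolding bounded_ops_def by auto
  have "hnorm H (A x) \<le> \<bar>M\<bar> * hnorm H x" if "x \<in> carrier H" for x
    using M[OF that] mult_right_mono[OF abs_ge_self[of M] hnorm_nonneg[OF that]] by linarith
  then show ?thesis using that[of "\<bar>M\<bar>"] by simp
qed

lemma op_eq_on_total:
  assumes "total_in H S" "S \<subseteq> carrier H" "A \<in> bounded_ops H" "B \<in> bounded_ops H"
    and "\<And>x. x \<in> S \<Longrightarrow> A x = B x"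
  shows "A = B"
proof (rule op_eqI[OF assms(3,4)])
  fix x assume x: "x \<in> carrier H"
  obtain M N where MN: "\<And>x. x \<in> carrier H \<Longrightarrow> hnorm H (A x) \<le> M * hnorm H x"
      "\<And>x. x \<in> carrier H \<Longrightarrow> hnorm H (B x) \<le> N * hnorm H x"
    using op_bound[OF assms(3)] op_bound[OF assms(4)] by metis
  note op = assms(3,4)[THEN op_carrier] 
  show "A x = B x"
  proof (rule ip_eqI)
    fix z assume z: "z \<in> carrier H"
    have "ip H z (A x) - ip H z (B x) = 0"
    proof (rule functional_zero_on_total[OF assms(1,2) _ _ _ _ x])
      show "cmod (ip H z (A y) - ip H z (B y)) \<le> (hnorm H z * (M + N)) * hnorm H y" if y: "y \<in> carrier H" for y
      proof -
        have "cmod (ip H z (A y) - ip H z (B y)) \<le> cmod (ip H z (A y)) + cmod (ip H z (B y))"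
          by (rule norm_triangle_ineq4)
        also have "\<dots> \<le> hnorm H z * hnorm H (A y) + hnorm H z * hnorm H (B y)"
          using z y op by (intro add_mono cauchy_schwarz) auto
        also have "\<dots> \<le> hnorm H z * (M * hnorm H y) + hnorm H z * (N * hnorm H y)"
          using z y MN by (intro add_mono mult_left_mono) auto
        finally show ?thesis by (simp add: algebra_simps)
      qed
    qed (use assms z op in \<open>auto simp: op_add op_smult algebra_simps\<close>)
    then show "ip H z (A x) = ip H z (B x)" by simp
  qed (use x op in auto)
qed

lemma bounded_ops_compose:
  assumes "A \<in> bounded_ops H" "B \<in> bounded_ops H"
  shows "compose (carrier H) A B \<in> bounded_ops H"
proof -
  obtain M N where MN: "M \<ge> 0" "\<And>x. x \<in> carrier H \<Longrightarrow> hnorm H (A x) \<le> M * hnorm H x"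
      "\<And>x. x \<in> carrier H \<Longrightarrow> hnorm H (B x) \<le> N * hnorm H x"
    using op_bound[OF assms(1)] op_bound[OF assms(2)] by metis
  have "hnorm H (A (B x)) \<le> (M * N) * hnorm H x" if x: "x \<in> carrier H" for x
    using MN(2)[of "B x"] mult_left_mono[OF MN(3)[OF x] MN(1)] op_carrier[OF assms(2) x] by simp
  then show ?thesis
    using assms by (intro bounded_opsI[where M = "M * N"])
      (auto simp: compose_def op_carrier op_add op_smult)
qed

lemma bounded_ops_smult:
  assumes "A \<in> bounded_ops H"
  shows "(\<lambda>x\<in>carrier H. c \<odot> A x) \<in> bounded_ops H"
proof -
  obtain M where M: "\<And>x. x \<in> carrier H \<Longrightarrow> hnorm H (A x) \<le> M * hnorm H x"
    using op_bound[OF assms] by metis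
  have "hnorm H (c \<odot> A x) \<le> (cmod c * M) * hnorm H x" if x: "x \<in> carrier H" for x
    using mult_left_mono[OF M[OF x], of "cmod c"] x assms by (simp add: hnorm_smult op_carrier)
  moreover have "c \<odot> (A x \<oplus> A y) = c \<odot> A x \<oplus> c \<odot> A y" "c \<odot> (d \<odot> A x) = d \<odot> (c \<odot> A x)"
    if "x \<in> carrier H" "y \<in> carrier H" for x y d
    using that assms by (auto intro!: ip_eqI simp: op_carrier algebra_simps)
  ultimately show ?thesis
    using assms by (intro bounded_opsI[where M = "cmod c * M"]) (auto simp: op_carrier op_add op_smult)
qed

lemma bounded_ops_zero: "(\<lambda>x\<in>carrier H. \<zero>) \<in> bounded_ops H"
  by (rule bounded_opsI[where M = 0]) (auto intro: ip_eqI simp: hnorm_def)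

lemma bounded_ops_add:
  assumes "A \<in> bounded_ops H" "B \<in> bounded_ops H"
  shows "(\<lambda>x\<in>carrier H. A x \<oplus> B x) \<in> bounded_ops H"
proof -
  obtain M N where MN: "\<And>x. x \<in> carrier H \<Longrightarrow> hnorm H (A x) \<le> M * hnorm H x"
      "\<And>x. x \<in> carrier H \<Longrightarrow> hnorm H (B x) \<le> N * hnorm H x"
    using op_bound[OF assms(1)] op_bound[OF assms(2)] by metis
  have "hnorm H (A x \<oplus> B x) \<le> (M + N) * hnorm H x" if x: "x \<in> carrier H" for x
  proof -
    have "hnorm H (A x \<oplus> B x) \<le> hnorm H (A x) + hnorm H (B x)"
      using assms x by (intro hnorm_triangle) (auto simp: op_carrier)
    then show ?thesis using MN(1)[OF x] MN(2)[OF x] by (simp add: algebra_simps)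
  qed
  moreover have "(A x \<oplus> A y) \<oplus> (B x \<oplus> B y) = (A x \<oplus> B x) \<oplus> (A y \<oplus> B y)"
    "c \<odot> A x \<oplus> c \<odot> B x = c \<odot> (A x \<oplus> B x)"
    if "x \<in> carrier H" "y \<in> carrier H" for x y c
    using that assms by (auto intro!: ip_eqI simp: op_carrier algebra_simps)
  ultimately show ?thesis
    using assms by (intro bounded_opsI[where M = "M + N"]) (auto simp: op_carrier op_add op_smult)
qed

lemma bounded_ops_op_sum:
  assumes "finite I" "\<And>i. i \<in> I \<Longrightarrow> A i \<in> bounded_ops H"
  shows "op_sum H A I \<in> bounded_ops H"
  using assms
proof (induction I)
  case empty
  then show ?case using bounded_ops_zero by (simp add: op_sum_def del: restrict_apply)
next
  case (insert a F)
  have "op_sum H A (insert a F) = (\<lambda>x\<in>carrier H. A a x \<oplus> op_sum H A F x)"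
    using insert.hyps insert.prems by (auto simp: op_sum_def Pi_iff op_carrier intro!: restrict_ext finsum_insert)
  then show ?case using insert bounded_ops_add by (simp del: restrict_apply)
qed

end

section \<open>Orthonormal families\<close>

context hilbert
begin

definition orthonormal :: "('i \<Rightarrow> 'a) \<Rightarrow> 'i set \<Rightarrow> bool" where
  "orthonormal e I \<longleftrightarrow> (\<forall>i\<in>I. e i \<in> carrier H) \<and>
     (\<forall>i\<in>I. \<forall>j\<in>I. ip H (e i) (e j) = (if i = j then 1 else 0))"

text \<open>
  Families rather than sets, because the bases of Bernoulli functionals and of elementary tensors come
  with natural index sets. Completeness is stated as triviality of the orthogonal complement, which is
  what measure theory provides for the \<open>Z\<^sub>\<sigma>\<close>.
\<close>

definition hilbert_basis :: "('i \<Rightarrow> 'a) \<Rightarrow> 'i set \<Rightarrow> bool" where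
  "hilbert_basis e I \<longleftrightarrow> orthonormal e I \<and>
     (\<forall>x\<in>carrier H. (\<forall>i\<in>I. ip H (e i) x = 0) \<longrightarrow> x = \<zero>)"

lemma orthonormalD:
  assumes "orthonormal e I"
  shows "i \<in> I \<Longrightarrow> e i \<in> carrier H"
    and "i \<in> I \<Longrightarrow> j \<in> I \<Longrightarrow> ip H (e i) (e j) = (if i = j then 1 else 0)"
  using assms by (auto simp: orthonormal_def)

lemma hilbert_basis_eqI:
  assumes "hilbert_basis e I" "x \<in> carrier H" "y \<in> carrier H"
    and "\<And>i. i \<in> I \<Longrightarrow> ip H (e i) x = ip H (e i) y"
  shows "x = y"
  using assms orthonormalD(1)[of e I] minus_eq_zeroD[of x y] by (auto simp: hilbert_basis_def)

lemma hdist_commute: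
  assumes "x \<in> carrier H" "y \<in> carrier H"
  shows "hdist H x y = hdist H y x"
  using assms by (simp add: hdist_def hnorm_def)

lemma ip_lincomb_right:
  assumes "orthonormal e I" "finite F" "F \<subseteq> I" "i \<in> I"
  shows "ip H (e i) (\<Oplus>j\<in>F. c j \<odot> e j) = (if i \<in> F then c i else 0)"
proof -
  have e: "e j \<in> carrier H" if "j \<in> I" for j using orthonormalD(1)[OF assms(1) that] .
  have "ip H (e i) (\<Oplus>j\<in>F. c j \<odot> e j) = (\<Sum>j\<in>F. ip H (e i) (c j \<odot> e j))"
    using assms e by (intro ip_finsum_right) auto
  also have "\<dots> = (\<Sum>j\<in>F. if i = j then c j else 0)"
    using assms e orthonormalD(2)[OF assms(1)] by (intro sum.cong) (auto simp: subset_eq)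
  finally show ?thesis using assms by simp
qed

lemma ip_lincomb:
  assumes "orthonormal e I" "finite F" "finite G" "F \<subseteq> G" "G \<subseteq> I"
  shows "ip H (\<Oplus>j\<in>F. c j \<odot> e j) (\<Oplus>j\<in>G. c j \<odot> e j) = of_real (\<Sum>j\<in>F. (cmod (c j))\<^sup>2)"
proof -
  have e: "e j \<in> carrier H" if "j \<in> I" for j using orthonormalD(1)[OF assms(1) that] .
  have "ip H (\<Oplus>j\<in>F. c j \<odot> e j) (\<Oplus>j\<in>G. c j \<odot> e j)
      = (\<Sum>i\<in>F. ip H (c i \<odot> e i) (\<Oplus>j\<in>G. c j \<odot> e j))"
    using assms e by (intro ip_finsum_left) (auto simp: Pi_iff subset_eq)
  also have "\<dots> = (\<Sum>i\<in>F. cnj (c i) * c i)"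
  proof (intro sum.cong refl)
    fix i assume i: "i \<in> F"
    have "(\<Oplus>j\<in>G. c j \<odot> e j) \<in> carrier H" using assms e by (intro finsum_closed) auto
    then show "ip H (c i \<odot> e i) (\<Oplus>j\<in>G. c j \<odot> e j) = cnj (c i) * c i"
      using assms(4,5) e i ip_lincomb_right[OF assms(1,3,5), of i c] by (auto simp: subset_eq)
  qed
  finally show ?thesis by (simp add: complex_norm_square mult.commute del: of_real_power)
qed

lemma hdist_lincomb:
  assumes "orthonormal e I" "finite F" "F \<subseteq> I" "x \<in> carrier H"
  shows "(hdist H x (\<Oplus>i\<in>F. ip H (e i) x \<odot> e i))\<^sup>2 = (hnorm H x)\<^sup>2 - (\<Sum>i\<in>F. (cmod (ip H (e i) x))\<^sup>2)"
proof -
  let ?y = "\<Oplus>i\<in>F. ip H (e i) x \<odot> e i"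
  have e: "e j \<in> carrier H" if "j \<in> F" for j using orthonormalD(1)[OF assms(1)] that assms(3) by auto
  have y: "?y \<in> carrier H" using assms e by (intro finsum_closed) auto
  have xy: "ip H x ?y = of_real (\<Sum>i\<in>F. (cmod (ip H (e i) x))\<^sup>2)"
    using assms e by (simp add: ip_finsum_right Pi_iff ip_cnj[symmetric, of x] complex_norm_square mult.commute del: of_real_power)
  have yy: "ip H ?y ?y = of_real (\<Sum>i\<in>F. (cmod (ip H (e i) x))\<^sup>2)"
    using assms by (intro ip_lincomb) auto
  have "ip H ?y x = cnj (ip H x ?y)" using ip_cnj assms y by simp
  then show ?thesis
    unfolding hdist_def using assms y by (simp add: hnorm_sq xy yy)
qed

lemma bessel:
  assumes "orthonormal e I" "finite F" "F \<subseteq> I" "x \<in> carrier H"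
  shows "(\<Sum>i\<in>F. (cmod (ip H (e i) x))\<^sup>2) \<le> (hnorm H x)\<^sup>2"
  using hdist_lincomb[OF assms] zero_le_power2[of "hdist H x (\<Oplus>i\<in>F. ip H (e i) x \<odot> e i)"] by linarith

text \<open>
  The partial sums over a sequence of finite index sets that exhausts the sum of squares form a Cauchy
  sequence, and the completeness of the space provides the limit.
\<close>

theorem riesz_fischer:
  assumes e: "orthonormal e I" and c: "(\<lambda>i. (cmod (c i))\<^sup>2) summable_on I"
  obtains y where "y \<in> carrier H" "\<And>i. i \<in> I \<Longrightarrow> ip H (e i) y = c i"
    "((\<lambda>i. (cmod (c i))\<^sup>2) has_sum (hnorm H y)\<^sup>2) I"
proof -
  define S where "S = (\<Sum>\<^sub>\<infinity>i\<in>I. (cmod (c i))\<^sup>2)"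
  have S: "((\<lambda>i. (cmod (c i))\<^sup>2) has_sum S) I" using c by (simp add: S_def)
  have le_S: "sum (\<lambda>i. (cmod (c i))\<^sup>2) F \<le> S" if "finite F" "F \<subseteq> I" for F
    using that S by (intro finite_sum_le_has_sum[where A = I]) auto
  have "\<exists>F. finite F \<and> F \<subseteq> I \<and> S - 1 / real (Suc n) < sum (\<lambda>i. (cmod (c i))\<^sup>2) F" for n
  proof -
    have "(sum (\<lambda>i. (cmod (c i))\<^sup>2) \<longlongrightarrow> S) (finite_subsets_at_top I)"
      using S by (simp add: has_sum_def)
    then have "eventually (\<lambda>F. S - 1 / real (Suc n) < sum (\<lambda>i. (cmod (c i))\<^sup>2) F) (finite_subsets_at_top I)"
      by (rule order_tendstoD) simp
    then show ?thesis by (auto simp: eventually_finite_subsets_at_top)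
  qed
  then obtain F where F: "\<And>n. finite (F n)" "\<And>n. F n \<subseteq> I"
      "\<And>n. S - 1 / real (Suc n) < sum (\<lambda>i. (cmod (c i))\<^sup>2) (F n)"
    by metis
  define G where "G n = (\<Union>k\<le>n. F k)" for n
  define s where "s n = (\<Sum>i\<in>G n. (cmod (c i))\<^sup>2)" for n
  have G: "finite (G n)" "G n \<subseteq> I" "m \<le> n \<Longrightarrow> G m \<subseteq> G n" for m n
    using F unfolding G_def by (auto, meson atMost_iff le_trans)
  have s: "S - 1 / real (Suc n) < s n" "s n \<le> S" for n
  proof -
    have "sum (\<lambda>i. (cmod (c i))\<^sup>2) (F n) \<le> s n"
      using G F unfolding s_def by (intro sum_mono2) (auto simp: G_def)
    then show "S - 1 / real (Suc n) < s n" using F(3)[of n] by simp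
    show "s n \<le> S" using le_S G by (simp add: s_def)
  qed
  define y where "y n = (\<Oplus>i\<in>G n. c i \<odot> e i)" for n
  have ec: "e i \<in> carrier H" if "i \<in> I" for i using orthonormalD(1)[OF e that] .
  have yc: "y n \<in> carrier H" for n unfolding y_def using G ec by (intro finsum_closed) blast
  have ey: "ip H (e i) (y n) = (if i \<in> G n then c i else 0)" if "i \<in> I" for i n
    unfolding y_def using that G by (intro ip_lincomb_right[OF e]) auto
  have yy: "ip H (y m) (y n) = of_real (s m)" if "m \<le> n" for m n
    unfolding y_def s_def using that G by (intro ip_lincomb[OF e]) auto
  have dist: "(hdist H (y m) (y n))\<^sup>2 \<le> 1 / real (Suc m)" if "m \<le> n" for m n
  proof -
    have "ip H (y n) (y m) = of_real (s m)" using yy[OF that] ip_cnj[OF yc yc] by (metis complex_cnj_complex_of_real)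
    then have "(hdist H (y m) (y n))\<^sup>2 = s n - s m"
      unfolding hdist_def using yc yy[OF that] yy[of m m] yy[of n n] by (simp add: hnorm_sq)
    then show ?thesis using s(1)[of m] s(2)[of n] by simp
  qed
  have inv: "(\<lambda>n. 1 / real (Suc n)) \<longlonglongrightarrow> 0"
    using LIMSEQ_inverse_real_of_nat by (simp add: inverse_eq_divide)
  obtain x where x: "x \<in> carrier H" "(\<lambda>n. hdist H (y n) x) \<longlonglongrightarrow> 0"
  proof (rule complete[of y])
    fix \<epsilon> :: real assume "\<epsilon> > 0"
    then have "eventually (\<lambda>n. 1 / real (Suc n) < \<epsilon>\<^sup>2) sequentially"
      by (intro order_tendstoD[OF inv]) simp
    then obtain N where N: "\<And>n. n \<ge> N \<Longrightarrow> 1 / real (Suc n) < \<epsilon>\<^sup>2"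
      by (auto simp: eventually_sequentially)
    have *: "hdist H (y m) (y n) < \<epsilon>" if "N \<le> m" "m \<le> n" for m n
    proof (rule power2_less_imp_less)
      show "(hdist H (y m) (y n))\<^sup>2 < \<epsilon>\<^sup>2" using dist[OF that(2)] N[OF that(1)] by simp
    qed (use \<open>\<epsilon> > 0\<close> in simp)
    have "hdist H (y m) (y n) < \<epsilon>" if "N \<le> m" "N \<le> n" for m n
      using *[of m n] *[of n m] that hdist_commute[OF yc yc, of m n] by (cases "m \<le> n") auto
    then show "\<exists>N. \<forall>m\<ge>N. \<forall>n\<ge>N. hdist H (y m) (y n) < \<epsilon>" by blast
  qed (use yc in auto)
  have ex: "ip H (e i) x = c i" if i: "i \<in> I" for i
  proof -
    have lim: "(\<lambda>n. ip H (e i) (y n)) \<longlonglongrightarrow> ip H (e i) x"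
      by (intro tendsto_ip yc x ec i)
    have small: "(cmod (ip H (e i) (y n) - c i))\<^sup>2 \<le> 1 / real (Suc n)" for n
    proof (cases "i \<in> G n")
      case False
      have "sum (\<lambda>i. (cmod (c i))\<^sup>2) (insert i (G n)) \<le> S" using G i by (intro le_S) auto
      then have "(cmod (c i))\<^sup>2 + s n \<le> S" using False G by (simp add: s_def)
      then show ?thesis using s(1)[of n] False by (simp add: ey[OF i])
    qed (simp add: ey[OF i])
    have "(\<lambda>n. (cmod (ip H (e i) (y n) - c i))\<^sup>2) \<longlonglongrightarrow> 0"
      by (rule tendsto_sandwich[OF _ _ tendsto_const inv]) (use small in auto)
    moreover have "(\<lambda>n. (cmod (ip H (e i) (y n) - c i))\<^sup>2) \<longlonglongrightarrow> (cmod (ip H (e i) x - c i))\<^sup>2"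
      by (intro tendsto_intros lim)
    ultimately have "(cmod (ip H (e i) x - c i))\<^sup>2 = 0" using LIMSEQ_unique by blast
    then show ?thesis by simp
  qed
  have "ip H x (y n) = of_real (s n)" for n
  proof -
    have "ip H x (y n) = (\<Sum>i\<in>G n. c i * ip H x (e i))"
      unfolding y_def using G x ec by (subst ip_finsum_right) (auto simp: subset_eq)
    also have "\<dots> = (\<Sum>i\<in>G n. c i * cnj (c i))"
    proof (intro sum.cong refl)
      fix i assume "i \<in> G n"
      then have "i \<in> I" using G by blast
      then show "c i * ip H x (e i) = c i * cnj (c i)"
        using ex[of i] ip_cnj[of "e i" x] ec x by simp
    qed
    finally show ?thesis by (simp add: s_def complex_norm_square del: of_real_power)
  qed
  then have "(\<lambda>n. of_real (s n)) \<longlonglongrightarrow> ip H x x" using tendsto_ip[OF yc x(1) x(1) x(2)] by simp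
  then have "(\<lambda>n. complex_of_real (s n)) \<longlonglongrightarrow> of_real ((hnorm H x)\<^sup>2)" using ip_self x by simp
  then have 1: "s \<longlonglongrightarrow> (hnorm H x)\<^sup>2" unfolding tendsto_of_real_iff .
  have 2: "s \<longlonglongrightarrow> S"
  proof (rule tendsto_sandwich)
    show "(\<lambda>n. S - 1 / real (Suc n)) \<longlonglongrightarrow> S" using tendsto_diff[OF tendsto_const inv] by simp
    show "\<forall>\<^sub>F n in sequentially. S - 1 / real (Suc n) \<le> s n"
      using s(1) by (intro always_eventually) (auto intro: less_imp_le)
  qed (use s(2) in auto)
  have "S = (hnorm H x)\<^sup>2" using LIMSEQ_unique[OF 2 1] .
  then show ?thesis using that[OF x(1) ex] S by simp
qed

lemma parseval:
  assumes e: "hilbert_basis e I" and x: "x \<in> carrier H"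
  shows "((\<lambda>i. (cmod (ip H (e i) x))\<^sup>2) has_sum (hnorm H x)\<^sup>2) I"
proof -
  have o: "orthonormal e I" using e by (simp add: hilbert_basis_def)
  have "(\<lambda>i. (cmod (ip H (e i) x))\<^sup>2) summable_on I"
    by (rule nonneg_bounded_partial_sums_imp_summable_on[where C = "(hnorm H x)\<^sup>2"])
      (auto simp: eventually_finite_subsets_at_top intro!: exI[of _ "{}"] bessel[OF o _ _ x])
  from riesz_fischer[OF o this] obtain y where y: "y \<in> carrier H"
      "\<And>i. i \<in> I \<Longrightarrow> ip H (e i) y = ip H (e i) x"
      "((\<lambda>i. (cmod (ip H (e i) x))\<^sup>2) has_sum (hnorm H y)\<^sup>2) I" by blast
  then show ?thesis using hilbert_basis_eqI[OF e y(1) x] by simp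
qed

lemma finsum_in_lin_span:
  assumes "finite F" "S \<subseteq> carrier H" "\<And>i. i \<in> F \<Longrightarrow> f i \<in> S"
  shows "(\<Oplus>i\<in>F. c i \<odot> f i) \<in> lin_span H S"
proof -
  have "(\<Oplus>i\<in>F. c i \<odot> f i) \<in> W"
    if W: "submodule W (ring_of_type_algebra :: complex ring) H" "S \<subseteq> W" for W
    using assms(1,3)
  proof (induction F)
    case empty
    obtain x where "x \<in> W" using Module.module.submoduleE(2)[OF module W(1)] by blast
    then have "x \<oplus> \<ominus> x \<in> W" "x \<in> carrier H"
      using Module.module.submoduleE[OF module W(1)] by blast+
    then show ?case by (simp add: r_neg)
  next
    case (insert i F)
    then have "c i \<odot> f i \<in> W" "(\<Oplus>i\<in>F. c i \<odot> f i) \<in> W"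
      using W Module.module.submoduleE(4)[OF module W(1), of "c i" "f i"]
      by (auto simp: ring_of_type_algebra_def)
    then have "c i \<odot> f i \<oplus> (\<Oplus>i\<in>F. c i \<odot> f i) \<in> W"
      using Module.module.submoduleE(5)[OF module W(1)] by blast
    then show ?case using insert assms(2) by (subst finsum_insert) (auto simp: subset_eq)
  qed
  then show ?thesis by (simp add: lin_span_def)
qed

lemma hilbert_basis_total:
  assumes e: "hilbert_basis e I"
  shows "total_in H (e ` I)"
  unfolding total_in_def
proof (intro ballI allI impI)
  fix x and \<epsilon> :: real assume x: "x \<in> carrier H" and "\<epsilon> > 0"
  have o: "orthonormal e I" using e by (simp add: hilbert_basis_def)
  have "eventually (\<lambda>F. (hnorm H x)\<^sup>2 - \<epsilon>\<^sup>2 < (\<Sum>i\<in>F. (cmod (ip H (e i) x))\<^sup>2)) (finite_subsets_at_top I)"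
    using parseval[OF e x] \<open>\<epsilon> > 0\<close> unfolding has_sum_def by (intro order_tendstoD) auto
  then obtain F where F: "finite F" "F \<subseteq> I" "(hnorm H x)\<^sup>2 - \<epsilon>\<^sup>2 < (\<Sum>i\<in>F. (cmod (ip H (e i) x))\<^sup>2)"
    by (auto simp: eventually_finite_subsets_at_top)
  let ?y = "\<Oplus>i\<in>F. ip H (e i) x \<odot> e i"
  have "(hdist H x ?y)\<^sup>2 < \<epsilon>\<^sup>2" using hdist_lincomb[OF o F(1,2) x] F(3) by simp
  then have "hdist H x ?y < \<epsilon>" by (rule power2_less_imp_less) (use \<open>\<epsilon> > 0\<close> in simp)
  moreover have "?y \<in> lin_span H (e ` I)"
    using F orthonormalD(1)[OF o] by (intro finsum_in_lin_span) auto
  ultimately show "\<exists>y\<in>lin_span H (e ` I). hdist H x y < \<epsilon>" by blast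
qed

lemma hilbert_basis_image:
  assumes "hilbert_basis e I" shows "e ` I \<subseteq> carrier H"
  using assms by (auto simp: hilbert_basis_def orthonormal_def)

lemma orthonormal_basis_hilbert_basis:
  assumes "orthonormal_basis H E"
  shows "hilbert_basis (\<lambda>e. e) E"
proof -
  have E: "E \<subseteq> carrier H" "total_in H E" using assms by (auto simp: orthonormal_basis_def)
  have "x = \<zero>" if "x \<in> carrier H" "\<forall>e\<in>E. ip H e x = 0" for x
    using that E by (intro eq_on_total[OF E(2,1)]) auto
  then show ?thesis using assms by (auto simp: hilbert_basis_def orthonormal_def orthonormal_basis_def)
qed

subsection \<open>Operators with prescribed coordinates\<close>

text \<open>
  Adjoints, annihilation operators and tensor products all arise here: \<open>D x\<close> is the vector with coordinates \<open>\<langle>g\<^sub>i, x\<rangle>\<close>. A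
  Bessel inequality for the \<open>g\<^sub>i\<close> makes these square summable and bounds the norm of \<open>D x\<close>.
\<close>

lemma bounded_op_by_coordinates:
  assumes e: "hilbert_basis e I" and g: "\<And>i. i \<in> I \<Longrightarrow> g i \<in> carrier H"
    and bd: "\<And>F x. finite F \<Longrightarrow> F \<subseteq> I \<Longrightarrow> x \<in> carrier H \<Longrightarrow>
      (\<Sum>i\<in>F. (cmod (ip H (g i) x))\<^sup>2) \<le> M * (hnorm H x)\<^sup>2"
  obtains D where "D \<in> bounded_ops H" "\<And>x i. x \<in> carrier H \<Longrightarrow> i \<in> I \<Longrightarrow> ip H (e i) (D x) = ip H (g i) x"
proof -
  have o: "orthonormal e I" using e by (simp add: hilbert_basis_def)
  note ec = orthonormalD(1)[OF o]
  have "\<exists>y. y \<in> carrier H \<and> (\<forall>i\<in>I. ip H (e i) y = ip H (g i) x) \<and> (hnorm H y)\<^sup>2 \<le> M * (hnorm H x)\<^sup>2"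
    if x: "x \<in> carrier H" for x
  proof -
    have "(\<lambda>i. (cmod (ip H (g i) x))\<^sup>2) summable_on I"
      by (rule nonneg_bounded_partial_sums_imp_summable_on[where C = "M * (hnorm H x)\<^sup>2"])
        (auto simp: eventually_finite_subsets_at_top intro!: exI[of _ "{}"] bd x)
    from riesz_fischer[OF o this] obtain y where y: "y \<in> carrier H"
        "\<And>i. i \<in> I \<Longrightarrow> ip H (e i) y = ip H (g i) x"
        "((\<lambda>i. (cmod (ip H (g i) x))\<^sup>2) has_sum (hnorm H y)\<^sup>2) I" by blast
    have "(hnorm H y)\<^sup>2 \<le> M * (hnorm H x)\<^sup>2"
      by (rule has_sum_le_finite_sums[OF y(3)]) (use bd x in auto)
    then show ?thesis using y by blast
  qed
  then obtain D where D: "\<And>x. x \<in> carrier H \<Longrightarrow> D x \<in> carrier H"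
      "\<And>x i. x \<in> carrier H \<Longrightarrow> i \<in> I \<Longrightarrow> ip H (e i) (D x) = ip H (g i) x"
      "\<And>x. x \<in> carrier H \<Longrightarrow> (hnorm H (D x))\<^sup>2 \<le> M * (hnorm H x)\<^sup>2"
    by metis
  let ?D = "\<lambda>x\<in>carrier H. D x"
  have "?D \<in> bounded_ops H"
  proof (rule bounded_opsI[where M = "sqrt \<bar>M\<bar>"])
    fix x assume x: "x \<in> carrier H"
    have "(hnorm H (D x))\<^sup>2 \<le> \<bar>M\<bar> * (hnorm H x)\<^sup>2"
      using D(3)[OF x] mult_right_mono[OF abs_ge_self[of M] zero_le_power2[of "hnorm H x"]] by linarith
    also have "\<dots> = (sqrt \<bar>M\<bar> * hnorm H x)\<^sup>2" by (simp add: power_mult_distrib)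
    finally have "hnorm H (D x) \<le> sqrt \<bar>M\<bar> * hnorm H x" using x by (auto intro: power2_le_imp_le)
    then show "hnorm H (?D x) \<le> sqrt \<bar>M\<bar> * hnorm H x" using x by simp
  next
    fix x y assume "x \<in> carrier H" "y \<in> carrier H"
    then show "?D (x \<oplus> y) = ?D x \<oplus> ?D y"
      using D(1,2) g ec by (intro hilbert_basis_eqI[OF e]) auto
  next
    fix c x assume "x \<in> carrier H"
    then show "?D (c \<odot> x) = c \<odot> ?D x"
      using D(1,2) g ec by (intro hilbert_basis_eqI[OF e]) auto
  qed (use D in auto)
  then show ?thesis using that D(2) by simp
qed

subsection \<open>Adjoints\<close>

text \<open>
  The coordinates of the adjoint are \<open>\<langle>A e\<^sub>i, x\<rangle>\<close>. With \<open>c\<^sub>i = \<langle>A e\<^sub>i, x\<rangle>\<close> for finitely many \<open>i\<close>, the sum of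
  squares is \<open>\<langle>A (\<Sum>\<^sub>i c\<^sub>i e\<^sub>i), x\<rangle>\<close>, which is at most \<open>M \<parallel>x\<parallel>\<close> times its own square root.
\<close>

lemma adjoint_exists:
  assumes e: "hilbert_basis e I" and A: "A \<in> bounded_ops H"
  obtains B where "B \<in> bounded_ops H"
    "\<And>x y. x \<in> carrier H \<Longrightarrow> y \<in> carrier H \<Longrightarrow> ip H (B x) y = ip H x (A y)"
proof -
  have o: "orthonormal e I" using e by (simp add: hilbert_basis_def)
  note ec = orthonormalD(1)[OF o] and Ac = op_carrier[OF A]
  obtain M where M: "M \<ge> 0" "\<And>x. x \<in> carrier H \<Longrightarrow> hnorm H (A x) \<le> M * hnorm H x"
    using op_bound[OF A] by blast
  obtain B where B: "B \<in> bounded_ops H"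
    "\<And>x i. x \<in> carrier H \<Longrightarrow> i \<in> I \<Longrightarrow> ip H (e i) (B x) = ip H (A (e i)) x"
  proof (rule bounded_op_by_coordinates[OF e, of "\<lambda>i. A (e i)" "M\<^sup>2"])
    fix F x assume F: "finite F" "F \<subseteq> I" and x: "x \<in> carrier H"
    define c where "c i = ip H (A (e i)) x" for i
    define w where "w = (\<Oplus>i\<in>F. c i \<odot> e i)"
    define S where "S = (\<Sum>i\<in>F. (cmod (c i))\<^sup>2)"
    have eF: "e i \<in> carrier H" if "i \<in> F" for i using F that ec by blast
    have w: "w \<in> carrier H" unfolding w_def using eF by (intro finsum_closed) auto
    have "A w = (\<Oplus>i\<in>F. A (c i \<odot> e i))"
      unfolding w_def by (rule op_finsum[OF A]) (use eF F in auto)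
    then have "ip H (A w) x = (\<Sum>i\<in>F. ip H (A (c i \<odot> e i)) x)"
      using x eF Ac by (simp add: ip_finsum_left Pi_iff)
    also have "\<dots> = (\<Sum>i\<in>F. c i * cnj (c i))"
      using x eF Ac by (intro sum.cong) (auto simp: op_smult[OF A] c_def)
    finally have S: "ip H (A w) x = of_real S"
      by (simp add: S_def complex_norm_square del: of_real_power)
    have "complex_of_real ((hnorm H w)\<^sup>2) = of_real S"
      using ip_lincomb[OF o F(1) F(1) order_refl F(2), of c] ip_self[OF w]
      unfolding w_def[symmetric] S_def[symmetric] by (simp del: of_real_power)
    then have "(hnorm H w)\<^sup>2 = S" by (simp only: of_real_eq_iff)
    have "S \<ge> 0" by (auto simp: S_def intro: sum_nonneg)
    have "S = cmod (ip H (A w) x)" using S \<open>S \<ge> 0\<close> by simp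
    also have "\<dots> \<le> hnorm H (A w) * hnorm H x" using w x Ac by (intro cauchy_schwarz) auto
    also have "\<dots> \<le> M * hnorm H w * hnorm H x" using M(2)[OF w] x by (intro mult_right_mono) auto
    finally have "S\<^sup>2 \<le> (M * hnorm H w * hnorm H x)\<^sup>2" using \<open>S \<ge> 0\<close> by (rule power_mono)
    also have "\<dots> = (M\<^sup>2 * (hnorm H x)\<^sup>2) * S" by (simp add: power_mult_distrib \<open>(hnorm H w)\<^sup>2 = S\<close>)
    finally have "S * S \<le> (M\<^sup>2 * (hnorm H x)\<^sup>2) * S" by (simp add: power2_eq_square)
    then have "S \<le> M\<^sup>2 * (hnorm H x)\<^sup>2"
      using \<open>S \<ge> 0\<close> by (cases "S = 0") (auto simp: mult_le_cancel_right)
    then show "(\<Sum>i\<in>F. (cmod (ip H (A (e i)) x))\<^sup>2) \<le> M\<^sup>2 * (hnorm H x)\<^sup>2" by (simp add: S_def c_def)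
  qed (use ec Ac in auto)
  note Bc = op_carrier[OF B(1)]
  have "ip H (B x) y = ip H x (A y)" if x: "x \<in> carrier H" and y: "y \<in> carrier H" for x y
  proof -
    have "ip H (B x) y - ip H x (A y) = 0"
    proof (rule functional_zero_on_total[OF hilbert_basis_total[OF e] hilbert_basis_image[OF e] _ _ _ _ y])
      show "cmod (ip H (B x) z - ip H x (A z)) \<le> (hnorm H (B x) + hnorm H x * M) * hnorm H z"
        if z: "z \<in> carrier H" for z
      proof -
        have "cmod (ip H (B x) z - ip H x (A z)) \<le> cmod (ip H (B x) z) + cmod (ip H x (A z))"
          by (rule norm_triangle_ineq4)
        also have "\<dots> \<le> hnorm H (B x) * hnorm H z + hnorm H x * hnorm H (A z)"
          using x z Ac Bc by (intro add_mono cauchy_schwarz) auto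
        also have "\<dots> \<le> hnorm H (B x) * hnorm H z + hnorm H x * (M * hnorm H z)"
          using x z M Bc by (intro add_mono mult_left_mono) auto
        finally show ?thesis by (simp add: algebra_simps)
      qed
      show "ip H (B x) z - ip H x (A z) = 0" if z: "z \<in> e ` I" for z
      proof -
        obtain i where i: "i \<in> I" "z = e i" using z by blast
        then show ?thesis using ip_flip[OF _ _ _ _ B(2)[OF x i(1)]] x Bc Ac ec by simp
      qed
    qed (use x Ac Bc in \<open>auto simp: op_add[OF A] op_smult[OF A] algebra_simps\<close>)
    then show ?thesis by simp
  qed
  then show ?thesis using that B(1) by blast
qed

lemma hadjoint_unique:
  assumes "B \<in> bounded_ops H"
    and adj: "\<And>x y. x \<in> carrier H \<Longrightarrow> y \<in> carrier H \<Longrightarrow> ip H (B x) y = ip H x (A y)"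
  shows "hadjoint H A = B"
  unfolding hadjoint_def
proof (rule the_equality)
  fix C assume C: "C \<in> bounded_ops H \<and> (\<forall>x\<in>carrier H. \<forall>y\<in>carrier H. ip H (C x) y = ip H x (A y))"
  show "C = B"
  proof (rule op_eqI)
    fix x assume x: "x \<in> carrier H"
    show "C x = B x"
    proof (rule ip_eqI)
      fix z assume z: "z \<in> carrier H"
      have "ip H (C x) z = ip H (B x) z" using C x z adj by simp
      then show "ip H z (C x) = ip H z (B x)"
        using C x z assms(1) by (intro ip_flip[of "C x" z]) (auto simp: op_carrier)
    qed (use C x assms(1) in \<open>auto simp: op_carrier\<close>)
  qed (use C assms(1) in auto)
qed (use assms in auto)

lemma
  assumes "hilbert_basis e I" "A \<in> bounded_ops H"
  shows hadjoint_bounded: "hadjoint H A \<in> bounded_ops H"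
    and ip_hadjoint: "x \<in> carrier H \<Longrightarrow> y \<in> carrier H \<Longrightarrow> ip H (hadjoint H A x) y = ip H x (A y)"
proof -
  obtain B where B: "B \<in> bounded_ops H"
    "\<And>x y. x \<in> carrier H \<Longrightarrow> y \<in> carrier H \<Longrightarrow> ip H (B x) y = ip H x (A y)"
    using adjoint_exists[OF assms] by blast
  then have "hadjoint H A = B" by (rule hadjoint_unique)
  then show "hadjoint H A \<in> bounded_ops H"
    "x \<in> carrier H \<Longrightarrow> y \<in> carrier H \<Longrightarrow> ip H (hadjoint H A x) y = ip H x (A y)"
    using B by auto
qed

end

section \<open>Positive operators and their square roots\<close>

context hilbert
begin

definition symmetric :: "('a \<Rightarrow> 'a) \<Rightarrow> bool" where
  "symmetric A \<longleftrightarrow> (\<forall>x\<in>carrier H. \<forall>y\<in>carrier H. ip H (A x) y = ip H x (A y))"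

lemma symmetricD: "symmetric A \<Longrightarrow> x \<in> carrier H \<Longrightarrow> y \<in> carrier H \<Longrightarrow> ip H (A x) y = ip H x (A y)"
  by (simp add: symmetric_def)

lemma positive_bounded: "A \<in> positive_ops H \<Longrightarrow> A \<in> bounded_ops H"
  by (simp add: positive_ops_def)

lemma
  assumes "A \<in> positive_ops H" "x \<in> carrier H"
  shows positive_Re: "0 \<le> Re (ip H x (A x))"
    and positive_Im: "Im (ip H x (A x)) = 0"
  using assms by (auto simp: positive_ops_def complex_nonneg_Reals_iff)

lemma Re_ip_commute:
  assumes "x \<in> carrier H" "y \<in> carrier H"
  shows "Re (ip H x y) = Re (ip H y x)"
  using arg_cong[OF ip_cnj[OF assms], of Re] by simp

lemma hnorm_normalize:
  assumes "x \<in> carrier H" "hnorm H x \<noteq> 0"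
  shows "hnorm H (of_real (1 / hnorm H x) \<odot> x) = 1"
  using assms by (simp add: hnorm_smult norm_divide)

text \<open>Polarization: the quadratic form at \<open>x + y\<close> and \<open>x + i y\<close> is real.\<close>

lemma positive_symmetric:
  assumes "A \<in> positive_ops H"
  shows "symmetric A"
  unfolding symmetric_def
proof (intro ballI)
  fix x y assume xy: "x \<in> carrier H" "y \<in> carrier H"
  have A: "A \<in> bounded_ops H" using positive_bounded[OF assms] .
  note simps = op_carrier[OF A] op_add[OF A] op_smult[OF A]
  have "Im (ip H (x \<oplus> y) (A (x \<oplus> y))) = 0" "Im (ip H (x \<oplus> \<i> \<odot> y) (A (x \<oplus> \<i> \<odot> y))) = 0"
    "Im (ip H x (A x)) = 0" "Im (ip H y (A y)) = 0"
    using xy by (auto intro!: positive_Im assms)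
  then have "ip H x (A y) = cnj (ip H y (A x))"
    using xy by (simp add: simps complex_eq_iff)
  then show "ip H (A x) y = ip H x (A y)"
    using xy ip_cnj[of y "A x"] op_carrier[OF A] by simp
qed

lemma hadjoint_symmetric:
  "A \<in> bounded_ops H \<Longrightarrow> symmetric A \<Longrightarrow> hadjoint H A = A"
  by (intro hadjoint_unique) (auto dest: symmetricD)

text \<open>
  For a symmetric operator the quadratic form already controls the norm, because
  \<open>4 Re \<langle>D x, y\<rangle>\<close> is the difference of its values at \<open>x + y\<close> and \<open>x - y\<close>.
\<close>

lemma numerical_radius:
  assumes D: "D \<in> bounded_ops H" "symmetric D"
    and c: "c \<ge> 0" "\<And>y. y \<in> carrier H \<Longrightarrow> \<bar>Re (ip H y (D y))\<bar> \<le> c * (hnorm H y)\<^sup>2"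
    and x: "x \<in> carrier H" "hnorm H x = 1"
  shows "hnorm H (D x) \<le> c"
proof (cases "hnorm H (D x) = 0")
  case False
  note Dc = op_carrier[OF D(1)]
  define r where "r = hnorm H (D x)"
  have r: "r > 0" using False Dc x by (simp add: r_def order_less_le)
  define y where "y = of_real (1 / r) \<odot> D x"
  have y: "y \<in> carrier H" using Dc x by (simp add: y_def)
  have ny: "hnorm H y = 1" using Dc x False hnorm_normalize[of "D x"] by (simp add: y_def r_def)
  have "ip H (D x) y = of_real r"
    using Dc x r ip_self[of "D x"] by (simp add: y_def r_def[symmetric] power2_eq_square)
  moreover have "ip H y (D x) = cnj (ip H (D x) y)" "ip H x (D y) = ip H (D x) y"
    using ip_cnj Dc x y symmetricD[OF D(2)] by auto
  ultimately have "Re (ip H (x \<oplus> y) (D (x \<oplus> y))) - Re (ip H (x \<ominus> y) (D (x \<ominus> y))) = 4 * r"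
    using x y Dc by (simp add: op_add[OF D(1)] op_minus[OF D(1)])
  moreover have "\<bar>Re (ip H (x \<oplus> y) (D (x \<oplus> y)))\<bar> \<le> c * (hnorm H (x \<oplus> y))\<^sup>2"
    "\<bar>Re (ip H (x \<ominus> y) (D (x \<ominus> y)))\<bar> \<le> c * (hnorm H (x \<ominus> y))\<^sup>2"
    using x y by (auto intro!: c(2))
  moreover have "(hnorm H (x \<oplus> y))\<^sup>2 + (hnorm H (x \<ominus> y))\<^sup>2 = 2 * (hnorm H x)\<^sup>2 + 2 * (hnorm H y)\<^sup>2"
    using x(1) y by (simp add: hnorm_sq)
  then have "c * (hnorm H (x \<oplus> y))\<^sup>2 + c * (hnorm H (x \<ominus> y))\<^sup>2 = c * 4"
    by (simp add: x ny flip: distrib_left)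
  ultimately have "4 * r \<le> c * 4" by linarith
  then show ?thesis by (simp add: r_def)
qed (use c in simp)

text \<open>
  Let \<open>A\<close> and \<open>S\<close> be positive with \<open>S\<^sup>2 = A\<^sup>2\<close>, and put \<open>D = A - S\<close>, \<open>P = A + S\<close>. Then
  \<open>P D + D P = 0\<close>, so \<open>Re \<langle>P x, D x\<rangle> = 0\<close> for all \<open>x\<close>, while \<open>\<bar>\<langle>x, D x\<rangle>\<bar> \<le> \<langle>x, P x\<rangle>\<close>. For a unit vector
  \<open>x\<close> write \<open>D x = q x + r\<close> with \<open>q = \<langle>x, D x\<rangle>\<close>. Orthogonality gives
  \<open>q\<^sup>2 \<le> \<bar>q\<bar> \<langle>x, P x\<rangle> \<le> \<parallel>P\<parallel> \<parallel>r\<parallel>\<close>, and \<open>\<parallel>r\<parallel>\<^sup>2 = \<parallel>D x\<parallel>\<^sup>2 - q\<^sup>2 \<le> k - q\<^sup>2\<close> where \<open>k\<close> is the supremum of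
  all \<open>q\<^sup>2\<close>. Letting \<open>q\<^sup>2\<close> approach \<open>k\<close> yields \<open>k = 0\<close>, hence \<open>D = 0\<close>.
\<close>

theorem positive_sqrt_unique:
  assumes A: "A \<in> positive_ops H" and S: "S \<in> positive_ops H"
    and sq: "\<And>x. x \<in> carrier H \<Longrightarrow> S (S x) = A (A x)"
  shows "S = A"
proof (rule ccontr)
  assume neq: "S \<noteq> A"
  define D where "D = (\<lambda>x\<in>carrier H. A x \<oplus> (\<lambda>x\<in>carrier H. (-1) \<odot> S x) x)"
  define P where "P = (\<lambda>x\<in>carrier H. A x \<oplus> S x)"
  have Ab: "A \<in> bounded_ops H" and Sb: "S \<in> bounded_ops H" using A S positive_bounded by auto
  note Ac = op_carrier[OF Ab] and Sc = op_carrier[OF Sb]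
  have Db: "D \<in> bounded_ops H" unfolding D_def by (intro bounded_ops_add bounded_ops_smult Ab Sb)
  have Pb: "P \<in> bounded_ops H" unfolding P_def by (intro bounded_ops_add Ab Sb)
  note Dc = op_carrier[OF Db] and Pc = op_carrier[OF Pb]
  have D: "D x = A x \<ominus> S x" if "x \<in> carrier H" for x
    using that Ac Sc by (intro ip_eqI) (auto simp: D_def)
  have P: "P x = A x \<oplus> S x" if "x \<in> carrier H" for x using that by (simp add: P_def)
  note As = symmetricD[OF positive_symmetric[OF A]] and Ss = symmetricD[OF positive_symmetric[OF S]]
  have Ds: "symmetric D" using Ac Sc As Ss by (simp add: symmetric_def D)
  have PD: "Re (ip H (P x) (D x)) = 0" if x: "x \<in> carrier H" for x
  proof -
    have "ip H (A x) (A x) = ip H (S x) (S x)"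
      using x Ac Sc As[of x "A x"] Ss[of x "S x"] sq by simp
    moreover have "Re (ip H (S x) (A x)) = Re (ip H (A x) (S x))"
      using x Ac Sc by (intro Re_ip_commute) auto
    ultimately show ?thesis using x Ac Sc by (simp add: D P)
  qed
  have qp: "\<bar>Re (ip H x (D x))\<bar> \<le> Re (ip H x (P x))" if x: "x \<in> carrier H" for x
    using x Ac Sc positive_Re[OF A x] positive_Re[OF S x] by (simp add: D P)
  obtain C where C: "\<And>x. x \<in> carrier H \<Longrightarrow> hnorm H (P x) \<le> C * hnorm H x" "C \<ge> 0"
    using op_bound[OF Pb] by metis
  obtain N where N: "\<And>x. x \<in> carrier H \<Longrightarrow> hnorm H (D x) \<le> N * hnorm H x" "N \<ge> 0"
    using op_bound[OF Db] by metis
  define q where "q x = Re (ip H x (D x))" for x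
  define U where "U = {x \<in> carrier H. hnorm H x = 1}"
  define K where "K = (\<lambda>x. (q x)\<^sup>2) ` U"
  define k where "k = Sup K"
  have normalize: "of_real (1 / hnorm H x) \<odot> x \<in> U" if "x \<in> carrier H" "hnorm H x \<noteq> 0" for x
    using that hnorm_normalize[OF that] by (simp add: U_def)
  obtain x0 where x0: "x0 \<in> carrier H" "S x0 \<noteq> A x0"
    using neq op_eqI[OF Sb Ab] by blast
  have Dx0: "D x0 \<noteq> \<zero>" using x0 D minus_eq_zeroD[OF Ac Sc, of x0 x0] by auto
  have "hnorm H x0 \<noteq> 0"
  proof
    assume "hnorm H x0 = 0"
    then have "hnorm H (D x0) = 0" using N(1)[OF x0(1)] Dc[OF x0(1)] by (simp add: antisym)
    then show False using Dx0 hnorm_eq_0 Dc x0 by blast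
  qed
  then have ne: "K \<noteq> {}" using normalize[OF x0(1)] by (auto simp: K_def)
  have "q x \<le> N \<and> - N \<le> q x" if "x \<in> U" for x
  proof -
    have "\<bar>q x\<bar> \<le> cmod (ip H x (D x))" by (simp add: q_def abs_Re_le_cmod)
    also have "\<dots> \<le> hnorm H x * hnorm H (D x)" using that Dc by (intro cauchy_schwarz) (auto simp: U_def)
    also have "\<dots> \<le> N" using that N(1)[of x] by (simp add: U_def)
    finally show ?thesis by auto
  qed
  then have "(q x)\<^sup>2 \<le> N\<^sup>2" if "x \<in> U" for x using that by (intro sqrt_ge_absD abs_le_square_iff[THEN iffD1]) (force simp: abs_le_iff)
  then have bdd: "bdd_above K" by (auto simp: K_def intro!: bdd_aboveI2)
  have le_k: "(q x)\<^sup>2 \<le> k" if "x \<in> U" for x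
    unfolding k_def using that by (intro cSup_upper bdd) (auto simp: K_def)
  have k0: "k \<ge> 0" using ne le_k by (auto simp: K_def) (meson order_trans zero_le_power2)
  have form: "\<bar>Re (ip H y (D y))\<bar> \<le> sqrt k * (hnorm H y)\<^sup>2" if y: "y \<in> carrier H" for y
  proof (cases "hnorm H y = 0")
    case True
    then have "y = \<zero>" using hnorm_eq_0 y by blast
    then show ?thesis using True Dc[OF zero_closed] by simp
  next
    case False
    let ?u = "of_real (1 / hnorm H y) \<odot> y"
    have "q ?u = q y / (hnorm H y)\<^sup>2"
      using y Dc[OF y] by (simp add: q_def op_smult[OF Db] power2_eq_square)
    moreover have "\<bar>q ?u\<bar> \<le> sqrt k" using le_k[OF normalize[OF y False]] real_le_rsqrt[of "\<bar>q ?u\<bar>" k] by simp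
    ultimately have "\<bar>q y\<bar> / (hnorm H y)\<^sup>2 \<le> sqrt k" by (simp add: abs_divide)
    then show ?thesis using False by (simp add: q_def field_simps)
  qed
  have Dle: "hnorm H (D x) \<le> sqrt k" if "x \<in> U" for x
    using that k0 form by (intro numerical_radius[OF Db Ds]) (auto simp: U_def)
  have main: "((q x)\<^sup>2)\<^sup>2 \<le> C\<^sup>2 * (k - (q x)\<^sup>2)" if xU: "x \<in> U" for x
  proof -
    have x: "x \<in> carrier H" "hnorm H x = 1" using xU by (auto simp: U_def)
    note c = Dc[OF x(1)] Pc[OF x(1)]
    define r where "r = D x \<ominus> of_real (q x) \<odot> x"
    have r: "r \<in> carrier H" using x c by (simp add: r_def)
    have xx: "ip H x x = 1" using ip_self x by simp
    have xD: "ip H x (D x) = of_real (q x)" "ip H (D x) x = of_real (q x)"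
    proof -
      have "ip H (D x) x = ip H x (D x)" using symmetricD[OF Ds] x by simp
      moreover have "cnj (ip H x (D x)) = ip H (D x) x" using ip_cnj x c by simp
      ultimately have "Im (ip H x (D x)) = 0" by (auto simp: complex_eq_iff)
      then show "ip H x (D x) = of_real (q x)" by (simp add: q_def complex_eq_iff)
      then show "ip H (D x) x = of_real (q x)" using \<open>ip H (D x) x = ip H x (D x)\<close> by simp
    qed
    have "(hnorm H r)\<^sup>2 = (hnorm H (D x))\<^sup>2 - (q x)\<^sup>2"
      unfolding hnorm_sq[OF r] hnorm_sq[OF c(1)] using x c by (simp add: r_def xD xx power2_eq_square)
    also have "\<dots> \<le> k - (q x)\<^sup>2"
      using power_mono[OF Dle[OF xU], of 2] c k0 by simp
    finally have nr: "(hnorm H r)\<^sup>2 \<le> k - (q x)\<^sup>2" .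
    have "D x = of_real (q x) \<odot> x \<oplus> r" using x c by (intro ip_eqI) (auto simp: r_def)
    then have "0 = Re (ip H (P x) (of_real (q x) \<odot> x \<oplus> r))" using PD[OF x(1)] by simp
    then have "q x * Re (ip H (P x) x) = - Re (ip H (P x) r)" using x c r by simp
    then have 1: "\<bar>q x\<bar> * \<bar>Re (ip H (P x) x)\<bar> = \<bar>Re (ip H (P x) r)\<bar>" by (metis abs_minus_cancel abs_mult)
    have "Re (ip H (P x) x) = Re (ip H x (P x))" using x c by (intro Re_ip_commute) auto
    then have "\<bar>q x\<bar> * \<bar>q x\<bar> \<le> \<bar>q x\<bar> * \<bar>Re (ip H (P x) x)\<bar>"
      using qp[OF x(1)] by (intro mult_left_mono) (auto simp: q_def)
    also have "\<dots> \<le> cmod (ip H (P x) r)" using 1 abs_Re_le_cmod by metis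
    also have "\<dots> \<le> hnorm H (P x) * hnorm H r" using c r by (intro cauchy_schwarz)
    also have "\<dots> \<le> C * hnorm H r" using C(1)[OF x(1)] x r by (intro mult_right_mono) auto
    finally have "(q x)\<^sup>2 \<le> C * hnorm H r" by (simp add: power2_eq_square abs_mult_self_eq)
    then have "((q x)\<^sup>2)\<^sup>2 \<le> (C * hnorm H r)\<^sup>2" by (intro power_mono) auto
    also have "\<dots> \<le> C\<^sup>2 * (k - (q x)\<^sup>2)" using nr by (simp add: power_mult_distrib mult_left_mono)
    finally show ?thesis .
  qed
  have "k \<in> closure K" unfolding k_def by (intro closure_contains_Sup ne bdd)
  moreover have "closure K \<subseteq> {t. t\<^sup>2 \<le> C\<^sup>2 * (k - t)}"
  proof (rule closure_minimal)
    show "closed {t. t\<^sup>2 \<le> C\<^sup>2 * (k - t)}" by (intro closed_Collect_le continuous_intros)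
  qed (use main in \<open>auto simp: K_def\<close>)
  ultimately have "k = 0" by auto
  have "hnorm H (D x0) \<le> 0"
  proof -
    let ?u = "of_real (1 / hnorm H x0) \<odot> x0"
    have "hnorm H (D ?u) \<le> 0" using Dle[OF normalize[OF x0(1) \<open>hnorm H x0 \<noteq> 0\<close>]] \<open>k = 0\<close> by simp
    then show ?thesis
      using x0 Dc \<open>hnorm H x0 \<noteq> 0\<close> hnorm_nonneg[OF x0(1)] by (simp add: op_smult[OF Db] hnorm_smult norm_divide divide_le_0_iff)
  qed
  then show False using Dx0 hnorm_eq_0[OF Dc[OF x0(1)]] hnorm_nonneg[OF Dc[OF x0(1)]] by simp
qed

lemma abs_op_positive:
  assumes "A \<in> positive_ops H"
  shows "abs_op H A = A"
  unfolding abs_op_def hadjoint_symmetric[OF positive_bounded[OF assms] positive_symmetric[OF assms]]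
proof (rule the_equality)
  fix S assume S: "S \<in> positive_ops H \<and> compose (carrier H) S S = compose (carrier H) A A"
  then have "S (S x) = A (A x)" if "x \<in> carrier H" for x
    using that by (metis compose_eq)
  then show "S = A" using S by (intro positive_sqrt_unique[OF assms]) auto
qed (use assms in auto)

end

section \<open>Vector decompositions of positive operators and the trace\<close>

lemma has_sum_finite_sum:
  fixes f :: "'i \<Rightarrow> 'x \<Rightarrow> 'b :: topological_comm_monoid_add"
  assumes "finite I" "\<And>i. i \<in> I \<Longrightarrow> (f i has_sum s i) A"
  shows "((\<lambda>x. \<Sum>i\<in>I. f i x) has_sum (\<Sum>i\<in>I. s i)) A"
  using assms by (induction I) (auto intro!: has_sum_add)

lemma nonneg_double_has_sum:
  fixes f :: "'x \<Rightarrow> 'y \<Rightarrow> real"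
  assumes "\<And>x y. 0 \<le> f x y"
    and "\<And>x. x \<in> A \<Longrightarrow> (f x has_sum g x) B"
    and "\<And>y. y \<in> B \<Longrightarrow> ((\<lambda>x. f x y) has_sum h y) A"
    and g: "(g has_sum s) A"
  shows "(h has_sum s) B"
proof -
  let ?F = "\<lambda>(x, y). f x y"
  have "?F summable_on Sigma A (\<lambda>_. B)"
    by (rule summable_on_SigmaI[where g = g]) (use assms in \<open>auto simp: summable_on_def\<close>)
  then have "(?F has_sum s) (A \<times> B)"
    using assms by (intro has_sum_SigmaI[where g = g]) auto
  then have "((\<lambda>(y, x). f x y) has_sum s) (B \<times> A)"
    by (subst (asm) has_sum_swap) (simp add: case_prod_unfold)
  then show ?thesis by (rule has_sum_SigmaD) (use assms in auto)
qed

context hilbert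
begin

text \<open>The invariant of the elimination steps below.\<close>

definition psd :: "('a \<Rightarrow> 'a) \<Rightarrow> bool" where
  "psd B \<longleftrightarrow> (\<forall>x\<in>carrier H. B x \<in> carrier H) \<and>
     (\<forall>x\<in>carrier H. \<forall>y\<in>carrier H. B (x \<oplus> y) = B x \<oplus> B y) \<and>
     (\<forall>c. \<forall>x\<in>carrier H. B (c \<odot> x) = c \<odot> B x) \<and> symmetric B \<and>
     (\<forall>x\<in>carrier H. ip H x (B x) \<in> \<real>\<^sub>\<ge>\<^sub>0)"

lemma psdD:
  assumes "psd B"
  shows "x \<in> carrier H \<Longrightarrow> B x \<in> carrier H"
    and "x \<in> carrier H \<Longrightarrow> y \<in> carrier H \<Longrightarrow> B (x \<oplus> y) = B x \<oplus> B y"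
    and "x \<in> carrier H \<Longrightarrow> B (c \<odot> x) = c \<odot> B x"
    and "x \<in> carrier H \<Longrightarrow> y \<in> carrier H \<Longrightarrow> ip H (B x) y = ip H x (B y)"
    and "x \<in> carrier H \<Longrightarrow> ip H x (B x) \<in> \<real>\<^sub>\<ge>\<^sub>0"
  using assms by (auto simp: psd_def symmetric_def)

lemma psd_positive: "A \<in> positive_ops H \<Longrightarrow> psd A"
  using positive_symmetric[of A] positive_bounded[of A]
  by (auto simp: psd_def op_carrier op_add op_smult positive_ops_def)

lemma psd_ip_self: "psd B \<Longrightarrow> x \<in> carrier H \<Longrightarrow> ip H x (B x) = of_real (Re (ip H x (B x)))"
  using psdD(5)[of B x] by (auto simp: complex_eq_iff complex_nonneg_Reals_iff)

lemma psd_Re_nonneg: "psd B \<Longrightarrow> x \<in> carrier H \<Longrightarrow> 0 \<le> Re (ip H x (B x))"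
  using psdD(5)[of B x] by (auto simp: complex_nonneg_Reals_iff)

lemma psd_cauchy_schwarz:
  assumes B: "psd B" and xy: "x \<in> carrier H" "y \<in> carrier H"
  shows "(cmod (ip H x (B y)))\<^sup>2 \<le> Re (ip H x (B x)) * Re (ip H y (B y))"
proof (rule form_cauchy_schwarz)
  fix x y assume "x \<in> carrier H" "y \<in> carrier H"
  then show "cnj (ip H x (B y)) = ip H y (B x)"
    using psdD[OF B] ip_cnj[of x "B y"] by simp
qed (use psdD[OF B] xy in auto)

text \<open>
  One step of symmetric Gaussian elimination: \<open>\<bar>B z\<rangle>\<langle>B z\<bar> / \<langle>z, B z\<rangle>\<close> is subtracted from \<open>B\<close>, so that
  the difference is still positive and vanishes at \<open>z\<close>.
\<close>

definition pivot :: "('a \<Rightarrow> 'a) \<Rightarrow> 'a \<Rightarrow> 'a" where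
  "pivot B z = of_real (1 / sqrt (Re (ip H z (B z)))) \<odot> B z"

definition eliminate :: "('a \<Rightarrow> 'a) \<Rightarrow> 'a \<Rightarrow> 'a \<Rightarrow> 'a" where
  "eliminate B z x = B x \<ominus> ip H (pivot B z) x \<odot> pivot B z"

text \<open>
  If \<open>\<langle>z, B z\<rangle> = 0\<close> then \<open>B z = 0\<close> by the Cauchy-Schwarz inequality for the form of \<open>B\<close>; the
  convention \<open>1 / 0 = 0\<close> makes the pivot zero in this case, and the elimination step changes nothing.
\<close>

lemma psd_kernel:
  assumes "psd B" "z \<in> carrier H" "Re (ip H z (B z)) = 0"
  shows "B z = \<zero>"
  using psd_cauchy_schwarz[OF assms(1), of "B z" z] assms psdD(1)[OF assms(1)]
  by (auto intro: ip_self_eq_0)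

lemma
  assumes B: "psd B" and z: "z \<in> carrier H"
  shows pivot_carrier: "pivot B z \<in> carrier H"
    and ip_eliminate: "x \<in> carrier H \<Longrightarrow> ip H x (eliminate B z x) =
        of_real (Re (ip H x (B x)) - (cmod (ip H (pivot B z) x))\<^sup>2)"
    and eliminate_kernel: "x \<in> carrier H \<Longrightarrow> B x = \<zero> \<Longrightarrow> eliminate B z x = \<zero>"
    and eliminate_pivot: "eliminate B z z = \<zero>"
    and psd_eliminate: "psd (eliminate B z)"
proof -
  note Bc = psdD(1)[OF B] and Bs = psdD(4)[OF B]
  define t where "t = Re (ip H z (B z))"
  have t0: "t \<ge> 0" using psd_Re_nonneg[OF B z] by (simp add: t_def)
  show u: "pivot B z \<in> carrier H" using z Bc by (simp add: pivot_def)
  have ec: "eliminate B z x \<in> carrier H" if "x \<in> carrier H" for x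
    using that u Bc by (simp add: eliminate_def)
  show ip: "ip H x (eliminate B z x) = of_real (Re (ip H x (B x)) - (cmod (ip H (pivot B z) x))\<^sup>2)"
    if x: "x \<in> carrier H" for x
  proof -
    have "ip H x (eliminate B z x) = ip H x (B x) - ip H (pivot B z) x * ip H x (pivot B z)"
      using x u Bc by (simp add: eliminate_def)
    also have "ip H x (pivot B z) = cnj (ip H (pivot B z) x)" using ip_cnj u x by simp
    also have "ip H (pivot B z) x * cnj (ip H (pivot B z) x) = of_real ((cmod (ip H (pivot B z) x))\<^sup>2)"
      by (rule complex_norm_square[symmetric])
    finally show ?thesis using psd_ip_self[OF B x] by simp
  qed
  have ux: "ip H (pivot B z) x = of_real (1 / sqrt t) * ip H z (B x)" if "x \<in> carrier H" for x
    using that z Bc Bs by (simp add: pivot_def t_def)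
  show "eliminate B z x = \<zero>" if x: "x \<in> carrier H" "B x = \<zero>" for x
    using x u z by (intro ip_eqI) (auto simp: eliminate_def ux)
  show "eliminate B z z = \<zero>"
  proof (cases "t = 0")
    case True
    then show ?thesis using psd_kernel[OF B z] u z ux[OF z] by (intro ip_eqI) (auto simp: eliminate_def t_def)
  next
    case False
    have "ip H (pivot B z) z = of_real (sqrt t)"
      using ux[OF z] psd_ip_self[OF B z] False t0
      by (simp add: t_def[symmetric] of_real_mult[symmetric] of_real_divide[symmetric] real_div_sqrt
          del: of_real_mult of_real_divide)
    then have "ip H (pivot B z) z \<odot> pivot B z = B z"
      using z Bc False t0 by (intro ip_eqI) (auto simp: pivot_def t_def[symmetric])
    then show ?thesis using Bc z by (auto simp: eliminate_def intro: ip_eqI)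
  qed
  have "ip H x (eliminate B z x) \<in> \<real>\<^sub>\<ge>\<^sub>0" if x: "x \<in> carrier H" for x
  proof -
    have "(cmod (ip H (pivot B z) x))\<^sup>2 \<le> Re (ip H x (B x))"
    proof (cases "t = 0")
      case False
      have "(cmod (ip H (pivot B z) x))\<^sup>2 = (cmod (ip H z (B x)))\<^sup>2 / t"
        using t0 by (simp add: ux[OF x] norm_mult norm_divide power_mult_distrib power_divide)
      also have "\<dots> \<le> Re (ip H x (B x))"
        using psd_cauchy_schwarz[OF B z x] False t0 by (simp add: field_simps t_def)
      finally show ?thesis .
    qed (use psd_Re_nonneg[OF B x] in \<open>simp add: ux[OF x]\<close>)
    then show ?thesis by (simp add: ip[OF x] nonneg_Reals_of_real_iff del: of_real_diff)
  qed
  moreover have "symmetric (eliminate B z)"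
    unfolding symmetric_def
  proof (intro ballI)
    fix x y assume xy: "x \<in> carrier H" "y \<in> carrier H"
    then show "ip H (eliminate B z x) y = ip H x (eliminate B z y)"
      using u Bc Bs ip_cnj[OF u xy(1)] by (simp add: eliminate_def)
  qed
  moreover have "eliminate B z (x \<oplus> y) = eliminate B z x \<oplus> eliminate B z y"
    "eliminate B z (c \<odot> x) = c \<odot> eliminate B z x"
    if "x \<in> carrier H" "y \<in> carrier H" for x y c
    using that u Bc psdD(2,3)[OF B] by (auto simp: eliminate_def algebra_simps intro!: ip_eqI)
  ultimately show "psd (eliminate B z)" using ec unfolding psd_def by blast
qed

primrec schur_complement :: "('a \<Rightarrow> 'a) \<Rightarrow> (nat \<Rightarrow> 'a) \<Rightarrow> nat \<Rightarrow> 'a \<Rightarrow> 'a" where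
  "schur_complement A z 0 = A"
| "schur_complement A z (Suc n) = eliminate (schur_complement A z n) (z n)"

lemma psd_schur_complement: "psd A \<Longrightarrow> (\<And>n. z n \<in> carrier H) \<Longrightarrow> psd (schur_complement A z n)"
  by (induction n) (auto intro: psd_eliminate)

lemma schur_complement_kernel:
  assumes "psd A" "\<And>n. z n \<in> carrier H" "k < n"
  shows "schur_complement A z n (z k) = \<zero>"
  using assms(3)
proof (induction n)
  case (Suc n)
  then show ?case using assms psd_schur_complement[OF assms(1,2)]
    by (cases "k = n") (auto intro: eliminate_pivot eliminate_kernel)
qed simp

lemma ip_schur_complement:
  assumes "psd A" "\<And>n. z n \<in> carrier H" "x \<in> carrier H"
  shows "Re (ip H x (schur_complement A z n x)) =
    Re (ip H x (A x)) - (\<Sum>k<n. (cmod (ip H (pivot (schur_complement A z k) (z k)) x))\<^sup>2)"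
  using assms psd_schur_complement[OF assms(1,2)] by (induction n) (auto simp: ip_eliminate)

definition decomposes :: "(nat \<Rightarrow> 'a) \<Rightarrow> ('a \<Rightarrow> 'a) \<Rightarrow> bool" where
  "decomposes v A \<longleftrightarrow> (\<forall>i. v i \<in> carrier H) \<and>
     (\<forall>x\<in>carrier H. ((\<lambda>i. (cmod (ip H (v i) x))\<^sup>2) has_sum Re (ip H x (A x))) UNIV)"

text \<open>
  Symmetric Gaussian elimination along an orthonormal basis. After \<open>m\<close> steps the remaining positive
  operator vanishes on the span of the first \<open>m\<close> basis vectors, so its form at \<open>x\<close> is its form at
  the tail of the expansion of \<open>x\<close>. There it is dominated by the form of \<open>A\<close>, and the tail tends to
  zero. The subtracted squares therefore exhaust \<open>\<langle>x, A x\<rangle>\<close>.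
\<close>

theorem positive_decomposition:
  assumes A: "A \<in> positive_ops H" and z: "hilbert_basis z (UNIV :: nat set)"
  obtains v where "decomposes v A"
proof -
  have o: "orthonormal z UNIV" using z by (simp add: hilbert_basis_def)
  have zc: "z n \<in> carrier H" for n using orthonormalD(1)[OF o] by simp
  note psdS = psd_schur_complement[of A z, OF psd_positive[OF A] zc]
    and kernel = schur_complement_kernel[of A z, OF psd_positive[OF A] zc]
    and remainder = ip_schur_complement[of A z, OF psd_positive[OF A] zc]
  note Ac = op_carrier[OF positive_bounded[OF A]]
  define v where "v k = pivot (schur_complement A z k) (z k)" for k
  have v: "v k \<in> carrier H" for k unfolding v_def by (intro pivot_carrier psdS zc)
  obtain M where M: "M \<ge> 0" "\<And>x. x \<in> carrier H \<Longrightarrow> hnorm H (A x) \<le> M * hnorm H x"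
    using op_bound[OF positive_bounded[OF A]] by blast
  have "((\<lambda>i. (cmod (ip H (v i) x))\<^sup>2) has_sum Re (ip H x (A x))) UNIV" if x: "x \<in> carrier H" for x
  proof -
    define y where "y m = (\<Oplus>i\<in>{..<m}. ip H (z i) x \<odot> z i)" for m
    define d where "d m = (hdist H x (y m))\<^sup>2" for m
    define rest where "rest m = Re (ip H x (schur_complement A z m x))" for m
    have yc: "y m \<in> carrier H" for m unfolding y_def using zc by (intro finsum_closed) auto
    have d: "d m = (hnorm H x)\<^sup>2 - (\<Sum>i<m. (cmod (ip H (z i) x))\<^sup>2)" for m
      unfolding d_def y_def by (rule hdist_lincomb[OF o _ _ x]) auto
    have "(\<lambda>m. \<Sum>i<m. (cmod (ip H (z i) x))\<^sup>2) \<longlonglongrightarrow> (hnorm H x)\<^sup>2"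
      using has_sum_imp_sums[OF parseval[OF z x]] by (simp add: sums_def)
    then have "(\<lambda>m. (hnorm H x)\<^sup>2 - (\<Sum>i<m. (cmod (ip H (z i) x))\<^sup>2)) \<longlonglongrightarrow> (hnorm H x)\<^sup>2 - (hnorm H x)\<^sup>2"
      by (intro tendsto_diff tendsto_const)
    then have d0: "(\<lambda>m. M * d m) \<longlonglongrightarrow> 0" unfolding d by (intro tendsto_mult_right_zero) simp
    have upper: "rest m \<le> M * d m" for m
    proof -
      let ?S = "schur_complement A z m" and ?w = "x \<ominus> y m"
      have w: "?w \<in> carrier H" using x yc by simp
      have Sc: "?S u \<in> carrier H" if "u \<in> carrier H" for u using psdD(1)[OF psdS that] .
      have Sz: "ip H (?S u) (y m) = 0" if u: "u \<in> carrier H" for u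
      proof -
        have "ip H (?S u) (y m) = (\<Sum>i<m. ip H (z i) x * ip H (?S u) (z i))"
          unfolding y_def using Sc u zc by (subst ip_finsum_right) auto
        also have "\<dots> = 0"
          using psdD(4)[OF psdS] kernel u zc by (intro sum.neutral) auto
        finally show ?thesis .
      qed
      have "ip H (y m) (?S u) = 0" if u: "u \<in> carrier H" for u
        using ip_cnj[OF Sc[OF u] yc[of m]] Sz[OF u] by simp
      moreover have "ip H x (?S (y m)) = 0" using psdD(4)[OF psdS x yc] Sz[OF x] by simp
      moreover have "?S x = ?S ?w \<oplus> ?S (y m)"
      proof -
        have "x = ?w \<oplus> y m" using x yc by (intro ip_eqI) auto
        then show ?thesis using psdD(2)[OF psdS w yc[of m]] by metis
      qed
      ultimately have "ip H x (?S x) = ip H ?w (?S ?w)"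
        using x yc Sc w by simp
      then have "rest m = Re (ip H ?w (?S ?w))" by (simp add: rest_def)
      also have "\<dots> \<le> Re (ip H ?w (A ?w))"
        using remainder[OF w, of m] by (simp add: sum_nonneg)
      also have "\<dots> \<le> cmod (ip H ?w (A ?w))" by (rule complex_Re_le_cmod)
      also have "\<dots> \<le> hnorm H ?w * hnorm H (A ?w)" using w Ac by (intro cauchy_schwarz) auto
      also have "\<dots> \<le> hnorm H ?w * (M * hnorm H ?w)" using w M by (intro mult_left_mono) auto
      finally show ?thesis by (simp add: d_def hdist_def power2_eq_square algebra_simps)
    qed
    have "rest \<longlonglongrightarrow> 0"
      by (rule tendsto_sandwich[OF _ _ tendsto_const d0])
        (use upper psd_Re_nonneg[OF psdS x] in \<open>auto simp: rest_def\<close>)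
    then have "(\<lambda>n. Re (ip H x (A x)) - rest n) \<longlonglongrightarrow> Re (ip H x (A x)) - 0"
      by (intro tendsto_diff tendsto_const)
    moreover have "Re (ip H x (A x)) - rest n = (\<Sum>i<n. (cmod (ip H (v i) x))\<^sup>2)" for n
      using remainder[OF x, of n] by (simp add: rest_def v_def)
    ultimately have "(\<lambda>i. (cmod (ip H (v i) x))\<^sup>2) sums Re (ip H x (A x))" by (simp add: sums_def)
    then show ?thesis by (intro sums_nonneg_imp_has_sum) auto
  qed
  then show ?thesis using that[of v] v by (simp add: decomposes_def)
qed

text \<open>
  Both sides are the double sum of \<open>\<bar>\<langle>C v\<^sub>i, e\<rangle>\<bar>\<^sup>2\<close>, summed in the two orders; the inner sum over \<open>e\<close>
  is Parseval's identity.
\<close>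

lemma
  assumes decomp: "decomposes v A"
    and C: "C \<in> bounded_ops H" "symmetric C" and e: "hilbert_basis e I"
  shows decomposition_sum: "((\<lambda>i. (hnorm H (C (v i)))\<^sup>2) has_sum s) UNIV \<Longrightarrow>
      ((\<lambda>i. Re (ip H (C (e i)) (A (C (e i))))) has_sum s) I"
    and decomposition_sum': "((\<lambda>i. Re (ip H (C (e i)) (A (C (e i))))) has_sum s) I \<Longrightarrow>
      ((\<lambda>i. (hnorm H (C (v i)))\<^sup>2) has_sum s) UNIV"
proof -
  have v: "v i \<in> carrier H"
    "x \<in> carrier H \<Longrightarrow> ((\<lambda>i. (cmod (ip H (v i) x))\<^sup>2) has_sum Re (ip H x (A x))) UNIV" for i x
    using decomp by (auto simp: decomposes_def)
  define f where "f i k = (cmod (ip H (v k) (C (e i))))\<^sup>2" for i k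
  have ec: "e i \<in> carrier H" if "i \<in> I" for i using hilbert_basis_image[OF e] that by auto
  note Cc = op_carrier[OF C(1)]
  have rows: "(f i has_sum Re (ip H (C (e i)) (A (C (e i))))) UNIV" if "i \<in> I" for i
    unfolding f_def using v(2)[OF Cc[OF ec[OF that]]] .
  have cols: "((\<lambda>i. f i k) has_sum (hnorm H (C (v k)))\<^sup>2) I" for k
  proof (rule has_sum_cong[THEN iffD1, OF _ parseval[OF e Cc[OF v(1)[of k]]]])
    fix i assume i: "i \<in> I"
    have "ip H (e i) (C (v k)) = cnj (ip H (v k) (C (e i)))"
      using symmetricD[OF C(2) ec[OF i] v(1)[of k]] ip_cnj[of "v k" "C (e i)"] v Cc ec i by simp
    then show "(cmod (ip H (e i) (C (v k))))\<^sup>2 = f i k" by (simp add: f_def)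
  qed
  show "((\<lambda>i. Re (ip H (C (e i)) (A (C (e i))))) has_sum s) I"
    if "((\<lambda>i. (hnorm H (C (v i)))\<^sup>2) has_sum s) UNIV"
    by (rule nonneg_double_has_sum[where f = "\<lambda>k i. f i k", OF _ cols rows that]) (simp_all add: f_def)
  show "((\<lambda>i. (hnorm H (C (v i)))\<^sup>2) has_sum s) UNIV"
    if "((\<lambda>i. Re (ip H (C (e i)) (A (C (e i))))) has_sum s) I"
    by (rule nonneg_double_has_sum[where f = f, OF _ rows cols that]) (simp_all add: f_def)
qed

lemma bounded_ops_id: "(\<lambda>x\<in>carrier H. x) \<in> bounded_ops H" and symmetric_id: "symmetric (\<lambda>x\<in>carrier H. x)"
  by (auto intro: bounded_opsI[where M = 1] simp: symmetric_def)

text \<open>In each basis the sum equals \<open>\<Sum>\<^sub>i \<parallel>v\<^sub>i\<parallel>\<^sup>2\<close> for the same decomposition of \<open>A\<close>.\<close>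

lemma positive_trace_basis_independent:
  assumes A: "A \<in> positive_ops H" and z: "hilbert_basis z (UNIV :: nat set)"
    and e: "hilbert_basis e I" and f: "hilbert_basis f J"
    and s: "((\<lambda>i. Re (ip H (e i) (A (e i)))) has_sum s) I"
  shows "((\<lambda>i. Re (ip H (f i) (A (f i)))) has_sum s) J"
proof -
  obtain v where v: "decomposes v A"
    using positive_decomposition[OF A z] by blast
  let ?C = "\<lambda>x\<in>carrier H. x"
  have ec: "e i \<in> carrier H" if "i \<in> I" for i using hilbert_basis_image[OF e] that by auto
  have fc: "f i \<in> carrier H" if "i \<in> J" for i using hilbert_basis_image[OF f] that by auto
  have "((\<lambda>i. Re (ip H (?C (e i)) (A (?C (e i))))) has_sum s) I"
    using s by (rule has_sum_cong[THEN iffD1, rotated]) (use ec in auto)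
  then have "((\<lambda>i. (hnorm H (?C (v i)))\<^sup>2) has_sum s) UNIV"
    by (rule decomposition_sum'[OF v bounded_ops_id symmetric_id e])
  then have "((\<lambda>i. Re (ip H (?C (f i)) (A (?C (f i))))) has_sum s) J"
    by (rule decomposition_sum[OF v bounded_ops_id symmetric_id f])
  then show ?thesis by (rule has_sum_cong[THEN iffD1, rotated]) (use fc in auto)
qed

text \<open>
  The trace is defined by an arbitrary choice of a basis and membership by the existence of one; by
  independence a computation in a single basis \<open>E\<close> settles both.
\<close>

lemma
  assumes A: "A \<in> positive_ops H" and z: "hilbert_basis z (UNIV :: nat set)"
    and E: "orthonormal_basis H E"
    and s: "((\<lambda>e. Re (ip H e (A e))) has_sum s) E"
  shows pos_trace_classI: "A \<in> pos_trace_class H" and op_trace_eq: "op_trace H A = of_real s"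
proof -
  have cplx: "((\<lambda>e. ip H e (A e)) has_sum of_real s) E"
    if "orthonormal_basis H E" "((\<lambda>e. Re (ip H e (A e))) has_sum s) E" for E
    by (rule has_sum_cong[THEN iffD1, OF _ has_sum_of_real[OF that(2)]])
      (use that(1) psd_ip_self[OF psd_positive[OF A]] in \<open>auto simp: orthonormal_basis_def\<close>)
  show "A \<in> pos_trace_class H"
  proof -
    have "(\<lambda>e. ip H e (abs_op H A e)) summable_on E"
      unfolding abs_op_positive[OF A] summable_on_def using cplx[OF E s] by blast
    then have "A \<in> trace_class H"
      using E positive_bounded[OF A] unfolding trace_class_def by blast
    then show ?thesis using A by (simp add: pos_trace_class_def)
  qed
  let ?F = "SOME E. orthonormal_basis H E"
  have F: "orthonormal_basis H ?F" using E by (rule someI)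
  have "((\<lambda>e. Re (ip H e (A e))) has_sum s) ?F"
    by (rule positive_trace_basis_independent[OF A z orthonormal_basis_hilbert_basis[OF E]
        orthonormal_basis_hilbert_basis[OF F] s])
  from cplx[OF F this] show "op_trace H A = of_real s"
    by (simp add: op_trace_def infsumI)
qed

lemma pos_trace_classE:
  assumes A: "A \<in> pos_trace_class H" and z: "hilbert_basis z (UNIV :: nat set)"
  obtains E s where "orthonormal_basis H E" "((\<lambda>e. Re (ip H e (A e))) has_sum s) E"
    "op_trace H A = of_real s"
proof -
  have pos: "A \<in> positive_ops H" using A by (simp add: pos_trace_class_def)
  obtain E where "orthonormal_basis H E" "(\<lambda>e. ip H e (abs_op H A e)) summable_on E"
    using A unfolding pos_trace_class_def trace_class_def by blast
  then have E: "orthonormal_basis H E" "(\<lambda>e. ip H e (A e)) summable_on E"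
    unfolding abs_op_positive[OF pos] .
  then have "(\<lambda>e. Re (ip H e (A e))) summable_on E"
    unfolding summable_on_def using has_sum_Re by blast
  then obtain s where "((\<lambda>e. Re (ip H e (A e))) has_sum s) E" unfolding summable_on_def by blast
  then show ?thesis using that E(1) op_trace_eq[OF pos z E(1)] by blast
qed

end

section \<open>Conjugating a nucleus by a resolution of the identity\<close>

context hilbert
begin

text \<open>
  Choose \<open>v\<^sub>x\<close> decomposing \<open>\<omega> x\<close>. The contribution of \<open>\<epsilon>\<close> to the trace at \<open>x\<close> is
  \<open>\<Sum>\<^sub>i \<parallel>C\<^sub>\<epsilon> v\<^sub>i\<parallel>\<^sup>2\<close> with \<open>v = v\<^bsub>x - \<epsilon>\<^esub>\<close>. Summing over all \<open>x\<close>, the shift by \<open>\<epsilon>\<close> disappears, and the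
  sum over \<open>\<epsilon>\<close> restores \<open>\<Sum>\<^sub>i \<parallel>v\<^sub>i\<parallel>\<^sup>2\<close>, the trace of \<open>\<omega> x\<close>.
\<close>

theorem nuclei_conjugation:
  fixes \<omega> :: "int ^ 'd \<Rightarrow> 'a \<Rightarrow> 'a"
  assumes z: "hilbert_basis z (UNIV :: nat set)" and S: "finite S"
    and Cb: "\<And>\<epsilon>. \<epsilon> \<in> S \<Longrightarrow> C \<epsilon> \<in> bounded_ops H" and Cs: "\<And>\<epsilon>. \<epsilon> \<in> S \<Longrightarrow> symmetric (C \<epsilon>)"
    and res: "\<And>x. x \<in> carrier H \<Longrightarrow> (\<Sum>\<epsilon>\<in>S. (hnorm H (C \<epsilon> x))\<^sup>2) = (hnorm H x)\<^sup>2"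
    and \<omega>: "\<omega> \<in> nuclei H"
  shows "(\<lambda>x. op_sum H (\<lambda>\<epsilon>. compose (carrier H) (C \<epsilon>) (compose (carrier H) (\<omega> (x - \<epsilon>)) (C \<epsilon>))) S) \<in> nuclei H"
    (is "?J \<in> _")
proof -
  have tc: "\<omega> x \<in> pos_trace_class H" and tr1: "((\<lambda>x. op_trace H (\<omega> x)) has_sum 1) UNIV" for x
    using \<omega> by (auto simp: nuclei_def)
  have pos: "\<omega> x \<in> positive_ops H" for x using tc by (simp add: pos_trace_class_def)
  note wb = positive_bounded[OF pos]
  note wc = op_carrier[OF wb] and Cc = op_carrier[OF Cb]
  obtain E where E: "orthonormal_basis H E" using pos_trace_classE[OF tc z] by metis
  note Eb = orthonormal_basis_hilbert_basis[OF E]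
  have Ec: "e \<in> carrier H" if "e \<in> E" for e using E that by (auto simp: orthonormal_basis_def)
  have "\<forall>x. \<exists>v. decomposes v (\<omega> x)" using positive_decomposition[OF pos z] by blast
  then obtain v where v: "\<And>x. decomposes (v x) (\<omega> x)" by metis
  have vc: "v x i \<in> carrier H" for x i using v[of x] by (simp add: decomposes_def)
  have "\<exists>s. op_trace H (\<omega> x) = of_real s \<and> ((\<lambda>i. (hnorm H (v x i))\<^sup>2) has_sum s) UNIV" for x
  proof -
    obtain F s where F: "orthonormal_basis H F" "((\<lambda>e. Re (ip H e (\<omega> x e))) has_sum s) F"
      "op_trace H (\<omega> x) = of_real s" using pos_trace_classE[OF tc z] by metis
    let ?C = "\<lambda>x\<in>carrier H. x"
    have "((\<lambda>e. Re (ip H (?C e) (\<omega> x (?C e)))) has_sum s) F"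
      using F(2) by (rule has_sum_cong[THEN iffD1, rotated]) (use F(1) in \<open>auto simp: orthonormal_basis_def\<close>)
    then have "((\<lambda>i. (hnorm H (?C (v x i)))\<^sup>2) has_sum s) UNIV"
      by (rule decomposition_sum'[OF v bounded_ops_id symmetric_id orthonormal_basis_hilbert_basis[OF F(1)]])
    then show ?thesis using F(3) vc by auto
  qed
  then obtain s where s: "\<And>x. op_trace H (\<omega> x) = of_real (s x)"
      "\<And>x. ((\<lambda>i. (hnorm H (v x i))\<^sup>2) has_sum s x) UNIV" by metis
  have sum_s: "(s has_sum 1) UNIV"
    using tr1 unfolding s(1) by (metis has_sum_of_real_iff of_real_1)
  have le: "(hnorm H (C \<epsilon> x))\<^sup>2 \<le> (hnorm H x)\<^sup>2" if "\<epsilon> \<in> S" "x \<in> carrier H" for \<epsilon> x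
    using member_le_sum[of \<epsilon> S "\<lambda>\<epsilon>. (hnorm H (C \<epsilon> x))\<^sup>2"] res[OF that(2)] S that(1) by simp
  define t where "t \<epsilon> x = (\<Sum>\<^sub>\<infinity>i. (hnorm H (C \<epsilon> (v x i)))\<^sup>2)" for \<epsilon> x
  have t: "((\<lambda>i. (hnorm H (C \<epsilon> (v x i)))\<^sup>2) has_sum t \<epsilon> x) UNIV" if "\<epsilon> \<in> S" for \<epsilon> x
    unfolding t_def
  proof (rule has_sum_infsum)
    show "(\<lambda>i. (hnorm H (C \<epsilon> (v x i)))\<^sup>2) summable_on UNIV"
      by (rule summable_on_comparison_test[of "\<lambda>i. (hnorm H (v x i))\<^sup>2"])
        (use s(2) le[OF that vc] in \<open>auto simp: summable_on_def\<close>)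
  qed
  have t_nonneg: "0 \<le> t \<epsilon> x" if "\<epsilon> \<in> S" for \<epsilon> x by (rule has_sum_nonneg[OF t[OF that]]) simp
  have sum_t: "(\<Sum>\<epsilon>\<in>S. t \<epsilon> x) = s x" for x
  proof (rule has_sum_unique)
    show "((\<lambda>i. \<Sum>\<epsilon>\<in>S. (hnorm H (C \<epsilon> (v x i)))\<^sup>2) has_sum (\<Sum>\<epsilon>\<in>S. t \<epsilon> x)) UNIV"
      using S t by (rule has_sum_finite_sum)
    show "((\<lambda>i. \<Sum>\<epsilon>\<in>S. (hnorm H (C \<epsilon> (v x i)))\<^sup>2) has_sum s x) UNIV"
      using s(2)[of x] by (simp add: res vc)
  qed
  define G where "G \<epsilon> = (\<Sum>\<^sub>\<infinity>x. t \<epsilon> x)" for \<epsilon>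
  have G: "(t \<epsilon> has_sum G \<epsilon>) UNIV" if "\<epsilon> \<in> S" for \<epsilon>
    unfolding G_def
  proof (rule has_sum_infsum)
    show "t \<epsilon> summable_on UNIV"
    proof (rule summable_on_comparison_test[of s])
      show "t \<epsilon> x \<le> s x" for x
        using member_le_sum[of \<epsilon> S "\<lambda>\<epsilon>. t \<epsilon> x"] t_nonneg S that sum_t[of x] by simp
    qed (use sum_s t_nonneg that in \<open>auto simp: summable_on_def\<close>)
  qed
  have sum_G: "(\<Sum>\<epsilon>\<in>S. G \<epsilon>) = 1"
  proof (rule has_sum_unique)
    show "((\<lambda>x. \<Sum>\<epsilon>\<in>S. t \<epsilon> x) has_sum (\<Sum>\<epsilon>\<in>S. G \<epsilon>)) UNIV"
      using S G by (rule has_sum_finite_sum)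
    show "((\<lambda>x. \<Sum>\<epsilon>\<in>S. t \<epsilon> x) has_sum 1) UNIV" using sum_s by (simp add: sum_t)
  qed
  have ip_J: "ip H y (?J x y) = (\<Sum>\<epsilon>\<in>S. ip H (C \<epsilon> y) (\<omega> (x - \<epsilon>) (C \<epsilon> y)))"
    if y: "y \<in> carrier H" for x y
    using y Cc wc symmetricD[OF Cs]
    by (simp add: op_sum_def ip_finsum_right Pi_iff compose_eq)
  have Jpos: "?J x \<in> positive_ops H" for x
  proof -
    have "?J x \<in> bounded_ops H"
      by (intro bounded_ops_op_sum bounded_ops_compose S Cb wb)
    moreover have "ip H y (?J x y) \<in> \<real>\<^sub>\<ge>\<^sub>0" if y: "y \<in> carrier H" for y
    proof -
      have "ip H y (?J x y) = (\<Sum>\<epsilon>\<in>S. of_real (Re (ip H (C \<epsilon> y) (\<omega> (x - \<epsilon>) (C \<epsilon> y)))))"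
        unfolding ip_J[OF y] using y Cc by (intro sum.cong refl psd_ip_self psd_positive pos) auto
      moreover have "0 \<le> (\<Sum>\<epsilon>\<in>S. Re (ip H (C \<epsilon> y) (\<omega> (x - \<epsilon>) (C \<epsilon> y))))"
        using y Cc by (intro sum_nonneg positive_Re pos) auto
      ultimately show ?thesis by (metis nonneg_Reals_of_real_iff of_real_sum)
    qed
    ultimately show ?thesis unfolding positive_ops_def by blast
  qed
  have Jtr: "((\<lambda>e. Re (ip H e (?J x e))) has_sum (\<Sum>\<epsilon>\<in>S. t \<epsilon> (x - \<epsilon>))) E" for x
  proof (rule has_sum_cong[THEN iffD1])
    show "((\<lambda>e. \<Sum>\<epsilon>\<in>S. Re (ip H (C \<epsilon> e) (\<omega> (x - \<epsilon>) (C \<epsilon> e)))) has_sum (\<Sum>\<epsilon>\<in>S. t \<epsilon> (x - \<epsilon>))) E"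
      using S by (rule has_sum_finite_sum) (intro decomposition_sum[OF v Cb Cs Eb] t)
  qed (use ip_J Ec in simp)
  have "((\<lambda>x. \<Sum>\<epsilon>\<in>S. t \<epsilon> (x - \<epsilon>)) has_sum (\<Sum>\<epsilon>\<in>S. G \<epsilon>)) UNIV"
    using S
  proof (rule has_sum_finite_sum)
    fix \<epsilon> assume "\<epsilon> \<in> S"
    have "bij (\<lambda>x. x - \<epsilon>)" by (rule bij_betw_byWitness[where f' = "\<lambda>x. x + \<epsilon>"]) auto
    then show "((\<lambda>x. t \<epsilon> (x - \<epsilon>)) has_sum G \<epsilon>) UNIV"
      using has_sum_reindex_bij_betw[of "\<lambda>x. x - \<epsilon>" UNIV UNIV "t \<epsilon>"] G[OF \<open>\<epsilon> \<in> S\<close>] by simp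
  qed
  then have "((\<lambda>x. op_trace H (?J x)) has_sum 1) UNIV"
    unfolding op_trace_eq[OF Jpos z E Jtr] sum_G using has_sum_of_real by fastforce
  then show ?thesis
    unfolding nuclei_def using pos_trace_classI[OF Jpos z E Jtr] by blast
qed

end

section \<open>Transport along a unitary isomorphism\<close>

lemma linear_mapsD:
  assumes "K \<in> linear_maps V W"
  shows "x \<in> carrier V \<Longrightarrow> K x \<in> carrier W"
    and "x \<in> carrier V \<Longrightarrow> y \<in> carrier V \<Longrightarrow> K (x \<oplus>\<^bsub>V\<^esub> y) = K x \<oplus>\<^bsub>W\<^esub> K y"
    and "x \<in> carrier V \<Longrightarrow> K (c \<odot>\<^bsub>V\<^esub> x) = c \<odot>\<^bsub>W\<^esub> K x"
  using assms by (auto simp: linear_maps_def)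

lemma unitary_isoD:
  assumes "unitary_iso V W K"
  shows "x \<in> carrier V \<Longrightarrow> K x \<in> carrier W"
    and "x \<in> carrier V \<Longrightarrow> y \<in> carrier V \<Longrightarrow> K (x \<oplus>\<^bsub>V\<^esub> y) = K x \<oplus>\<^bsub>W\<^esub> K y"
    and "x \<in> carrier V \<Longrightarrow> K (c \<odot>\<^bsub>V\<^esub> x) = c \<odot>\<^bsub>W\<^esub> K x"
    and "x \<in> carrier V \<Longrightarrow> y \<in> carrier V \<Longrightarrow> ip W (K x) (K y) = ip V x y"
    and "bij_betw K (carrier V) (carrier W)"
  using assms linear_mapsD[of K V W] by (auto simp: unitary_iso_def)

text \<open>
  Being onto and isometric, \<open>K\<close> carries all axioms of a Hilbert space over, completeness included,
  except that it does not see the distinguished zero of the target record.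
\<close>

lemma unitary_iso_hilbert:
  fixes V :: "('a, 'm) inner_space_scheme" and W :: "('b, 'n) inner_space_scheme"
  assumes V: "hilbert V" and K: "unitary_iso V W K"
    and zero: "\<zero>\<^bsub>W\<^esub> \<in> carrier W" "\<And>x. x \<in> carrier W \<Longrightarrow> \<zero>\<^bsub>W\<^esub> \<oplus>\<^bsub>W\<^esub> x = x"
  shows "hilbert W"
proof -
  interpret V: hilbert V by (rule V)
  note D = unitary_isoD[OF K]
  note Dsym = D(2,3)[symmetric]
  have onto: "\<exists>u\<in>carrier V. x = K u" if "x \<in> carrier W" for x
    using D(5) that by (auto simp: bij_betw_def)
  have K0: "K \<zero>\<^bsub>V\<^esub> = \<zero>\<^bsub>W\<^esub>"
  proof -
    obtain u where u: "u \<in> carrier V" "\<zero>\<^bsub>W\<^esub> = K u" using onto zero(1) by blast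
    have "K u = K (u \<oplus>\<^bsub>V\<^esub> \<zero>\<^bsub>V\<^esub>)" using u by simp
    also have "\<dots> = \<zero>\<^bsub>W\<^esub> \<oplus>\<^bsub>W\<^esub> K \<zero>\<^bsub>V\<^esub>" unfolding u(2) by (rule D(2)[OF u(1) V.zero_closed])
    also have "\<dots> = K \<zero>\<^bsub>V\<^esub>" by (intro zero(2) D(1) V.zero_closed)
    finally show ?thesis using u by simp
  qed
  have ag: "abelian_group W"
  proof (rule abelian_groupI)
    show "\<exists>y\<in>carrier W. y \<oplus>\<^bsub>W\<^esub> x = \<zero>\<^bsub>W\<^esub>" if "x \<in> carrier W" for x
    proof -
      obtain u where u: "u \<in> carrier V" "x = K u" using onto \<open>x \<in> carrier W\<close> by blast
      have "K (\<ominus>\<^bsub>V\<^esub> u) \<oplus>\<^bsub>W\<^esub> x = K \<zero>\<^bsub>V\<^esub>" using u by (simp add: Dsym V.l_neg)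
      then show ?thesis using u D(1) K0 by auto
    qed
    show "x \<oplus>\<^bsub>W\<^esub> y \<in> carrier W" if "x \<in> carrier W" "y \<in> carrier W" for x y
      using onto[OF that(1)] onto[OF that(2)] by (auto simp: Dsym D(1))
    show "(x \<oplus>\<^bsub>W\<^esub> y) \<oplus>\<^bsub>W\<^esub> w = x \<oplus>\<^bsub>W\<^esub> (y \<oplus>\<^bsub>W\<^esub> w)"
      if "x \<in> carrier W" "y \<in> carrier W" "w \<in> carrier W" for x y w
      using onto[OF that(1)] onto[OF that(2)] onto[OF that(3)] by (auto simp: Dsym D(1) V.a_assoc)
    show "x \<oplus>\<^bsub>W\<^esub> y = y \<oplus>\<^bsub>W\<^esub> x" if "x \<in> carrier W" "y \<in> carrier W" for x y
      using onto[OF that(1)] onto[OF that(2)] by (auto simp: Dsym D(1) V.a_comm)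
  qed (use zero in auto)
  interpret W: abelian_group W by (rule ag)
  have Kminus: "K u \<ominus>\<^bsub>W\<^esub> K v = K (u \<ominus>\<^bsub>V\<^esub> v)" if "u \<in> carrier V" "v \<in> carrier V" for u v
  proof -
    have "K (\<ominus>\<^bsub>V\<^esub> v) \<oplus>\<^bsub>W\<^esub> K v = \<zero>\<^bsub>W\<^esub>" using that by (simp add: Dsym V.l_neg K0)
    then have "\<ominus>\<^bsub>W\<^esub> K v = K (\<ominus>\<^bsub>V\<^esub> v)" using that D(1) by (intro W.minus_equality) auto
    then show ?thesis using that by (simp add: a_minus_def Dsym)
  qed
  have Kdist: "hdist W (K u) (K v) = hdist V u v" if "u \<in> carrier V" "v \<in> carrier V" for u v
    using that by (simp add: hdist_def hnorm_def Kminus D(4))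
  have VR: "Module.module (ring_of_type_algebra :: complex ring) V" by (rule V.module)
  have mod: "Module.module (ring_of_type_algebra :: complex ring) W"
  proof (rule Module.moduleI)
    show "cring (ring_of_type_algebra :: complex ring)" by (rule cring_from_type_algebra)
    fix a b x y assume ab: "a \<in> carrier (ring_of_type_algebra :: complex ring)"
      "b \<in> carrier (ring_of_type_algebra :: complex ring)" and x: "x \<in> carrier W"
    obtain u where u: "u \<in> carrier V" "x = K u" using onto x by blast
    show "(a \<oplus>\<^bsub>ring_of_type_algebra\<^esub> b) \<odot>\<^bsub>W\<^esub> x = a \<odot>\<^bsub>W\<^esub> x \<oplus>\<^bsub>W\<^esub> b \<odot>\<^bsub>W\<^esub> x"
      using u ab Module.module.smult_l_distr[OF VR ab u(1)] by (simp add: Dsym)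
    show "(a \<otimes>\<^bsub>ring_of_type_algebra\<^esub> b) \<odot>\<^bsub>W\<^esub> x = a \<odot>\<^bsub>W\<^esub> (b \<odot>\<^bsub>W\<^esub> x)"
      using u ab Module.module.smult_assoc1[OF VR ab u(1)] by (simp add: Dsym)
  next
    fix a x y assume a: "a \<in> carrier (ring_of_type_algebra :: complex ring)"
      and x: "x \<in> carrier W" and y: "y \<in> carrier W"
    obtain u where u: "u \<in> carrier V" "x = K u" using onto x by blast
    obtain v where v: "v \<in> carrier V" "y = K v" using onto y by blast
    show "a \<odot>\<^bsub>W\<^esub> (x \<oplus>\<^bsub>W\<^esub> y) = a \<odot>\<^bsub>W\<^esub> x \<oplus>\<^bsub>W\<^esub> a \<odot>\<^bsub>W\<^esub> y"
      using u v a Module.module.smult_r_distr[OF VR a u(1) v(1)] by (simp add: Dsym)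
  next
    fix a x assume x: "x \<in> carrier W"
    obtain u where u: "u \<in> carrier V" "x = K u" using onto x by blast
    show "a \<odot>\<^bsub>W\<^esub> x \<in> carrier W" using u D(1) by (simp add: Dsym)
    show "\<one>\<^bsub>ring_of_type_algebra\<^esub> \<odot>\<^bsub>W\<^esub> x = x"
      using u Module.module.smult_one[OF VR u(1)] by (simp add: Dsym)
  qed (rule ag)
  have add: "ip W x (y \<oplus>\<^bsub>W\<^esub> w) = ip W x y + ip W x w"
    if "x \<in> carrier W" "y \<in> carrier W" "w \<in> carrier W" for x y w
    using onto[OF that(1)] onto[OF that(2)] onto[OF that(3)] by (auto simp: Dsym D(4))
  have scal: "ip W x (c \<odot>\<^bsub>W\<^esub> y) = c * ip W x y" and conj: "ip W x y = cnj (ip W y x)"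
    if "x \<in> carrier W" "y \<in> carrier W" for x y c
    using onto[OF that(1)] onto[OF that(2)] by (auto simp: Dsym D(4) V.ip_cnj)
  have nonneg: "ip W x x \<in> \<real>\<^sub>\<ge>\<^sub>0" if "x \<in> carrier W" for x
    using onto[OF that] V.ip_self_nonneg by (auto simp: D(4))
  have definite: "x = \<zero>\<^bsub>W\<^esub>" if "x \<in> carrier W" "ip W x x = 0" for x
    using onto[OF that(1)] that(2) V.ip_self_eq_0 D(4) K0 by metis
  have complete: "\<exists>x\<in>carrier W. (\<lambda>n. hdist W (s n) x) \<longlonglongrightarrow> 0"
    if s: "range s \<subseteq> carrier W" "\<forall>e>0. \<exists>N. \<forall>m\<ge>N. \<forall>n\<ge>N. hdist W (s m) (s n) < e" for s :: "nat \<Rightarrow> 'b"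
  proof -
    have "\<forall>n. \<exists>u\<in>carrier V. s n = K u" using onto s(1) by blast
    then obtain r where r: "\<And>n. r n \<in> carrier V" "\<And>n. s n = K (r n)" by metis
    obtain u where u: "u \<in> carrier V" "(\<lambda>n. hdist V (r n) u) \<longlonglongrightarrow> 0"
    proof (rule V.complete[of r])
      fix e :: real assume "e > 0"
      then show "\<exists>N. \<forall>m\<ge>N. \<forall>n\<ge>N. hdist V (r m) (r n) < e"
        using s(2) r by (simp add: Kdist)
    qed (use r in auto)
    then show ?thesis using r D(1) Kdist by (intro bexI[of _ "K u"]) auto
  qed
  show ?thesis
    unfolding hilbert_def complex_hilbert_space_def
    by (intro conjI ballI allI impI, rule mod, (rule add; assumption), (rule scal; assumption),
      (rule conj; assumption), (rule nonneg; assumption), (rule definite; assumption),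
      elim conjE, (rule complete; assumption))
qed

section \<open>Spaces of square integrable functions\<close>

lemma square_integrableD:
  assumes "f \<in> square_integrable M"
  shows "f \<in> borel_measurable M" "integrable M (\<lambda>x. (cmod (f x))\<^sup>2)"
  using assms by (auto simp: square_integrable_def)

lemma square_integrable_cong_AE:
  assumes "f \<in> square_integrable M" "g \<in> borel_measurable M" "AE x in M. f x = g x"
  shows "g \<in> square_integrable M"
proof -
  have "integrable M (\<lambda>x. (cmod (g x))\<^sup>2)"
    by (rule Bochner_Integration.integrable_cong_AE_imp[OF square_integrableD(2)[OF assms(1)]])
      (use assms in auto)
  then show ?thesis using assms(2) by (simp add: square_integrable_def)
qed

lemma integrable_mult_square_integrable:
  assumes "f \<in> square_integrable M" "g \<in> square_integrable M"
  shows "integrable M (\<lambda>x. cnj (f x) * g x)"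
proof (rule Bochner_Integration.integrable_bound)
  note [measurable] = square_integrableD(1)[OF assms(1)] square_integrableD(1)[OF assms(2)]
  show "integrable M (\<lambda>x. (cmod (f x))\<^sup>2 + (cmod (g x))\<^sup>2)"
    using square_integrableD(2)[OF assms(1)] square_integrableD(2)[OF assms(2)] by simp
  show "(\<lambda>x. cnj (f x) * g x) \<in> borel_measurable M"
    by (intro borel_measurable_times borel_measurable_continuous_on[OF continuous_on_cnj[OF continuous_on_id]]) simp_all
  have "cmod (f x) * cmod (g x) \<le> (cmod (f x))\<^sup>2 + (cmod (g x))\<^sup>2" for x
    using sum_squares_bound[of "cmod (f x)" "cmod (g x)"]
      mult_nonneg_nonneg[OF norm_ge_zero norm_ge_zero, of "f x" "g x"] by linarith
  then show "AE x in M. norm (cnj (f x) * g x) \<le> norm ((cmod (f x))\<^sup>2 + (cmod (g x))\<^sup>2)"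
    by (intro AE_I2) (simp add: norm_mult)
qed

lemma equiv_ae_rel: "equiv (square_integrable M) (ae_rel M)"
proof (rule equivI)
  show "sym (ae_rel M)" by (auto simp: sym_def ae_rel_def elim: AE_mp)
  show "trans (ae_rel M)"
  proof (rule transI)
    fix f g h assume fgh: "(f, g) \<in> ae_rel M" "(g, h) \<in> ae_rel M"
    then have "AE x in M. f x = g x" "AE x in M. g x = h x" by (auto simp: ae_rel_def)
    then have "AE x in M. f x = h x" by eventually_elim simp
    then show "(f, h) \<in> ae_rel M" using fgh by (simp add: ae_rel_def)
  qed
qed (auto simp: refl_on_def ae_rel_def)

lemma ae_class_carrier: "f \<in> square_integrable M \<Longrightarrow> ae_class M f \<in> carrier (L2_space M)"
  by (simp add: L2_space_def ae_class_def quotientI)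

lemma ae_class_eqI:
  assumes "f \<in> square_integrable M" "g \<in> square_integrable M" "AE x in M. f x = g x"
  shows "ae_class M f = ae_class M g"
  unfolding ae_class_def using assms by (intro equiv_class_eq[OF equiv_ae_rel]) (simp add: ae_rel_def)

lemma rep_ae_class:
  assumes "f \<in> square_integrable M"
  shows "rep (ae_class M f) \<in> square_integrable M" "AE x in M. f x = rep (ae_class M f) x"
proof -
  have "f \<in> ae_class M f" using assms by (simp add: ae_class_def ae_rel_def)
  then have "rep (ae_class M f) \<in> ae_class M f" unfolding rep_def by (rule someI[where P = "\<lambda>g. g \<in> ae_class M f"])
  then show "rep (ae_class M f) \<in> square_integrable M" "AE x in M. f x = rep (ae_class M f) x"
    by (auto simp: ae_class_def ae_rel_def)
qed

lemma L2_carrierE: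
  assumes "F \<in> carrier (L2_space M)"
  obtains f where "f \<in> square_integrable M" "F = ae_class M f"
  using assms by (auto simp: L2_space_def ae_class_def elim: quotientE)

lemma ip_L2:
  assumes f: "f \<in> square_integrable M" and g: "g \<in> square_integrable M"
  shows "ip (L2_space M) (ae_class M f) (ae_class M g) = (\<integral>x. cnj (f x) * g x \<partial>M)"
proof -
  have "(\<integral>x. cnj (rep (ae_class M f) x) * rep (ae_class M g) x \<partial>M) = (\<integral>x. cnj (f x) * g x \<partial>M)"
  proof (rule integral_cong_AE)
    show "AE x in M. cnj (rep (ae_class M f) x) * rep (ae_class M g) x = cnj (f x) * g x"
      using rep_ae_class(2)[OF f] rep_ae_class(2)[OF g] by eventually_elim simp
  qed (intro borel_measurable_integrable integrable_mult_square_integrable rep_ae_class f g)+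
  then show ?thesis by (simp add: L2_space_def)
qed

lemma zero_square_integrable: "(\<lambda>_. 0) \<in> square_integrable M"
  by (simp add: square_integrable_def)

lemma L2_zero_carrier: "\<zero>\<^bsub>L2_space M\<^esub> \<in> carrier (L2_space M)"
  using ae_class_carrier[OF zero_square_integrable] by (simp add: L2_space_def)

lemma L2_zero_add:
  assumes "F \<in> carrier (L2_space M)"
  shows "\<zero>\<^bsub>L2_space M\<^esub> \<oplus>\<^bsub>L2_space M\<^esub> F = F"
proof -
  obtain f where f: "f \<in> square_integrable M" "F = ae_class M f" using L2_carrierE[OF assms] .
  let ?g = "\<lambda>x. rep (ae_class M (\<lambda>_. 0)) x + rep F x"
  note r = rep_ae_class[OF zero_square_integrable[of M]] rep_ae_class[OF f(1)]
  have ae: "AE x in M. f x = ?g x"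
    using r(2) r(4) unfolding f(2) by eventually_elim simp
  have meas: "?g \<in> borel_measurable M"
    unfolding f(2) by (intro borel_measurable_add square_integrableD(1) r)
  have "ae_class M ?g = ae_class M f"
    using ae_class_eqI[OF f(1) square_integrable_cong_AE[OF f(1) meas ae] ae] by simp
  then show ?thesis by (simp add: L2_space_def f(2))
qed

section \<open>The Bernoulli measure\<close>

definition bern_spec :: "(nat \<Rightarrow> real) \<Rightarrow> (nat \<Rightarrow> int) measure \<Rightarrow> bool" where
  "bern_spec p M \<longleftrightarrow> prob_space M \<and> space M = bern_space \<and>
     sets M = sigma_sets bern_space {{f \<in> bern_space. f n \<in> B} | n B. B \<subseteq> {-1, 1}} \<and>
     (\<forall>N e. finite N \<and> N \<noteq> {} \<and> e \<in> N \<rightarrow> {-1, 1} \<longrightarrow>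
        measure M {f \<in> bern_space. \<forall>j\<in>N. f j = e j} =
          (\<Prod>j\<in>N. p j powr ((1 + of_int (e j)) / 2) * (1 - p j) powr ((1 - of_int (e j)) / 2)))"

text \<open>
  Constraining each coordinate to a set, and not only to a point, makes the cylinders closed under
  intersection.
\<close>

definition cylinder :: "nat set \<Rightarrow> (nat \<Rightarrow> int set) \<Rightarrow> (nat \<Rightarrow> int) set" where
  "cylinder N A = {f \<in> bern_space. \<forall>j\<in>N. f j \<in> A j}"

definition cylinders :: "(nat \<Rightarrow> int) set set" where
  "cylinders = {cylinder N A | N A. finite N}"

lemma Int_stable_cylinders: "Int_stable cylinders"
proof (rule Int_stableI)
  fix a b assume "a \<in> cylinders" "b \<in> cylinders"
  then obtain N A N' A' where ab: "a = cylinder N A" "finite N" "b = cylinder N' A'" "finite N'"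
    by (auto simp: cylinders_def)
  have "a \<inter> b = cylinder (N \<union> N') (\<lambda>j. (if j \<in> N then A j else UNIV) \<inter> (if j \<in> N' then A' j else UNIV))"
    by (auto simp: cylinder_def ab)
  then show "a \<inter> b \<in> cylinders" using ab by (auto simp: cylinders_def)
qed

lemma cylinders_Pow: "cylinders \<subseteq> Pow bern_space"
  by (auto simp: cylinders_def cylinder_def)

lemma bern_space_cylinder: "bern_space = cylinder {} A"
  by (simp add: cylinder_def)

lemma sigma_sets_cylinders:
  "sigma_sets bern_space {{f \<in> bern_space. f n \<in> B} | n B. B \<subseteq> {-1, 1}} = sigma_sets bern_space cylinders"
    (is "sigma_sets _ ?S = _")
proof (rule sigma_sets_eqI)
  fix a assume "a \<in> ?S"
  then obtain n B where "a = cylinder {n} (\<lambda>_. B)" by (auto simp: cylinder_def)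
  then show "a \<in> sigma_sets bern_space cylinders" by (auto simp: cylinders_def)
next
  interpret sigma_algebra bern_space "sigma_sets bern_space ?S"
    by (rule sigma_algebra_sigma_sets) auto
  have "cylinder N A \<in> sigma_sets bern_space ?S" if "finite N" for N A
    using that
  proof (induction N)
    case empty
    then show ?case by (simp add: cylinder_def)
  next
    case (insert n N)
    have "{f \<in> bern_space. f n \<in> A n \<inter> {-1, 1}} \<in> ?S" by blast
    then have "{f \<in> bern_space. f n \<in> A n \<inter> {-1, 1}} \<in> sigma_sets bern_space ?S" by blast
    moreover have "cylinder (insert n N) A = {f \<in> bern_space. f n \<in> A n \<inter> {-1, 1}} \<inter> cylinder N A"
      by (auto simp: cylinder_def bern_space_def)
    ultimately show ?case using insert by auto
  qed
  then show "b \<in> sigma_sets bern_space ?S" if "b \<in> cylinders" for b using that by (auto simp: cylinders_def)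
qed

locale bernoulli_weights =
  fixes p :: "nat \<Rightarrow> real"
  assumes p: "0 < p k" "p k < 1"
begin

definition weight :: "nat \<Rightarrow> int \<Rightarrow> real" where
  "weight j e = (if e = 1 then p j else 1 - p j)"

lemma weight_powr:
  "e \<in> {-1, 1} \<Longrightarrow> p j powr ((1 + of_int e) / 2) * (1 - p j) powr ((1 - of_int e) / 2) = weight j e"
  using p[of j] by (auto simp: weight_def)

lemma bern_spec_elementary:
  assumes M: "bern_spec p M" and N: "finite N" "e \<in> N \<rightarrow> {-1, 1}"
  shows "cylinder N (\<lambda>j. {e j}) \<in> sets M" "measure M (cylinder N (\<lambda>j. {e j})) = (\<Prod>j\<in>N. weight j (e j))"
proof -
  have "cylinder N (\<lambda>j. {e j}) \<in> cylinders" using N by (auto simp: cylinders_def)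
  then show "cylinder N (\<lambda>j. {e j}) \<in> sets M" using M by (auto simp: bern_spec_def sigma_sets_cylinders)
  show "measure M (cylinder N (\<lambda>j. {e j})) = (\<Prod>j\<in>N. weight j (e j))"
  proof (cases "N = {}")
    case True
    have "prob_space M" "space M = bern_space" using M by (auto simp: bern_spec_def)
    then have "measure M bern_space = 1" using prob_space.prob_space by metis
    then show ?thesis using True by (simp add: cylinder_def)
  next
    case False
    then have "measure M (cylinder N (\<lambda>j. {e j})) =
      (\<Prod>j\<in>N. p j powr ((1 + of_int (e j)) / 2) * (1 - p j) powr ((1 - of_int (e j)) / 2))"
      using M N by (simp add: bern_spec_def cylinder_def)
    also have "\<dots> = (\<Prod>j\<in>N. weight j (e j))" using N by (intro prod.cong refl weight_powr) auto
    finally show ?thesis .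
  qed
qed

text \<open>
  Independence: a function of finitely many coordinates is a finite combination of indicators of
  cylinders over single points, whose measures are prescribed. Besides orthonormality of the \<open>Z\<^sub>\<sigma>\<close> this
  also yields the measures of all cylinders, hence the uniqueness of the measure.
\<close>

lemma bern_spec_product_integral:
  fixes \<phi> :: "nat \<Rightarrow> int \<Rightarrow> complex"
  assumes M: "bern_spec p M" and N: "finite N"
  shows "has_bochner_integral M (\<lambda>f. \<Prod>j\<in>N. \<phi> j (f j)) (\<Prod>j\<in>N. of_real (p j) * \<phi> j 1 + of_real (1 - p j) * \<phi> j (-1))"
proof -
  interpret prob_space M using M by (simp add: bern_spec_def)
  let ?P = "PiE N (\<lambda>_. {-1, 1 :: int})"
  let ?g = "\<lambda>e. \<Prod>j\<in>N. \<phi> j (e j)"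
  have finP: "finite ?P" using N by (intro finite_PiE) auto
  have eP: "e \<in> N \<rightarrow> {-1, 1}" if "e \<in> ?P" for e using that by auto
  have 1: "has_bochner_integral M (\<lambda>f. \<Sum>e\<in>?P. indicator (cylinder N (\<lambda>j. {e j})) f *\<^sub>R ?g e)
      (\<Sum>e\<in>?P. measure M (cylinder N (\<lambda>j. {e j})) *\<^sub>R ?g e)"
    using bern_spec_elementary(1)[OF M N eP]
    by (intro has_bochner_integral_sum has_bochner_integral_indicator) (auto simp: less_top[symmetric])
  have "(\<Sum>e\<in>?P. measure M (cylinder N (\<lambda>j. {e j})) *\<^sub>R ?g e) = (\<Sum>e\<in>?P. \<Prod>j\<in>N. of_real (weight j (e j)) * \<phi> j (e j))"
    using bern_spec_elementary(2)[OF M N eP] by (intro sum.cong refl) (simp add: scaleR_conv_of_real prod.distrib)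
  also have "\<dots> = (\<Prod>j\<in>N. \<Sum>e\<in>{-1, 1}. of_real (weight j e) * \<phi> j e)"
    using N by (intro prod_sum_PiE[symmetric]) auto
  also have "\<dots> = (\<Prod>j\<in>N. of_real (p j) * \<phi> j 1 + of_real (1 - p j) * \<phi> j (-1))"
    by (simp add: weight_def add.commute)
  finally have 2: "(\<Sum>e\<in>?P. measure M (cylinder N (\<lambda>j. {e j})) *\<^sub>R ?g e) = \<dots>" .
  have pointwise: "(\<Sum>e\<in>?P. indicator (cylinder N (\<lambda>j. {e j})) f *\<^sub>R ?g e) = (\<Prod>j\<in>N. \<phi> j (f j))"
    if f: "f \<in> space M" for f
  proof -
    have fb: "f \<in> bern_space" using f M by (simp add: bern_spec_def)
    have r: "restrict f N \<in> ?P" using fb by (auto simp: bern_space_def)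
    have "(\<Sum>e\<in>?P. indicator (cylinder N (\<lambda>j. {e j})) f *\<^sub>R ?g e) = (\<Sum>e\<in>?P. if e = restrict f N then ?g e else 0)"
    proof (intro sum.cong refl)
      fix e assume e: "e \<in> ?P"
      have "f \<in> cylinder N (\<lambda>j. {e j}) \<longleftrightarrow> e = restrict f N"
        using fb e by (auto simp: cylinder_def PiE_def extensional_def fun_eq_iff)
      then show "indicator (cylinder N (\<lambda>j. {e j})) f *\<^sub>R ?g e = (if e = restrict f N then ?g e else 0)"
        by (simp add: indicator_def)
    qed
    also have "\<dots> = ?g (restrict f N)" using finP r by simp
    also have "\<dots> = (\<Prod>j\<in>N. \<phi> j (f j))" by simp
    finally show ?thesis .
  qed
  show ?thesis by (rule has_bochner_integral_cong[THEN iffD1, OF refl pointwise 2 1])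
qed

lemma indicator_cylinder:
  assumes "finite N" "f \<in> bern_space"
  shows "(indicator (cylinder N A) f :: complex) = (\<Prod>j\<in>N. indicator (A j) (f j))"
proof (cases "f \<in> cylinder N A")
  case True
  then show ?thesis by (auto simp: cylinder_def intro!: prod.neutral[symmetric])
next
  case False
  then obtain j where "j \<in> N" "f j \<notin> A j" using assms by (auto simp: cylinder_def)
  then have "\<exists>j\<in>N. (indicator (A j) (f j) :: complex) = 0" by (intro bexI[of _ j]) auto
  then show ?thesis using False assms by (simp add: prod_zero)
qed

lemma bern_spec_unique:
  assumes M: "bern_spec p M" and M': "bern_spec p M'"
  shows "M = M'"
proof (rule measure_eqI_generator_eq[OF Int_stable_cylinders cylinders_Pow])
  have meas: "of_real (measure M b) = (\<Prod>j\<in>N. of_real (p j) * indicator (A j) 1 + of_real (1 - p j) * (indicator (A j) (-1) :: complex))"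
    if M: "bern_spec p M" and N: "finite N" and b: "b = cylinder N A" for M b N A
  proof -
    have space: "space M = bern_space" using M by (simp add: bern_spec_def)
    interpret prob_space M using M by (simp add: bern_spec_def)
    have b_sets: "b \<in> sets M" using M N by (auto simp: bern_spec_def sigma_sets_cylinders b cylinders_def)
    have 1: "has_bochner_integral M (\<lambda>f. indicator b f *\<^sub>R (1 :: complex)) (measure M b *\<^sub>R 1)"
      using b_sets by (intro has_bochner_integral_indicator) (auto simp: less_top[symmetric])
    have pointwise: "indicator b f *\<^sub>R (1 :: complex) = (\<Prod>j\<in>N. indicator (A j) (f j))" if "f \<in> space M" for f
      using indicator_cylinder[OF N, of f A] that space b by (cases "f \<in> b") auto
    have "has_bochner_integral M (\<lambda>f. \<Prod>j\<in>N. indicator (A j) (f j) :: complex) (measure M b *\<^sub>R 1)"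
      by (rule has_bochner_integral_cong[THEN iffD1, OF refl pointwise refl 1])
    then show ?thesis
      using bern_spec_product_integral[OF M N, of "\<lambda>j. indicator (A j)"]
      by (auto simp: scaleR_conv_of_real dest: has_bochner_integral_eq)
  qed
  have fin: "finite_measure M" "finite_measure M'"
    using M M' by (auto simp: bern_spec_def prob_space_def)
  show "emeasure M b = emeasure M' b" if b: "b \<in> cylinders" for b
  proof -
    obtain N A where N: "finite N" "b = cylinder N A" using b by (auto simp: cylinders_def)
    have "complex_of_real (measure M b) = of_real (measure M' b)"
      using meas[OF M N] meas[OF M' N] by simp
    then have "measure M b = measure M' b" by (simp only: of_real_eq_iff)
    then show ?thesis using fin by (simp add: finite_measure.emeasure_eq_measure)
  qed
  show "emeasure M ((\<lambda>_. bern_space) i) \<noteq> \<infinity>" for i :: nat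
    using fin(1) by (simp add: finite_measure.emeasure_finite)
  show "range (\<lambda>_ :: nat. bern_space) \<subseteq> cylinders" using bern_space_cylinder by (auto simp: cylinders_def)
qed (use M M' in \<open>auto simp: bern_spec_def sigma_sets_cylinders\<close>)

definition coin :: "nat \<Rightarrow> int measure" where
  "coin j = point_measure {-1, 1} (\<lambda>e. ennreal (weight j e))"

lemma weight_nonneg: "0 \<le> weight j e"
  using p[of j] by (simp add: weight_def)

lemma bern_spec_PiM: "bern_spec p (PiM UNIV coin)"
proof -
  have sp: "space (coin j) = {-1, 1}" "sets (coin j) = Pow {-1, 1}" for j
    by (auto simp: coin_def space_point_measure sets_point_measure)
  have em: "emeasure (coin j) B = (\<Sum>e\<in>B. ennreal (weight j e))" if "B \<subseteq> {-1, 1}" for j B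
    unfolding coin_def using that by (intro emeasure_point_measure_finite) auto
  have "prob_space (coin j)" for j
  proof (rule prob_spaceI)
    have "emeasure (coin j) (space (coin j)) = ennreal (weight j (-1)) + ennreal (weight j 1)"
      unfolding sp using em[of "{-1, 1}" j] by simp
    also have "\<dots> = ennreal (weight j (-1) + weight j 1)" using weight_nonneg by (simp add: ennreal_plus)
    finally show "emeasure (coin j) (space (coin j)) = 1" by (simp add: weight_def)
  qed
  then interpret product_prob_space coin UNIV by (intro product_prob_spaceI)
  have space: "PiE UNIV (\<lambda>_. {-1, 1 :: int}) = bern_space" by (auto simp: bern_space_def PiE_def)
  have "sets (PiM UNIV coin) = sigma_sets bern_space {{f \<in> bern_space. f n \<in> B} | n B. B \<subseteq> {-1, 1}}"
    unfolding sets_PiM_single sp space by (rule arg_cong) auto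
  moreover have "measure (PiM UNIV coin) {f \<in> bern_space. \<forall>j\<in>N. f j = e j} =
      (\<Prod>j\<in>N. p j powr ((1 + of_int (e j)) / 2) * (1 - p j) powr ((1 - of_int (e j)) / 2))"
    if N: "finite N" and e: "e \<in> N \<rightarrow> {-1, 1}" for N e
  proof -
    have "emeasure (PiM UNIV coin) {x \<in> space (PiM UNIV coin). \<forall>j\<in>N. x j \<in> {e j}} = (\<Prod>j\<in>N. emeasure (coin j) {e j})"
      using N e by (intro emeasure_PiM_Collect) (auto simp: sp)
    also have "\<dots> = (\<Prod>j\<in>N. ennreal (weight j (e j)))"
      using e by (intro prod.cong refl) (subst em, auto)
    also have "\<dots> = ennreal (\<Prod>j\<in>N. weight j (e j))" by (intro prod_ennreal weight_nonneg)
    finally have "measure (PiM UNIV coin) {f \<in> bern_space. \<forall>j\<in>N. f j = e j} = (\<Prod>j\<in>N. weight j (e j))"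
      by (simp add: measure_def space_PiM sp space prod_nonneg weight_nonneg)
    also have "\<dots> = (\<Prod>j\<in>N. p j powr ((1 + of_int (e j)) / 2) * (1 - p j) powr ((1 - of_int (e j)) / 2))"
      using e by (intro prod.cong refl weight_powr[symmetric]) auto
    finally show ?thesis .
  qed
  ultimately show ?thesis
    unfolding bern_spec_def using prob_space_axioms by (simp add: space_PiM sp space)
qed

lemma bern_spec_bern_measure: "bern_spec p (bern_measure p)"
proof -
  have "bern_measure p = (THE M. bern_spec p M)" by (simp only: bern_measure_def bern_spec_def)
  also have "bern_spec p \<dots>" by (rule theI[where P = "bern_spec p", OF bern_spec_PiM bern_spec_unique[OF _ bern_spec_PiM]])
  finally show ?thesis .
qed

end

section \<open>The orthonormal basis of Bernoulli functionals\<close>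

context bernoulli_weights
begin

definition Z_value :: "nat \<Rightarrow> int \<Rightarrow> real" where
  "Z_value j e = (of_int e + (1 - p j) - p j) / (2 * sqrt (p j * (1 - p j)))"

definition Z_function :: "nat set \<Rightarrow> (nat \<Rightarrow> int) \<Rightarrow> complex" where
  "Z_function \<sigma> f = (\<Prod>j\<in>\<sigma>. of_real (Z_value j (f j)))"

lemma bern_Z_Z_function: "bern_Z p \<sigma> = ae_class (bern_measure p) (Z_function \<sigma>)"
  by (simp add: bern_Z_def Z_function_def[abs_def] Z_value_def)

lemma Z_value_mean: "p j * Z_value j 1 + (1 - p j) * Z_value j (-1) = 0"
proof -
  have "p j * (1 + (1 - p j) - p j) + (1 - p j) * (-1 + (1 - p j) - p j) = 0"
    by (simp add: algebra_simps)
  then show ?thesis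
    by (simp only: Z_value_def times_divide_eq_right add_divide_distrib[symmetric] of_int_1 of_int_minus div_0)
qed

lemma Z_value_variance: "p j * (Z_value j 1)\<^sup>2 + (1 - p j) * (Z_value j (-1))\<^sup>2 = 1"
proof -
  have pos: "p j * (1 - p j) > 0" using p[of j] by simp
  have "Z_value j 1 = (1 - p j) / sqrt (p j * (1 - p j))" "Z_value j (-1) = - p j / sqrt (p j * (1 - p j))"
    using pos by (auto simp: Z_value_def divide_simps)
  then have "(Z_value j 1)\<^sup>2 = (1 - p j)\<^sup>2 / (p j * (1 - p j))" "(Z_value j (-1))\<^sup>2 = (p j)\<^sup>2 / (p j * (1 - p j))"
    using pos by (auto simp: power_divide)
  then show ?thesis using p[of j] by (simp add: divide_simps power2_eq_square) (simp add: algebra_simps)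
qed

lemma Z_value_neq: "Z_value j 1 \<noteq> Z_value j (-1)"
  using p[of j] by (simp add: Z_value_def divide_simps)

lemma bern_prob_space: "prob_space (bern_measure p)"
  and bern_space_measure: "space (bern_measure p) = bern_space"
  and bern_sets: "sets (bern_measure p) = sigma_sets bern_space cylinders"
  using bern_spec_bern_measure by (auto simp: bern_spec_def sigma_sets_cylinders)

lemma bern_product_integral:
  "finite N \<Longrightarrow> has_bochner_integral (bern_measure p) (\<lambda>f. \<Prod>j\<in>N. \<phi> j (f j))
     (\<Prod>j\<in>N. of_real (p j) * \<phi> j 1 + of_real (1 - p j) * \<phi> j (-1) :: complex)"
  by (rule bern_spec_product_integral[OF bern_spec_bern_measure])

lemma Z_function_square_integrable:
  assumes "finite \<sigma>"
  shows "Z_function \<sigma> \<in> square_integrable (bern_measure p)"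
proof -
  have "integrable (bern_measure p) (Z_function \<sigma>)"
    using has_bochner_integral_iff bern_product_integral[OF assms, of "\<lambda>j e. of_real (Z_value j e)"]
    unfolding Z_function_def[abs_def] by blast
  moreover have "integrable (bern_measure p) (\<lambda>f. \<Prod>j\<in>\<sigma>. complex_of_real ((Z_value j (f j))\<^sup>2))"
    using has_bochner_integral_iff bern_product_integral[OF assms, of "\<lambda>j e. of_real ((Z_value j e)\<^sup>2)"]
    by blast
  then have "integrable (bern_measure p) (\<lambda>f. Re (\<Prod>j\<in>\<sigma>. complex_of_real ((Z_value j (f j))\<^sup>2)))"
    by (rule integrable_Re)
  moreover have "Re (\<Prod>j\<in>\<sigma>. complex_of_real ((Z_value j (f j))\<^sup>2)) = (cmod (Z_function \<sigma> f))\<^sup>2" for f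
    unfolding of_real_prod[symmetric] Re_complex_of_real Z_function_def
    by (simp add: norm_of_real prod_power_distrib del: of_real_prod)
  ultimately show ?thesis
    by (simp add: square_integrable_def borel_measurable_integrable)
qed

lemma ip_bern_Z:
  assumes "finite \<sigma>" "finite \<rho>"
  shows "ip (bern_H p) (bern_Z p \<sigma>) (bern_Z p \<rho>) = (if \<sigma> = \<rho> then 1 else 0)"
proof -
  let ?z = "\<lambda>j e. complex_of_real (Z_value j e)"
  let ?\<phi> = "\<lambda>j e. (if j \<in> \<sigma> then ?z j e else 1) * (if j \<in> \<rho> then ?z j e else 1)"
  let ?m = "\<lambda>j. of_real (p j) * ?\<phi> j 1 + of_real (1 - p j) * ?\<phi> j (-1)"
  have split: "cnj (Z_function \<sigma> f) * Z_function \<rho> f = (\<Prod>j\<in>\<sigma> \<union> \<rho>. ?\<phi> j (f j))" for f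
  proof -
    have "cnj (Z_function \<sigma> f) = (\<Prod>j\<in>\<sigma> \<union> \<rho>. if j \<in> \<sigma> then ?z j (f j) else 1)"
      unfolding Z_function_def cnj_prod complex_cnj_complex_of_real
      using assms by (intro prod.mono_neutral_cong_left) auto
    moreover have "Z_function \<rho> f = (\<Prod>j\<in>\<sigma> \<union> \<rho>. if j \<in> \<rho> then ?z j (f j) else 1)"
      unfolding Z_function_def using assms by (intro prod.mono_neutral_cong_left) auto
    ultimately show ?thesis by (simp only: prod.distrib)
  qed
  have "ip (bern_H p) (bern_Z p \<sigma>) (bern_Z p \<rho>) = (\<integral>f. cnj (Z_function \<sigma> f) * Z_function \<rho> f \<partial>bern_measure p)"
    unfolding bern_H_def bern_Z_Z_function by (intro ip_L2 Z_function_square_integrable assms)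
  also have "\<dots> = (\<Prod>j\<in>\<sigma> \<union> \<rho>. ?m j)"
    unfolding split using assms
    by (intro has_bochner_integral_integral_eq bern_product_integral[of _ ?\<phi>]) auto
  also have "\<dots> = (if \<sigma> = \<rho> then 1 else 0)"
  proof (cases "\<sigma> = \<rho>")
    case True
    have "?m j = of_real (p j * (Z_value j 1)\<^sup>2 + (1 - p j) * (Z_value j (-1))\<^sup>2)" if "j \<in> \<sigma>" for j
      using that True by (simp add: power2_eq_square)
    then show ?thesis using True by (simp add: Z_value_variance prod.neutral del: of_real_add)
  next
    case False
    then obtain j where j: "j \<in> \<sigma> \<union> \<rho>" "\<not> (j \<in> \<sigma> \<and> j \<in> \<rho>)" by blast
    then have "?m j = of_real (p j * Z_value j 1 + (1 - p j) * Z_value j (-1))" by auto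
    then have "?m j = 0" by (simp only: Z_value_mean of_real_0)
    then have "\<exists>j\<in>\<sigma> \<union> \<rho>. ?m j = 0" using j(1) by blast
    then have "(\<Prod>j\<in>\<sigma> \<union> \<rho>. ?m j) = 0" using assms by (intro prod_zero) auto
    then show ?thesis using False by (simp only: if_False)
  qed
  finally show ?thesis .
qed

text \<open>
  On the two values of a coordinate every function is affine in \<open>Z_value\<close>; hence the indicator of a
  cylinder is a linear combination of the \<open>Z\<^sub>\<sigma>\<close>. The sets over which \<open>g\<close> integrates to zero form a
  Dynkin system.
\<close>

lemma Z_function_complete:
  assumes g: "g \<in> square_integrable (bern_measure p)"
    and orth: "\<And>\<sigma>. finite \<sigma> \<Longrightarrow> (\<integral>f. cnj (Z_function \<sigma> f) * g f \<partial>bern_measure p) = 0"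
  shows "AE f in bern_measure p. g f = 0"
proof -
  let ?M = "bern_measure p"
  interpret prob_space ?M by (rule bern_prob_space)
  have int: "integrable ?M (\<lambda>f. cnj (Z_function \<sigma> f) * g f)" if "finite \<sigma>" for \<sigma>
    by (intro integrable_mult_square_integrable Z_function_square_integrable that g)
  have cnj_Z_function: "cnj (Z_function \<sigma> f) = Z_function \<sigma> f" for \<sigma> f by (simp add: Z_function_def)
  have g_int: "integrable ?M g" using int[of "{}"] by (simp add: Z_function_def)
  have cyl: "(LINT f:cylinder N A|?M. g f) = 0" if N: "finite N" for N A
  proof -
    define b where "b j = (indicator (A j) 1 - indicator (A j) (-1)) / (Z_value j 1 - Z_value j (-1))" for j
    define a where "a j = indicator (A j) 1 - b j * Z_value j 1" for j
    have affine: "indicator (A j) e = b j * Z_value j e + a j" if "e \<in> {-1, 1}" for j and e :: int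
    proof -
      have "b j * (Z_value j 1 - Z_value j (-1)) = indicator (A j) 1 - indicator (A j) (-1)"
        using Z_value_neq by (simp add: b_def)
      then show ?thesis using that by (auto simp: a_def algebra_simps)
    qed
    let ?c = "\<lambda>\<sigma>. (\<Prod>j\<in>\<sigma>. of_real (b j)) * (\<Prod>j\<in>N - \<sigma>. complex_of_real (a j))"
    have "(LINT f:cylinder N A|?M. g f) = (\<integral>f. (\<Sum>\<sigma>\<in>Pow N. ?c \<sigma> * (cnj (Z_function \<sigma> f) * g f)) \<partial>?M)"
      unfolding set_lebesgue_integral_def
    proof (rule Bochner_Integration.integral_cong[OF refl])
      fix f assume "f \<in> space ?M"
      then have f: "f \<in> bern_space" by (simp add: bern_space_measure)
      have "indicator (cylinder N A) f = (\<Prod>j\<in>N. of_real (b j) * of_real (Z_value j (f j)) + complex_of_real (a j))"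
      proof -
        have "(indicator (A j) (f j) :: complex) = of_real (b j) * of_real (Z_value j (f j)) + of_real (a j)" for j
        proof -
          have "(indicator (A j) (f j) :: complex) = of_real (indicator (A j) (f j))" by (simp add: indicator_def)
          also have "\<dots> = of_real (b j * Z_value j (f j) + a j)"
            using affine[of "f j" j] f by (simp add: bern_space_def)
          finally show ?thesis by simp
        qed
        then show ?thesis using indicator_cylinder[OF N f] by simp
      qed
      also have "\<dots> = (\<Sum>\<sigma>\<in>Pow N. (\<Prod>j\<in>\<sigma>. of_real (b j) * of_real (Z_value j (f j))) * (\<Prod>j\<in>N - \<sigma>. of_real (a j)))"
        using N by (rule prod_add)
      also have "\<dots> = (\<Sum>\<sigma>\<in>Pow N. ?c \<sigma> * cnj (Z_function \<sigma> f))"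
        by (intro sum.cong refl) (simp add: cnj_Z_function Z_function_def prod.distrib)
      finally have "indicator (cylinder N A) f * g f = (\<Sum>\<sigma>\<in>Pow N. ?c \<sigma> * (cnj (Z_function \<sigma> f) * g f))"
        by (simp add: sum_distrib_right mult.assoc)
      then show "indicator (cylinder N A) f *\<^sub>R g f = (\<Sum>\<sigma>\<in>Pow N. ?c \<sigma> * (cnj (Z_function \<sigma> f) * g f))"
        by (simp only: scaleR_conv_of_real of_real_indicator)
    qed
    also have "\<dots> = (\<Sum>\<sigma>\<in>Pow N. \<integral>f. ?c \<sigma> * (cnj (Z_function \<sigma> f) * g f) \<partial>?M)"
      by (rule Bochner_Integration.integral_sum, rule integrable_mult_right, rule int)
        (use N finite_subset in auto)
    also have "\<dots> = 0"
    proof (intro sum.neutral ballI)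
      fix \<sigma> assume "\<sigma> \<in> Pow N"
      then have "finite \<sigma>" using N finite_subset by auto
      then show "(\<integral>f. ?c \<sigma> * (cnj (Z_function \<sigma> f) * g f) \<partial>?M) = 0"
        using orth by (subst integral_mult_right_zero) simp
    qed
    finally show ?thesis .
  qed
  have zero: "(LINT f:A|?M. g f) = 0" if "A \<in> sigma_sets bern_space cylinders" for A
    using Int_stable_cylinders cylinders_Pow that
  proof (induction rule: sigma_sets_induct_disjoint)
    case (basic A)
    then show ?case using cyl by (auto simp: cylinders_def)
  next
    case empty
    show ?case by (simp add: set_lebesgue_integral_def)
  next
    case (compl A)
    have A: "A \<in> sets ?M" using compl by (simp add: bern_sets)
    have sp: "bern_space \<in> sets ?M" using sets.top[of ?M] by (simp add: bern_space_measure)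
    have si: "set_integrable ?M B g" if "B \<in> sets ?M" for B
      unfolding set_integrable_def using g_int that by (rule integrable_mult_indicator[rotated])
    have "(LINT f:(bern_space - A) \<union> A|?M. g f) = (LINT f:bern_space - A|?M. g f) + (LINT f:A|?M. g f)"
      using A sp by (intro set_integral_Un si) auto
    moreover have "(bern_space - A) \<union> A = cylinder {} (\<lambda>_. {})"
      using sets.sets_into_space[OF A] by (auto simp: bern_space_measure cylinder_def)
    ultimately show ?case using compl cyl[of "{}"] by simp
  next
    case (union A)
    have A: "A i \<in> sets ?M" for i using union(2) by (auto simp: bern_sets)
    have "(LINT f:(\<Union>i. A i)|?M. g f) = (\<Sum>i. LINT f:A i|?M. g f)"
    proof (rule lebesgue_integral_countable_add)
      show "set_integrable ?M (\<Union>i. A i) g"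
        unfolding set_integrable_def using A by (intro integrable_mult_indicator g_int) auto
      show "A i \<inter> A j = {}" if "i \<noteq> j" for i j
        using union(1) that by (auto simp: disjoint_family_on_def)
    qed (rule A)
    then show ?case using union(3) by simp
  qed
  show ?thesis
    by (rule density_zero[OF g_int]) (use zero in \<open>simp add: bern_sets\<close>)
qed

end

locale bernoulli = bernoulli_weights p + hilbert "bern_H p" for p
begin

abbreviation "H \<equiv> bern_H p"
abbreviation "Z \<equiv> bern_Z p"
abbreviation "\<Gamma> \<equiv> {\<sigma> :: nat set. finite \<sigma>}"

lemma Z_carrier: "finite \<sigma> \<Longrightarrow> Z \<sigma> \<in> carrier H"
  unfolding bern_H_def bern_Z_Z_function by (intro ae_class_carrier Z_function_square_integrable)

lemma Z_basis: "hilbert_basis Z \<Gamma>"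
  unfolding hilbert_basis_def
proof (intro conjI ballI impI)
  show "orthonormal Z \<Gamma>" by (auto simp: orthonormal_def Z_carrier ip_bern_Z)
  fix x assume x: "x \<in> carrier H" and orth: "\<forall>\<sigma>\<in>\<Gamma>. ip H (Z \<sigma>) x = 0"
  obtain g where g: "g \<in> square_integrable (bern_measure p)" "x = ae_class (bern_measure p) g"
    using x unfolding bern_H_def by (rule L2_carrierE)
  have "(\<integral>f. cnj (Z_function \<sigma> f) * g f \<partial>bern_measure p) = 0" if "finite \<sigma>" for \<sigma>
    using orth that ip_L2[OF Z_function_square_integrable[OF that] g(1)]
    by (simp add: bern_H_def bern_Z_Z_function g(2))
  then have "AE f in bern_measure p. g f = 0" by (rule Z_function_complete[OF g(1)])
  then have "x = ae_class (bern_measure p) (\<lambda>_. 0)"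
    unfolding g(2) by (intro ae_class_eqI g(1) zero_square_integrable)
  then show "x = \<zero>\<^bsub>H\<^esub>" by (simp add: bern_H_def L2_space_def)
qed

text \<open>The decomposition of positive operators proceeds along a sequence of basis vectors.\<close>

lemma Z_sequence_basis: "hilbert_basis (\<lambda>n. Z (set_decode n)) UNIV"
proof -
  have "ip H (Z \<sigma>) x = 0" if "\<forall>n\<in>UNIV. ip H (Z (set_decode n)) x = 0" "finite \<sigma>" for x \<sigma>
    using that(1)[rule_format, of "set_encode \<sigma>"] that(2) by simp
  moreover have "set_decode i = set_decode j \<longleftrightarrow> i = j" for i j by (metis set_decode_inverse)
  ultimately show ?thesis
    using Z_basis by (auto simp: hilbert_basis_def orthonormal_def Z_carrier ip_bern_Z)
qed

section \<open>Annihilation and creation\<close>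

text \<open>
  The coordinate of \<open>\<partial>\<^sub>k x\<close> at \<open>\<sigma>\<close> is that of \<open>x\<close> at \<open>insert k \<sigma>\<close>, or zero if \<open>k \<in> \<sigma>\<close>. As \<open>insert k\<close> is injective
  on the sets without \<open>k\<close>, each coordinate of \<open>x\<close> is used at most once.
\<close>

lemma annihilation_exists:
  "\<exists>D\<in>bounded_ops H. \<forall>\<sigma>. finite \<sigma> \<longrightarrow> D (Z \<sigma>) = indicator \<sigma> k \<odot>\<^bsub>H\<^esub> Z (\<sigma> - {k})"
proof -
  define g where "g \<sigma> = (if k \<in> \<sigma> then \<zero>\<^bsub>H\<^esub> else Z (insert k \<sigma>))" for \<sigma>
  have o: "orthonormal Z \<Gamma>" using Z_basis by (simp add: hilbert_basis_def)
  obtain D where D: "D \<in> bounded_ops H"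
    "\<And>x \<sigma>. x \<in> carrier H \<Longrightarrow> \<sigma> \<in> \<Gamma> \<Longrightarrow> ip H (Z \<sigma>) (D x) = ip H (g \<sigma>) x"
  proof (rule bounded_op_by_coordinates[OF Z_basis, of g 1])
    fix F x assume F: "finite F" "F \<subseteq> \<Gamma>" and x: "x \<in> carrier H"
    let ?F = "{\<sigma> \<in> F. k \<notin> \<sigma>}"
    have inj: "inj_on (insert k) ?F" by (auto simp: inj_on_def)
    have "(\<Sum>\<sigma>\<in>F. (cmod (ip H (g \<sigma>) x))\<^sup>2) = (\<Sum>\<sigma>\<in>?F. (cmod (ip H (Z (insert k \<sigma>)) x))\<^sup>2)"
      using F x by (intro sum.mono_neutral_cong_right) (auto simp: g_def)
    also have "\<dots> = (\<Sum>\<sigma>\<in>insert k ` ?F. (cmod (ip H (Z \<sigma>) x))\<^sup>2)"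
      by (simp add: sum.reindex[OF inj])
    also have "\<dots> \<le> (hnorm H x)\<^sup>2" using F x by (intro bessel[OF o]) auto
    finally show "(\<Sum>\<sigma>\<in>F. (cmod (ip H (g \<sigma>) x))\<^sup>2) \<le> 1 * (hnorm H x)\<^sup>2" by simp
  qed (auto simp: g_def Z_carrier)
  have "D (Z \<sigma>) = indicator \<sigma> k \<odot>\<^bsub>H\<^esub> Z (\<sigma> - {k})" if \<sigma>: "finite \<sigma>" for \<sigma>
  proof (rule hilbert_basis_eqI[OF Z_basis])
    fix \<rho> assume "\<rho> \<in> \<Gamma>"
    then have \<rho>: "finite \<rho>" by simp
    have "k \<notin> \<rho> \<and> insert k \<rho> = \<sigma> \<longleftrightarrow> k \<in> \<sigma> \<and> \<rho> = \<sigma> - {k}" by blast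
    then show "ip H (Z \<rho>) (D (Z \<sigma>)) = ip H (Z \<rho>) (indicator \<sigma> k \<odot>\<^bsub>H\<^esub> Z (\<sigma> - {k}))"
      using \<sigma> \<rho> D(2)[OF Z_carrier[OF \<sigma>], of \<rho>]
      by (auto simp: g_def Z_carrier ip_bern_Z indicator_def)
  qed (use \<sigma> op_carrier[OF D(1)] Z_carrier in auto)
  then show ?thesis using D(1) by blast
qed

lemma annihilation_bounded: "annihilation p k \<in> bounded_ops H"
  and annihilation_Z: "finite \<sigma> \<Longrightarrow> annihilation p k (Z \<sigma>) = indicator \<sigma> k \<odot>\<^bsub>H\<^esub> Z (\<sigma> - {k})"
proof -
  obtain D where D: "D \<in> bounded_ops H"
    "\<And>\<sigma>. finite \<sigma> \<Longrightarrow> D (Z \<sigma>) = indicator \<sigma> k \<odot>\<^bsub>H\<^esub> Z (\<sigma> - {k})"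
    using annihilation_exists[of k] by blast
  have "annihilation p k = D"
    unfolding annihilation_def
  proof (rule the_equality)
    fix D' assume D': "D' \<in> bounded_ops H \<and>
      (\<forall>\<sigma>. finite \<sigma> \<longrightarrow> D' (Z \<sigma>) = indicator \<sigma> k \<odot>\<^bsub>H\<^esub> Z (\<sigma> - {k}))"
    show "D' = D"
    proof (rule op_eq_on_total[OF hilbert_basis_total[OF Z_basis] hilbert_basis_image[OF Z_basis]])
      fix x assume "x \<in> Z ` \<Gamma>"
      then obtain \<sigma> where "x = Z \<sigma>" "finite \<sigma>" by blast
      then show "D' x = D x" using D(2) D' by metis
    qed (use D(1) D' in blast)+
  qed (use D in blast)
  then show "annihilation p k \<in> bounded_ops H"
    "finite \<sigma> \<Longrightarrow> annihilation p k (Z \<sigma>) = indicator \<sigma> k \<odot>\<^bsub>H\<^esub> Z (\<sigma> - {k})"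
    using D by auto
qed

lemma creation_bounded: "creation p k \<in> bounded_ops H"
  unfolding creation_def by (rule hadjoint_bounded[OF Z_basis annihilation_bounded])

lemma ip_creation:
  "x \<in> carrier H \<Longrightarrow> y \<in> carrier H \<Longrightarrow> ip H (creation p k x) y = ip H x (annihilation p k y)"
  unfolding creation_def by (rule ip_hadjoint[OF Z_basis annihilation_bounded])

lemma creation_Z:
  assumes \<sigma>: "finite \<sigma>"
  shows "creation p k (Z \<sigma>) = (if k \<in> \<sigma> then \<zero>\<^bsub>H\<^esub> else Z (insert k \<sigma>))"
proof (rule hilbert_basis_eqI[OF Z_basis])
  fix \<rho> assume "\<rho> \<in> \<Gamma>"
  then have \<rho>: "finite \<rho>" by simp
  have "ip H (creation p k (Z \<sigma>)) (Z \<rho>) = ip H (Z \<sigma>) (indicator \<rho> k \<odot>\<^bsub>H\<^esub> Z (\<rho> - {k}))"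
    using \<sigma> \<rho> by (simp add: ip_creation Z_carrier annihilation_Z)
  also have "\<dots> = (if k \<in> \<rho> \<and> \<sigma> = \<rho> - {k} then 1 else 0)"
    using \<sigma> \<rho> by (simp add: Z_carrier ip_bern_Z)
  also have "k \<in> \<rho> \<and> \<sigma> = \<rho> - {k} \<longleftrightarrow> k \<notin> \<sigma> \<and> insert k \<sigma> = \<rho>" by blast
  also have "(if k \<notin> \<sigma> \<and> insert k \<sigma> = \<rho> then 1 else 0) = ip H (if k \<in> \<sigma> then \<zero>\<^bsub>H\<^esub> else Z (insert k \<sigma>)) (Z \<rho>)"
    using \<sigma> \<rho> by (simp add: Z_carrier ip_bern_Z)
  finally show "ip H (Z \<rho>) (creation p k (Z \<sigma>)) = ip H (Z \<rho>) (if k \<in> \<sigma> then \<zero>\<^bsub>H\<^esub> else Z (insert k \<sigma>))"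
    by (rule ip_flip[rotated 4]) (use \<sigma> \<rho> op_carrier[OF creation_bounded] in \<open>auto simp: Z_carrier\<close>)
qed (use \<sigma> op_carrier[OF creation_bounded] in \<open>auto simp: Z_carrier\<close>)

text \<open>
  The operator \<open>\<partial>\<^sub>k\<^sup>* + \<partial>\<^sub>k\<close> permutes the basis by toggling \<open>k\<close>: it is a symmetric involution, so
  \<open>R\<close> and \<open>- L\<close> are the complementary spectral projections.
\<close>

definition toggle :: "nat \<Rightarrow> bern_functional \<Rightarrow> bern_functional" where
  "toggle k = (\<lambda>x\<in>carrier H. creation p k x \<oplus>\<^bsub>H\<^esub> annihilation p k x)"

lemma toggle_bounded: "toggle k \<in> bounded_ops H"
  unfolding toggle_def by (intro bounded_ops_add creation_bounded annihilation_bounded)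

lemmas toggle_carrier [simp] = op_carrier[OF toggle_bounded]

lemma toggle_symmetric: "symmetric (toggle k)"
  unfolding symmetric_def
proof (intro ballI)
  fix x y assume xy: "x \<in> carrier H" "y \<in> carrier H"
  note c = op_carrier[OF creation_bounded] op_carrier[OF annihilation_bounded]
  have "ip H (annihilation p k x) y = ip H x (creation p k y)"
    by (rule ip_flip[rotated 4, OF ip_creation[of y x k, symmetric]]) (use xy c in auto)
  then show "ip H (toggle k x) y = ip H x (toggle k y)"
    using xy c ip_creation[of x y k] by (simp add: toggle_def)
qed

lemma toggle_Z:
  assumes "finite \<sigma>"
  shows "toggle k (Z \<sigma>) = Z (if k \<in> \<sigma> then \<sigma> - {k} else insert k \<sigma>)"
  using assms by (intro ip_eqI) (auto simp: toggle_def Z_carrier creation_Z annihilation_Z)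

lemma toggle_involution:
  assumes "x \<in> carrier H"
  shows "toggle k (toggle k x) = x"
proof -
  have "compose (carrier H) (toggle k) (toggle k) = (\<lambda>x\<in>carrier H. x)"
  proof (rule op_eq_on_total[OF hilbert_basis_total[OF Z_basis] hilbert_basis_image[OF Z_basis]])
    fix x assume "x \<in> Z ` \<Gamma>"
    then obtain \<sigma> where "x = Z \<sigma>" "finite \<sigma>" by auto
    then show "compose (carrier H) (toggle k) (toggle k) x = (\<lambda>x\<in>carrier H. x) x"
      by (auto simp: compose_def Z_carrier toggle_Z insert_absorb)
  qed (intro bounded_ops_compose toggle_bounded bounded_ops_id)+
  from fun_cong[OF this, of x] show ?thesis using assms by (simp add: compose_eq)
qed

lemma bern_B_carrier:
  assumes "x \<in> carrier H"
  shows "bern_B p n s x \<in> carrier H"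
  using assms op_carrier[OF creation_bounded] op_carrier[OF annihilation_bounded]
  by (auto simp: bern_B_def bern_L_def bern_R_def)

lemma ip_bern_B:
  assumes "s \<in> {-1, 1}" "x \<in> carrier H" "z \<in> carrier H"
  shows "ip H z (bern_B p n s x) = (ip H z (toggle n x) + of_int s * ip H z x) / 2"
proof -
  define u where "u = creation p n x \<oplus>\<^bsub>H\<^esub> annihilation p n x"
  have u: "u \<in> carrier H" "toggle n x = u"
    using assms op_carrier[OF creation_bounded] op_carrier[OF annihilation_bounded]
    by (auto simp: u_def toggle_def)
  show ?thesis
  proof (cases "s = -1")
    case True
    have "bern_B p n s x = (1 / 2) \<odot>\<^bsub>H\<^esub> (u \<ominus>\<^bsub>H\<^esub> x)"
      unfolding bern_B_def bern_L_def u_def using True assms(2) by simp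
    then show ?thesis using True assms(2,3) u by simp
  next
    case False
    then have "s = 1" using assms(1) by simp
    have "bern_B p n s x = (1 / 2) \<odot>\<^bsub>H\<^esub> (u \<oplus>\<^bsub>H\<^esub> x)"
      unfolding bern_B_def bern_R_def u_def using \<open>s = 1\<close> assms(2) by simp
    then show ?thesis using \<open>s = 1\<close> assms(2,3) u by simp
  qed
qed

lemma bern_B_symmetric:
  assumes s: "s \<in> {-1, 1}" and xz: "x \<in> carrier H" "z \<in> carrier H"
  shows "ip H (bern_B p n s z) x = ip H z (bern_B p n s x)"
proof -
  have "cnj (ip H x (bern_B p n s z)) = ip H z (bern_B p n s x)"
    using xz symmetricD[OF toggle_symmetric, of z x n] ip_cnj[of x "toggle n z"] ip_cnj[of x z]
    by (simp add: ip_bern_B[OF s])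
  then show ?thesis using xz ip_cnj[of x "bern_B p n s z"] bern_B_carrier by simp
qed

text \<open>In operator form: \<open>B\<^sub>s\<^sup>2 = (I + s W) / 2\<close> with \<open>W\<close> the toggle, because \<open>W\<^sup>2 = I\<close> and \<open>s\<^sup>2 = 1\<close>.\<close>

lemma bern_B_resolution:
  assumes "x \<in> carrier H" "z \<in> carrier H"
  shows "(\<Sum>s\<in>{-1, 1}. ip H z (bern_B p n s (bern_B p n s x))) = ip H z x"
proof -
  have sq: "ip H z (bern_B p n s (bern_B p n s x)) = (ip H z x + of_int s * ip H z (toggle n x)) / 2"
    if s: "s \<in> {-1, 1}" for s
  proof -
    have sym: "ip H z (toggle n y) = ip H (toggle n z) y" if "y \<in> carrier H" for y
      using symmetricD[OF toggle_symmetric, of z y n] that assms(2) by simp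
    have 1: "ip H z (bern_B p n s (bern_B p n s x)) =
        (ip H z (toggle n (bern_B p n s x)) + of_int s * ip H z (bern_B p n s x)) / 2"
      using assms s by (intro ip_bern_B bern_B_carrier)
    have 2: "ip H z (toggle n (bern_B p n s x)) = ip H (toggle n z) (bern_B p n s x)"
      using assms by (intro sym bern_B_carrier)
    have 3: "ip H (toggle n z) (bern_B p n s x) = (ip H (toggle n z) (toggle n x) + of_int s * ip H (toggle n z) x) / 2"
      using assms s by (intro ip_bern_B toggle_carrier)
    have 4: "ip H (toggle n z) (toggle n x) = ip H z x"
      using sym[of "toggle n x"] assms by (simp add: toggle_involution)
    have 5: "ip H (toggle n z) x = ip H z (toggle n x)" using sym[of x] assms by simp
    have 6: "ip H z (bern_B p n s x) = (ip H z (toggle n x) + of_int s * ip H z x) / 2"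
      using assms s by (intro ip_bern_B)
    have "of_int s * of_int s = (1 :: complex)" using s by auto
    then show ?thesis unfolding 1 2 3 4 5 6 by (simp add: field_simps)
  qed
  show ?thesis using sq[of "-1"] sq[of 1] by (simp add: diff_divide_distrib add_divide_distrib)
qed

end

section \<open>Operators on Hilbert space tensor powers\<close>

locale tensor_power = H: hilbert H + T: hilbert T
  for H :: "('a, 'm) inner_space_scheme" and T :: "('t, 'n) inner_space_scheme" +
  fixes \<tau> :: "('d :: finite \<Rightarrow> 'a) \<Rightarrow> 't"
  assumes tensor: "hilbert_tensor_power H T \<tau>"
begin

abbreviation "families \<equiv> (UNIV :: 'd set) \<rightarrow> carrier H"

lemma
  assumes "x \<in> families"
  shows tensor_carrier: "\<tau> x \<in> carrier T"
    and tensor_add: "u \<in> carrier H \<Longrightarrow> v \<in> carrier H \<Longrightarrow>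
      \<tau> (x(j := u \<oplus>\<^bsub>H\<^esub> v)) = \<tau> (x(j := u)) \<oplus>\<^bsub>T\<^esub> \<tau> (x(j := v))"
    and tensor_smult: "u \<in> carrier H \<Longrightarrow> \<tau> (x(j := c \<odot>\<^bsub>H\<^esub> u)) = c \<odot>\<^bsub>T\<^esub> \<tau> (x(j := u))"
    and ip_tensor: "y \<in> families \<Longrightarrow> ip T (\<tau> x) (\<tau> y) = (\<Prod>j\<in>UNIV. ip H (x j) (y j))"
  using assms tensor unfolding hilbert_tensor_power_def by blast+

lemma tensor_total: "total_in T (\<tau> ` families)"
  using tensor unfolding hilbert_tensor_power_def by blast

lemma tensor_image: "\<tau> ` families \<subseteq> carrier T"
  using tensor_carrier by blast

lemma hnorm_tensor:
  assumes "x \<in> families"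
  shows "hnorm T (\<tau> x) = (\<Prod>j\<in>UNIV. hnorm H (x j))"
proof (rule power2_eq_imp_eq)
  have xc: "x j \<in> carrier H" for j using assms by auto
  have "ip T (\<tau> x) (\<tau> x) = (\<Prod>j\<in>UNIV. of_real ((hnorm H (x j))\<^sup>2))"
    unfolding ip_tensor[OF assms assms] using H.ip_self[OF xc] by simp
  also have "\<dots> = of_real ((\<Prod>j\<in>UNIV. hnorm H (x j))\<^sup>2)"
    by (simp add: prod_power_distrib)
  finally have "ip T (\<tau> x) (\<tau> x) = of_real ((\<Prod>j\<in>UNIV. hnorm H (x j))\<^sup>2)" .
  then show "(hnorm T (\<tau> x))\<^sup>2 = (\<Prod>j\<in>UNIV. hnorm H (x j))\<^sup>2"
    unfolding T.hnorm_sq[OF tensor_carrier[OF assms]] by (simp only: Re_complex_of_real)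
  show "0 \<le> hnorm T (\<tau> x)" using tensor_carrier[OF assms] by simp
  show "0 \<le> (\<Prod>j\<in>UNIV. hnorm H (x j))" using xc by (intro prod_nonneg) simp
qed

text \<open>
  Replace the basis vectors by arbitrary vectors one coordinate at a time: for fixed other
  coordinates, \<open>u \<mapsto> \<langle>y, \<tau> (x(j := u))\<rangle>\<close> is a bounded functional that vanishes on a basis.
\<close>

lemma tensor_basis:
  assumes e: "H.hilbert_basis e I"
  shows "T.hilbert_basis (\<lambda>s. \<tau> (\<lambda>j. e (s j))) (UNIV \<rightarrow> I)"
  unfolding T.hilbert_basis_def
proof (intro conjI ballI impI)
  have o: "H.orthonormal e I" using e by (simp add: H.hilbert_basis_def)
  have es: "(\<lambda>j. e (s j)) \<in> families" if "s \<in> UNIV \<rightarrow> I" for s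
    using that H.orthonormalD(1)[OF o] by auto
  show "T.orthonormal (\<lambda>s. \<tau> (\<lambda>j. e (s j))) (UNIV \<rightarrow> I)"
    unfolding T.orthonormal_def
  proof (intro conjI ballI)
    fix s r assume s: "s \<in> (UNIV :: 'd set) \<rightarrow> I" and r: "r \<in> (UNIV :: 'd set) \<rightarrow> I"
    have "ip T (\<tau> (\<lambda>j. e (s j))) (\<tau> (\<lambda>j. e (r j))) = (\<Prod>j\<in>UNIV. if s j = r j then 1 else 0)"
      unfolding ip_tensor[OF es[OF s] es[OF r]]
      using s r by (intro prod.cong refl H.orthonormalD(2)[OF o]) auto
    also have "\<dots> = (if s = r then 1 else 0)"
    proof (cases "s = r")
      case False
      then have "\<exists>j\<in>UNIV. (if s j = r j then 1 else 0 :: complex) = 0" by auto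
      then have "(\<Prod>j\<in>UNIV. if s j = r j then 1 else 0 :: complex) = 0" by (intro prod_zero) auto
      then show ?thesis using False by simp
    qed simp
    finally show "ip T (\<tau> (\<lambda>j. e (s j))) (\<tau> (\<lambda>j. e (r j))) = (if s = r then 1 else 0)" .
  qed (use es tensor_carrier in auto)
  fix y assume y: "y \<in> carrier T" and orth: "\<forall>s\<in>UNIV \<rightarrow> I. ip T (\<tau> (\<lambda>j. e (s j))) y = 0"
  have "\<forall>x\<in>families. (\<forall>j. j \<notin> J \<longrightarrow> x j \<in> e ` I) \<longrightarrow> ip T y (\<tau> x) = 0" if "finite J" for J :: "'d set"
    using that
  proof (induction J)
    case empty
    show ?case
    proof (intro ballI impI)
      fix x assume x: "x \<in> families" "\<forall>j. j \<notin> {} \<longrightarrow> x j \<in> e ` I"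
      then have "\<forall>j. \<exists>i. i \<in> I \<and> x j = e i" by blast
      then obtain s where s: "\<And>j. s j \<in> I \<and> x j = e (s j)" by metis
      then have "ip T (\<tau> x) y = 0" using orth[rule_format, of s] by (simp add: Pi_iff flip: s)
      then show "ip T y (\<tau> x) = 0" using T.ip_cnj[OF tensor_carrier[OF x(1)] y] by simp
    qed
  next
    case (insert k J)
    show ?case
    proof (intro ballI impI)
      fix x assume x: "x \<in> families" "\<forall>j. j \<notin> insert k J \<longrightarrow> x j \<in> e ` I"
      have xu: "x(k := u) \<in> families" if "u \<in> carrier H" for u using x(1) that by auto
      have "ip T y (\<tau> (x(k := x k))) = 0"
      proof (rule H.functional_zero_on_total[OF H.hilbert_basis_total[OF e] H.hilbert_basis_image[OF e],
            where C = "hnorm T y * (\<Prod>j\<in>UNIV - {k}. hnorm H (x j))" and x = "x k"])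
        fix u v assume "u \<in> carrier H" "v \<in> carrier H"
        then show "ip T y (\<tau> (x(k := u \<oplus>\<^bsub>H\<^esub> v))) = ip T y (\<tau> (x(k := u))) + ip T y (\<tau> (x(k := v)))"
          using y tensor_carrier[OF xu] by (simp add: tensor_add[OF x(1)])
      next
        fix c u assume "u \<in> carrier H"
        then show "ip T y (\<tau> (x(k := c \<odot>\<^bsub>H\<^esub> u))) = c * ip T y (\<tau> (x(k := u)))"
          using y tensor_carrier[OF xu] by (simp add: tensor_smult[OF x(1)])
      next
        fix u assume u: "u \<in> carrier H"
        have "hnorm T (\<tau> (x(k := u))) = hnorm H u * (\<Prod>j\<in>UNIV - {k}. hnorm H (x j))"
          unfolding hnorm_tensor[OF xu[OF u]] by (subst prod.remove[of _ k]) auto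
        then show "cmod (ip T y (\<tau> (x(k := u)))) \<le> hnorm T y * (\<Prod>j\<in>UNIV - {k}. hnorm H (x j)) * hnorm H u"
          using T.cauchy_schwarz[OF y tensor_carrier[OF xu[OF u]]] by (simp add: mult_ac)
      next
        fix u assume u: "u \<in> e ` I"
        then have "u \<in> carrier H" using H.hilbert_basis_image[OF e] by blast
        then show "ip T y (\<tau> (x(k := u))) = 0"
          using insert.IH[rule_format, OF xu] x(2) u by auto
      qed (use x(1) in auto)
      then show "ip T y (\<tau> x) = 0" by simp
    qed
  qed
  from this[OF finite[of UNIV]] have "ip T y (\<tau> x) = 0" if "x \<in> families" for x using that by blast
  then have "ip T (\<tau> x) y = 0" if "x \<in> families" for x
    using that T.ip_cnj[OF y tensor_carrier[OF that]] by simp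
  then show "y = \<zero>\<^bsub>T\<^esub>"
    using y by (intro T.eq_on_total[OF tensor_total tensor_image]) (auto simp: tensor_carrier)
qed

text \<open>
  The images of the basis tensors under symmetric isometries \<open>U j\<close> form an orthonormal family, so
  Bessel's inequality allows to define the tensor product of the \<open>U j\<close> by its coordinates.
\<close>

lemma tensor_of_symmetric_isometries:
  assumes e: "H.hilbert_basis e I"
    and Uc: "\<And>j x. x \<in> carrier H \<Longrightarrow> U j x \<in> carrier H"
    and Us: "\<And>j x y. x \<in> carrier H \<Longrightarrow> y \<in> carrier H \<Longrightarrow> ip H (U j x) y = ip H x (U j y)"
    and Ui: "\<And>j x y. x \<in> carrier H \<Longrightarrow> y \<in> carrier H \<Longrightarrow> ip H (U j x) (U j y) = ip H x y"
  obtains V where "V \<in> bounded_ops T" "\<And>x. x \<in> families \<Longrightarrow> V (\<tau> x) = \<tau> (\<lambda>j. U j (x j))"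
proof -
  let ?I = "(UNIV :: 'd set) \<rightarrow> I"
  have ec: "e i \<in> carrier H" if "i \<in> I" for i using H.hilbert_basis_image[OF e] that by auto
  have ef: "(\<lambda>j. e (s j)) \<in> families" if "s \<in> ?I" for s using that ec by auto
  have Uf: "(\<lambda>j. U j (x j)) \<in> families" if "x \<in> families" for x using that Uc by auto
  note Te = tensor_basis[OF e]
  have o: "T.orthonormal (\<lambda>s. \<tau> (\<lambda>j. U j (e (s j)))) ?I"
  proof -
    have "ip T (\<tau> (\<lambda>j. U j (e (s j)))) (\<tau> (\<lambda>j. U j (e (r j)))) = ip T (\<tau> (\<lambda>j. e (s j))) (\<tau> (\<lambda>j. e (r j)))"
      if "s \<in> ?I" "r \<in> ?I" for s r
      unfolding ip_tensor[OF Uf[OF ef[OF that(1)]] Uf[OF ef[OF that(2)]]] ip_tensor[OF ef[OF that(1)] ef[OF that(2)]]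
      using that ec by (intro prod.cong refl Ui) auto
    then show ?thesis
      using Te Uf ef tensor_carrier by (simp add: T.hilbert_basis_def T.orthonormal_def)
  qed
  obtain V where V: "V \<in> bounded_ops T"
    "\<And>x s. x \<in> carrier T \<Longrightarrow> s \<in> ?I \<Longrightarrow> ip T (\<tau> (\<lambda>j. e (s j))) (V x) = ip T (\<tau> (\<lambda>j. U j (e (s j)))) x"
  proof (rule T.bounded_op_by_coordinates[OF Te, of "\<lambda>s. \<tau> (\<lambda>j. U j (e (s j)))" 1])
    show "(\<Sum>s\<in>F. (cmod (ip T (\<tau> (\<lambda>j. U j (e (s j)))) x))\<^sup>2) \<le> 1 * (hnorm T x)\<^sup>2"
      if "finite F" "F \<subseteq> ?I" "x \<in> carrier T" for F x
      using T.bessel[OF o that] by simp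
  qed (use Uf ef tensor_carrier in auto)
  have "V (\<tau> x) = \<tau> (\<lambda>j. U j (x j))" if x: "x \<in> families" for x
  proof (rule T.hilbert_basis_eqI[OF Te])
    fix s assume s: "s \<in> ?I"
    have xc: "x j \<in> carrier H" for j using x by auto
    have "(\<Prod>j\<in>UNIV. ip H (U j (e (s j))) (x j)) = (\<Prod>j\<in>UNIV. ip H (e (s j)) (U j (x j)))"
      using s ec xc by (intro prod.cong refl Us) auto
    then show "ip T (\<tau> (\<lambda>j. e (s j))) (V (\<tau> x)) = ip T (\<tau> (\<lambda>j. e (s j))) (\<tau> (\<lambda>j. U j (x j)))"
      using V(2)[OF tensor_carrier[OF x] s] by (simp add: ip_tensor Uf ef s x)
  qed (use T.op_carrier[OF V(1)] tensor_carrier x Uf in auto)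
  then show ?thesis using that V(1) by blast
qed

text \<open>
  If every factor is of the form \<open>a + b W\<close> with one symmetric involution \<open>W\<close>, expanding the
  product over the coordinates leaves a finite combination of tensor products of \<open>W\<close> and the identity.
\<close>

lemma tensor_op_exists:
  assumes e: "H.hilbert_basis e I"
    and W: "W \<in> bounded_ops H" "H.symmetric W" "\<And>x. x \<in> carrier H \<Longrightarrow> W (W x) = x"
    and Bc: "\<And>j x. x \<in> carrier H \<Longrightarrow> B j x \<in> carrier H"
    and B: "\<And>j x z. x \<in> carrier H \<Longrightarrow> z \<in> carrier H \<Longrightarrow> ip H z (B j x) = b j * ip H z (W x) + a j * ip H z x"
  shows "\<exists>A\<in>bounded_ops T. \<forall>x\<in>families. A (\<tau> x) = \<tau> (\<lambda>j. B j (x j))"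
proof -
  note Wc = H.op_carrier[OF W(1)]
  let ?U = "\<lambda>J j x. if j \<in> J then W x else x"
  have "\<exists>V\<in>bounded_ops T. \<forall>x\<in>families. V (\<tau> x) = \<tau> (\<lambda>j. ?U J j (x j))" for J :: "'d set"
  proof -
    obtain V where "V \<in> bounded_ops T" "\<And>x. x \<in> families \<Longrightarrow> V (\<tau> x) = \<tau> (\<lambda>j. ?U J j (x j))"
    proof (rule tensor_of_symmetric_isometries[OF e, of "?U J"])
      show "ip H (?U J j x) (?U J j y) = ip H x y" if "x \<in> carrier H" "y \<in> carrier H" for j x y
        using that Wc H.symmetricD[OF W(2), of x "W y"] W(3) by simp
    qed (use Wc H.symmetricD[OF W(2)] in auto)
    then show ?thesis by blast
  qed
  then obtain V where V: "\<And>J. V J \<in> bounded_ops T"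
    "\<And>J x. x \<in> families \<Longrightarrow> V J (\<tau> x) = \<tau> (\<lambda>j. ?U J j (x j))" by metis
  let ?c = "\<lambda>J. (\<Prod>j\<in>J. b j) * (\<Prod>j\<in>UNIV - J. a j)"
  let ?A = "op_sum T (\<lambda>J. \<lambda>x\<in>carrier T. ?c J \<odot>\<^bsub>T\<^esub> V J x) (Pow UNIV)"
  have Ab: "?A \<in> bounded_ops T" by (intro T.bounded_ops_op_sum T.bounded_ops_smult V(1)) simp
  have "?A (\<tau> x) = \<tau> (\<lambda>j. B j (x j))" if x: "x \<in> families" for x
  proof (rule T.eq_on_total[OF tensor_total tensor_image])
    have xc: "x j \<in> carrier H" for j using x by auto
    have Bf: "(\<lambda>j. B j (x j)) \<in> families" using Bc xc by auto
    have Uf: "(\<lambda>j. ?U J j (x j)) \<in> families" for J using Wc xc by auto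
    show "?A (\<tau> x) \<in> carrier T" "\<tau> (\<lambda>j. B j (x j)) \<in> carrier T"
      using T.op_carrier[OF Ab tensor_carrier[OF x]] tensor_carrier[OF Bf] by auto
    fix t assume "t \<in> \<tau> ` families"
    then obtain z where z: "z \<in> families" "t = \<tau> z" by blast
    have zc: "z j \<in> carrier H" for j using z by auto
    note tc = tensor_carrier[OF z(1)]
    have "ip T t (?A (\<tau> x)) = (\<Sum>J\<in>Pow UNIV. ?c J * ip T (\<tau> z) (V J (\<tau> x)))"
      unfolding z(2) op_sum_def using tc tensor_carrier[OF x] T.op_carrier[OF V(1)]
      by (simp add: T.ip_finsum_right Pi_iff)
    also have "\<dots> = (\<Sum>J\<in>Pow UNIV. (\<Prod>j\<in>J. b j * ip H (z j) (W (x j))) * (\<Prod>j\<in>UNIV - J. a j * ip H (z j) (x j)))"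
    proof (intro sum.cong refl)
      fix J :: "'d set"
      have "ip T (\<tau> z) (V J (\<tau> x)) = (\<Prod>j\<in>UNIV. if j \<in> J then ip H (z j) (W (x j)) else ip H (z j) (x j))"
        unfolding V(2)[OF x] ip_tensor[OF z(1) Uf] by (intro prod.cong) auto
      also have "\<dots> = (\<Prod>j\<in>J. ip H (z j) (W (x j))) * (\<Prod>j\<in>UNIV - J. ip H (z j) (x j))"
        by (simp add: prod.If_cases Compl_eq_Diff_UNIV)
      finally show "?c J * ip T (\<tau> z) (V J (\<tau> x)) =
        (\<Prod>j\<in>J. b j * ip H (z j) (W (x j))) * (\<Prod>j\<in>UNIV - J. a j * ip H (z j) (x j))"
        by (simp add: prod.distrib mult_ac)
    qed
    also have "\<dots> = (\<Prod>j\<in>UNIV. b j * ip H (z j) (W (x j)) + a j * ip H (z j) (x j))"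
      by (rule prod_add[symmetric]) simp
    also have "\<dots> = (\<Prod>j\<in>UNIV. ip H (z j) (B j (x j)))" using B xc zc by simp
    also have "\<dots> = ip T t (\<tau> (\<lambda>j. B j (x j)))" unfolding z(2) ip_tensor[OF z(1) Bf] ..
    finally show "ip T t (?A (\<tau> x)) = ip T t (\<tau> (\<lambda>j. B j (x j)))" .
  qed
  then show ?thesis using Ab by blast
qed

lemma
  assumes "\<exists>A\<in>bounded_ops T. \<forall>x\<in>families. A (\<tau> x) = \<tau> (\<lambda>j. B j (x j))"
  shows tensor_op_bounded: "tensor_op H T \<tau> B \<in> bounded_ops T"
    and tensor_op_tensor: "x \<in> families \<Longrightarrow> tensor_op H T \<tau> B (\<tau> x) = \<tau> (\<lambda>j. B j (x j))"
proof -
  obtain A where A: "A \<in> bounded_ops T" "\<forall>x\<in>families. A (\<tau> x) = \<tau> (\<lambda>j. B j (x j))"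
    using assms by blast
  have "tensor_op H T \<tau> B = A"
    unfolding tensor_op_def
  proof (rule the_equality)
    fix A' assume A': "A' \<in> bounded_ops T \<and> (\<forall>x\<in>families. A' (\<tau> x) = \<tau> (\<lambda>j. B j (x j)))"
    show "A' = A"
    proof (rule T.op_eq_on_total[OF tensor_total tensor_image])
      fix t assume "t \<in> \<tau> ` families"
      then obtain x where "x \<in> families" "t = \<tau> x" by blast
      then show "A' t = A t" using A(2) A' by metis
    qed (use A(1) A' in blast)+
  qed (use A in blast)
  then show "tensor_op H T \<tau> B \<in> bounded_ops T"
    "x \<in> families \<Longrightarrow> tensor_op H T \<tau> B (\<tau> x) = \<tau> (\<lambda>j. B j (x j))"
    using A by auto
qed

lemma tensor_op_symmetric:
  assumes e: "T.hilbert_basis e I"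
    and ex: "\<exists>A\<in>bounded_ops T. \<forall>x\<in>families. A (\<tau> x) = \<tau> (\<lambda>j. B j (x j))"
    and Bc: "\<And>j x. x \<in> carrier H \<Longrightarrow> B j x \<in> carrier H"
    and Bs: "\<And>j x y. x \<in> carrier H \<Longrightarrow> y \<in> carrier H \<Longrightarrow> ip H (B j x) y = ip H x (B j y)"
  shows "T.symmetric (tensor_op H T \<tau> B)"
proof -
  let ?A = "tensor_op H T \<tau> B"
  note Ab = tensor_op_bounded[OF ex] and At = tensor_op_tensor[OF ex]
  note Ac = T.op_carrier[OF Ab] and Sb = T.hadjoint_bounded[OF e Ab] 
  note Sc = T.op_carrier[OF Sb]
  have Bf: "(\<lambda>j. B j (x j)) \<in> families" if "x \<in> families" for x using that Bc by auto
  have "hadjoint T ?A = ?A"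
  proof (rule T.op_eq_on_total[OF tensor_total tensor_image Sb Ab])
    fix t assume "t \<in> \<tau> ` families"
    then obtain x where x: "x \<in> families" "t = \<tau> x" by blast
    have tc: "t \<in> carrier T" using tensor_carrier x by blast
    show "hadjoint T ?A t = ?A t"
    proof (rule T.eq_on_total[OF tensor_total tensor_image Sc[OF tc] Ac[OF tc]])
      fix r assume "r \<in> \<tau> ` families"
      then obtain z where z: "z \<in> families" "r = \<tau> z" by blast
      have rc: "r \<in> carrier T" using tensor_carrier z by blast
      have xc: "x j \<in> carrier H" "z j \<in> carrier H" for j using x z by auto
      have "ip T (hadjoint T ?A t) r = ip T t (?A r)" by (rule T.ip_hadjoint[OF e Ab tc rc])
      also have "\<dots> = (\<Prod>j\<in>UNIV. ip H (x j) (B j (z j)))"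
        unfolding x(2) z(2) At[OF z(1)] by (rule ip_tensor[OF x(1) Bf[OF z(1)]])
      also have "\<dots> = (\<Prod>j\<in>UNIV. ip H (B j (x j)) (z j))" using Bs xc by simp
      also have "\<dots> = ip T (?A t) r"
        unfolding x(2) z(2) At[OF x(1)] by (rule ip_tensor[OF Bf[OF x(1)] z(1), symmetric])
      finally show "ip T r (hadjoint T ?A t) = ip T r (?A t)"
        by (rule T.ip_flip[OF Sc[OF tc] rc Ac[OF tc] rc])
    qed
  qed
  then show ?thesis
    using T.ip_hadjoint[OF e Ab] by (simp add: T.symmetric_def)
qed

end

lemma finite_signs: "finite (signs :: (int ^ 'd::finite) set)"
  and sum_prod_signs: "(\<Sum>\<epsilon>\<in>(signs :: (int ^ 'd) set). \<Prod>j\<in>UNIV. F j (\<epsilon> $ j)) =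
    (\<Prod>j\<in>UNIV. \<Sum>s\<in>{-1, 1}. (F j s :: complex))"
proof -
  have bij: "bij_betw vec_lambda (PiE (UNIV :: 'd set) (\<lambda>_. {-1, 1 :: int})) signs"
    by (rule bij_betw_byWitness[where f' = vec_nth]) (auto simp: signs_def PiE_def)
  have fin: "finite (PiE (UNIV :: 'd set) (\<lambda>_. {-1, 1 :: int}))" by (intro finite_PiE) auto
  show "finite (signs :: (int ^ 'd) set)" using bij_betw_finite[OF bij] fin by simp
  have "(\<Prod>j\<in>UNIV. \<Sum>s\<in>{-1, 1}. F j s) = (\<Sum>g\<in>PiE (UNIV :: 'd set) (\<lambda>_. {-1, 1 :: int}). \<Prod>j\<in>UNIV. F j (g j))"
    by (rule prod_sum_PiE) auto
  also have "\<dots> = (\<Sum>\<epsilon>\<in>(signs :: (int ^ 'd) set). \<Prod>j\<in>UNIV. F j (\<epsilon> $ j))"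
    by (rule sum.reindex_bij_betw[OF bij, of "\<lambda>\<epsilon>. \<Prod>j\<in>UNIV. F j (\<epsilon> $ j)", simplified])
  finally show "(\<Sum>\<epsilon>\<in>(signs :: (int ^ 'd) set). \<Prod>j\<in>UNIV. F j (\<epsilon> $ j)) = (\<Prod>j\<in>UNIV. \<Sum>s\<in>{-1, 1}. F j s)" ..
qed

section \<open>The walk on nucleuses\<close>

lemma unitary_conjugate:
  fixes V :: "('a, 'm) inner_space_scheme" and W :: "('b, 'n) inner_space_scheme"
  assumes V: "hilbert V" and W: "hilbert W" and K: "unitary_iso V W K"
    and A: "A \<in> bounded_ops V" "hilbert.symmetric V A"
  defines "L \<equiv> inv_into (carrier V) K"
  defines "C \<equiv> compose (carrier W) K (compose (carrier W) A L)"
  shows "C \<in> bounded_ops W" and "hilbert.symmetric W C"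
    and "h \<in> carrier W \<Longrightarrow> L h \<in> carrier V" and "h \<in> carrier W \<Longrightarrow> hnorm V (L h) = hnorm W h"
    and "h \<in> carrier W \<Longrightarrow> hnorm W (C h) = hnorm V (A (L h))"
proof -
  interpret V: hilbert V by (rule V)
  interpret W: hilbert W by (rule W)
  note D = unitary_isoD[OF K]
  have inj: "inj_on K (carrier V)" and im: "K ` carrier V = carrier W" using D(5) by (auto simp: bij_betw_def)
  have L: "L h \<in> carrier V" "K (L h) = h" if "h \<in> carrier W" for h
    using that im unfolding L_def by (auto intro: inv_into_into f_inv_into_f)
  have KL: "L (K u) = u" if "u \<in> carrier V" for u
    unfolding L_def using that inj by (rule inv_into_f_f[rotated])
  have Ladd: "L (h \<oplus>\<^bsub>W\<^esub> k) = L h \<oplus>\<^bsub>V\<^esub> L k" if "h \<in> carrier W" "k \<in> carrier W" for h k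
    using KL[of "L h \<oplus>\<^bsub>V\<^esub> L k"] that L D(2) by simp
  have Lsmult: "L (c \<odot>\<^bsub>W\<^esub> h) = c \<odot>\<^bsub>V\<^esub> L h" if "h \<in> carrier W" for h c
    using KL[of "c \<odot>\<^bsub>V\<^esub> L h"] that L D(3) by simp
  have ipL: "ip W h (K u) = ip V (L h) u" "ip W (K u) h = ip V u (L h)"
    if "h \<in> carrier W" "u \<in> carrier V" for h u
    using D(4)[of "L h" u] D(4)[of u "L h"] that L by auto
  have normK: "hnorm W (K u) = hnorm V u" if "u \<in> carrier V" for u
    using that by (simp add: hnorm_def D(4))
  note Ac = V.op_carrier[OF A(1)]
  have C: "C h = K (A (L h))" if "h \<in> carrier W" for h using that by (simp add: C_def compose_eq)
  show Lc: "L h \<in> carrier V" if "h \<in> carrier W" for h using L(1)[OF that] .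
  show normL: "hnorm V (L h) = hnorm W h" if "h \<in> carrier W" for h
    using normK[OF L(1)[OF that]] L(2)[OF that] by simp
  show normC: "hnorm W (C h) = hnorm V (A (L h))" if "h \<in> carrier W" for h
    using C[OF that] normK[OF Ac[OF L(1)[OF that]]] by simp
  obtain M where M: "\<And>x. x \<in> carrier V \<Longrightarrow> hnorm V (A x) \<le> M * hnorm V x"
    using V.op_bound[OF A(1)] by metis
  show "C \<in> bounded_ops W"
  proof (rule W.bounded_opsI[where M = M])
    show "hnorm W (C h) \<le> M * hnorm W h" if "h \<in> carrier W" for h
      using M[OF L(1)[OF that]] normC[OF that] normL[OF that] by simp
    show "C h = undefined" if "h \<notin> carrier W" for h using that by (simp add: C_def compose_def)
  qed (use L Ac D in \<open>auto simp: C Ladd Lsmult V.op_add[OF A(1)] V.op_smult[OF A(1)]\<close>)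
  show "W.symmetric C"
    using L Ac V.symmetricD[OF A(2)] by (simp add: W.symmetric_def C ipL)
qed

theorem theorem2p4:
  fixes p :: "nat \<Rightarrow> real"
    and T :: "'t inner_space"
    and \<tau> :: "('d::finite \<Rightarrow> bern_functional) \<Rightarrow> 't"
    and K :: "'t \<Rightarrow> bern_functional"
    and n :: nat
  assumes "CARD('d) \<ge> 2"
    and "\<And>k. 0 < p k \<and> p k < 1"
    and "hilbert_tensor_power (bern_H p) T \<tau>"
    and "unitary_iso T (bern_H p) K"
  shows "\<exists>J. J \<in> nuclei (bern_H p) \<rightarrow> nuclei (bern_H p) \<and>
    (\<forall>\<omega> \<in> nuclei (bern_H p). \<forall>x :: int ^ 'd.
       J \<omega> x = op_sum (bern_H p)
         (\<lambda>\<epsilon>. compose (carrier (bern_H p)) (bern_C p T \<tau> K n \<epsilon>)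
                 (compose (carrier (bern_H p)) (\<omega> (x - \<epsilon>)) (bern_C p T \<tau> K n \<epsilon>)))
         signs)"
proof -
  have T: "hilbert T"
    using assms(3) by (simp add: hilbert_tensor_power_def hilbert_def)
  \<comment> \<open>The completeness of \<open>L\<^sup>2\<close> is inherited from the tensor power through \<open>K\<close>.\<close>
  have H: "hilbert (bern_H p)"
    by (rule unitary_iso_hilbert[OF T assms(4)]) (auto simp: bern_H_def L2_zero_carrier L2_zero_add)
  interpret bernoulli_weights p using assms(2) by unfold_locales auto
  interpret bernoulli p using H by (intro bernoulli.intro bernoulli_weights_axioms)
  interpret tensor_power "bern_H p" T \<tau>
    by (intro tensor_power.intro tensor_power_axioms.intro H T assms(3))
  note basis = tensor_basis[OF Z_basis]
  define B where "B \<epsilon> j = bern_B p n (\<epsilon> $ j)" for \<epsilon> :: "int ^ 'd" and j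
  define A where "A \<epsilon> = tensor_op (bern_H p) T \<tau> (B \<epsilon>)" for \<epsilon>
  have sgn: "\<epsilon> $ j \<in> {-1, 1}" if "\<epsilon> \<in> signs" for \<epsilon> :: "int ^ 'd" and j
    using that by (simp add: signs_def)
  have Bc: "B \<epsilon> j x \<in> carrier H" if "x \<in> carrier H" for \<epsilon> j x
    unfolding B_def by (rule bern_B_carrier[OF that])
  have Bf: "(\<lambda>j. B \<epsilon> j (x j)) \<in> families" if "x \<in> families" for \<epsilon> x using that Bc by auto
  have ex: "\<exists>A\<in>bounded_ops T. \<forall>x\<in>families. A (\<tau> x) = \<tau> (\<lambda>j. B \<epsilon> j (x j))" if "\<epsilon> \<in> signs" for \<epsilon>
  proof (rule tensor_op_exists[OF Z_basis toggle_bounded toggle_symmetric toggle_involution])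
    show "ip H z (B \<epsilon> j x) = (1 / 2) * ip H z (toggle n x) + (of_int (\<epsilon> $ j) / 2) * ip H z x"
      if "x \<in> carrier H" "z \<in> carrier H" for j x z
      unfolding B_def ip_bern_B[OF sgn[OF \<open>\<epsilon> \<in> signs\<close>] that] by (simp add: add_divide_distrib)
  qed (use Bc in auto)
  have Ab: "A \<epsilon> \<in> bounded_ops T" if "\<epsilon> \<in> signs" for \<epsilon>
    unfolding A_def by (rule tensor_op_bounded[OF ex[OF that]])
  have At: "A \<epsilon> (\<tau> x) = \<tau> (\<lambda>j. B \<epsilon> j (x j))" if "\<epsilon> \<in> signs" "x \<in> families" for \<epsilon> x
    unfolding A_def by (rule tensor_op_tensor[OF ex[OF that(1)] that(2)])
  have As: "T.symmetric (A \<epsilon>)" if "\<epsilon> \<in> signs" for \<epsilon>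
    unfolding A_def
  proof (rule tensor_op_symmetric[OF basis ex[OF that] Bc])
    show "ip H (B \<epsilon> j x) y = ip H x (B \<epsilon> j y)" if "x \<in> carrier H" "y \<in> carrier H" for j x y
      unfolding B_def by (rule bern_B_symmetric[OF sgn[OF \<open>\<epsilon> \<in> signs\<close>] that(2,1)])
  qed
  \<comment> \<open>On elementary tensors \<open>\<Sum>\<^sub>\<epsilon> A\<^sub>\<epsilon>\<^sup>2\<close> factorizes over the coordinates into sums of \<open>L\<^sup>2 + R\<^sup>2 = I\<close>.\<close>
  let ?Q = "op_sum T (\<lambda>\<epsilon>. compose (carrier T) (A \<epsilon>) (A \<epsilon>)) signs"
  have Qb: "?Q \<in> bounded_ops T" by (intro T.bounded_ops_op_sum T.bounded_ops_compose finite_signs Ab)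
  have ipQ: "ip T r (?Q t) = (\<Sum>\<epsilon>\<in>signs. ip T r (A \<epsilon> (A \<epsilon> t)))" if "r \<in> carrier T" "t \<in> carrier T" for r t
    using that T.op_carrier[OF Ab] by (simp add: op_sum_def T.ip_finsum_right Pi_iff compose_eq)
  have Q: "?Q = (\<lambda>t\<in>carrier T. t)"
  proof (rule T.op_eq_on_total[OF tensor_total tensor_image Qb T.bounded_ops_id])
    fix t assume "t \<in> \<tau> ` families"
    then obtain x where x: "x \<in> families" "t = \<tau> x" by blast
    have tc: "t \<in> carrier T" using tensor_carrier x by blast
    have "?Q t = t"
    proof (rule T.eq_on_total[OF tensor_total tensor_image T.op_carrier[OF Qb tc] tc])
      fix r assume "r \<in> \<tau> ` families"
      then obtain z where z: "z \<in> families" "r = \<tau> z" by blast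
      have rc: "r \<in> carrier T" using tensor_carrier z by blast
      have xz: "x j \<in> carrier H" "z j \<in> carrier H" for j using x z by auto
      have "ip T r (?Q t) = (\<Sum>\<epsilon>\<in>signs. \<Prod>j\<in>UNIV. ip H (z j) (bern_B p n (\<epsilon> $ j) (bern_B p n (\<epsilon> $ j) (x j))))"
        unfolding ipQ[OF rc tc]
      proof (intro sum.cong refl)
        fix \<epsilon> :: "int ^ 'd" assume \<epsilon>: "\<epsilon> \<in> signs"
        show "ip T r (A \<epsilon> (A \<epsilon> t)) = (\<Prod>j\<in>UNIV. ip H (z j) (bern_B p n (\<epsilon> $ j) (bern_B p n (\<epsilon> $ j) (x j))))"
          unfolding x(2) z(2) At[OF \<epsilon> x(1)] At[OF \<epsilon> Bf[OF x(1)]] ip_tensor[OF z(1) Bf[OF Bf[OF x(1)]]]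
          by (simp add: B_def)
      qed
      also have "\<dots> = (\<Prod>j\<in>UNIV. \<Sum>s\<in>{-1, 1}. ip H (z j) (bern_B p n s (bern_B p n s (x j))))"
        by (rule sum_prod_signs[of "\<lambda>j s. ip H (z j) (bern_B p n s (bern_B p n s (x j)))"])
      also have "\<dots> = (\<Prod>j\<in>UNIV. ip H (z j) (x j))"
        using xz by (intro prod.cong refl bern_B_resolution)
      also have "\<dots> = ip T r t" unfolding x(2) z(2) by (rule ip_tensor[OF z(1) x(1), symmetric])
      finally show "ip T r (?Q t) = ip T r t" .
    qed
    then show "?Q t = (\<lambda>t\<in>carrier T. t) t" using tc by simp
  qed
  have resT: "(\<Sum>\<epsilon>\<in>signs. (hnorm T (A \<epsilon> t))\<^sup>2) = (hnorm T t)\<^sup>2" if t: "t \<in> carrier T" for t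
  proof -
    have "(hnorm T (A \<epsilon> t))\<^sup>2 = Re (ip T t (A \<epsilon> (A \<epsilon> t)))" if "\<epsilon> \<in> signs" for \<epsilon>
      using T.op_carrier[OF Ab[OF that] t] T.symmetricD[OF As[OF that] t] by (simp add: T.hnorm_sq)
    then have "(\<Sum>\<epsilon>\<in>signs. (hnorm T (A \<epsilon> t))\<^sup>2) = Re (ip T t (?Q t))"
      unfolding ipQ[OF t t] by simp
    also have "?Q t = t" unfolding Q using t by simp
    finally show ?thesis by (simp add: T.hnorm_sq t)
  qed
  define L where "L = inv_into (carrier T) K"
  define C where "C = bern_C p T \<tau> K n"
  have C_eq: "C \<epsilon> = compose (carrier H) K (compose (carrier H) (A \<epsilon>) (inv_into (carrier T) K))" for \<epsilon>
    by (simp add: C_def bern_C_def A_def B_def[abs_def])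
  note conj = unitary_conjugate[OF T H assms(4) Ab As, folded C_eq L_def]
  have Cb: "C \<epsilon> \<in> bounded_ops H" and Cs: "symmetric (C \<epsilon>)" if "\<epsilon> \<in> signs" for \<epsilon>
    using conj(1,2) that by auto
  have res: "(\<Sum>\<epsilon>\<in>signs. (hnorm H (C \<epsilon> x))\<^sup>2) = (hnorm H x)\<^sup>2" if x: "x \<in> carrier H" for x
  proof -
    \<comment> \<open>The properties of \<open>L\<close> are stated together with a conjugated operator; any sign vector serves.\<close>
    have \<epsilon>0: "(\<chi> j. 1) \<in> (signs :: (int ^ 'd) set)" by (simp add: signs_def)
    have "(\<Sum>\<epsilon>\<in>signs. (hnorm H (C \<epsilon> x))\<^sup>2) = (\<Sum>\<epsilon>\<in>signs. (hnorm T (A \<epsilon> (L x)))\<^sup>2)"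
      using conj(5) x by simp
    also have "\<dots> = (hnorm T (L x))\<^sup>2" using resT[OF conj(3)[OF \<epsilon>0 \<epsilon>0 x]] .
    also have "\<dots> = (hnorm H x)\<^sup>2" using conj(4)[OF \<epsilon>0 \<epsilon>0 x] by simp
    finally show ?thesis .
  qed
  let ?J = "\<lambda>\<omega> x. op_sum H (\<lambda>\<epsilon>. compose (carrier H) (C \<epsilon>) (compose (carrier H) (\<omega> (x - \<epsilon>)) (C \<epsilon>))) signs"
  have "?J \<omega> \<in> nuclei H" if "\<omega> \<in> nuclei H" for \<omega> :: "int ^ 'd \<Rightarrow> bern_functional \<Rightarrow> bern_functional"
    by (rule nuclei_conjugation[OF Z_sequence_basis finite_signs Cb Cs res that])
  then show ?thesis
    unfolding C_def[symmetric] by (intro exI[of _ ?J] conjI Pi_I ballI allI refl)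
qed

end
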